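(* Let $p$ be a prime and let ${\cal C}$ be a connected finite category whose objects are finite groups and whose morphisms are injective group homomorphisms. Then there exist a discrete group $\Gamma$ and, for each object $Q$ of ${\cal C}$, an injective homomorphism $\iota_Q\colon Q\to\Gamma$, such that for each morphism $\phi\colon Q\to Q'$ of ${\cal C}$ there is $\gamma\in\Gamma$ with $\iota_{Q'}(\phi(q))=\gamma\,\iota_Q(q)\,\gamma^{-1}$ for all $q\in Q$, and such that the induced ring homomorphism $\rho\colon H^*(\Gamma)\to I({\cal C})$, $x\mapsto(\iota_Q^*x)_{Q}$, satisfies: (a) the image of $\rho$ equals $I({\cal C})$; (b) the product of any two elements of ${\rm Ker}(\rho)$ is zero; (c) $\rho$ induces an isomorphism $H^*(\Gamma)/\sqrt0\to I({\cal C})/\sqrt0$; (d) $\Gamma$ has a free normal subgroup of finite index.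
   Context: $H^*(\cdot)$ denotes group cohomology with coefficients in ${\bf F}_p$ (trivial action). For a category ${\cal C}$ of finite groups and injective homomorphisms, $I({\cal C})=\lim_{Q\in{\cal C}}H^*(Q)$, i.e. the subring of $\prod_{Q\in{\cal C}}H^*(Q)$ of families $(x_Q)$ with $\phi^*x_{Q'}=x_Q$ for every morphism $\phi\colon Q\to Q'$. A category is connected if the equivalence relation on objects generated by "there is a morphism from $Q$ to $Q'$" has exactly one class. The elements $\iota_Q^*x$ form a compatible family because conjugation by an element of $\Gamma$ induces the identity on $H^*(\Gamma)$. $\sqrt0$ denotes the nilradical. *)

theory Defs
  imports "HOL-Algebra.Algebra" "HOL-Computational_Algebra.Primes"
begin

section \<open>Group cohomology with coefficients in F_p (trivial action), via inhomogeneous cochains\<close>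

text \<open>A (total) cochain of the group G is a function on lists of group elements;
 its restriction to lists of length n is the degree-n component. Values are
 residues in {0..<p} (i.e. elements of F_p), the function vanishes on lists
 not in the carrier, and only finitely many degrees are nonzero.\<close>

definition cochains :: "nat \<Rightarrow> ('a, 'b) monoid_scheme \<Rightarrow> ('a list \<Rightarrow> int) set" where
  "cochains p G = {f. (\<forall>xs. f xs \<in> {0..<int p}) \<and>
                      (\<forall>xs. \<not> set xs \<subseteq> carrier G \<longrightarrow> f xs = 0) \<and>
                      (\<exists>N. \<forall>xs. N < length xs \<longrightarrow> f xs = 0)}"

text \<open>merge_at G i [g1,...,g(n+1)] = [g1,...,g(i-1), gi*g(i+1), g(i+2), ...] for 1 <= i <= n\<close>
definition merge_at :: "('a, 'b) monoid_scheme \<Rightarrow> nat \<Rightarrow> 'a list \<Rightarrow> 'a list" where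
  "merge_at G i xs = take (i - 1) xs @ [xs ! (i - 1) \<otimes>\<^bsub>G\<^esub> xs ! i] @ drop (i + 1) xs"

text \<open>Standard coboundary (trivial action):
 (df)(g1..g(n+1)) = f(g2..g(n+1)) + sum_{i=1..n} (-1)^i f(..., gi g(i+1), ...) + (-1)^(n+1) f(g1..gn).\<close>
definition cobdry :: "nat \<Rightarrow> ('a, 'b) monoid_scheme \<Rightarrow> ('a list \<Rightarrow> int) \<Rightarrow> ('a list \<Rightarrow> int)" where
  "cobdry p G f = (\<lambda>xs. if xs \<noteq> [] \<and> set xs \<subseteq> carrier G then
       (f (tl xs) + (\<Sum>i\<in>{1..<length xs}. (-1) ^ i * f (merge_at G i xs))
          + (-1) ^ length xs * f (butlast xs)) mod int p
     else 0)"

definition cocycles :: "nat \<Rightarrow> ('a, 'b) monoid_scheme \<Rightarrow> ('a list \<Rightarrow> int) set" where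
  "cocycles p G = {f \<in> cochains p G. cobdry p G f = (\<lambda>_. 0)}"

definition coboundaries :: "nat \<Rightarrow> ('a, 'b) monoid_scheme \<Rightarrow> ('a list \<Rightarrow> int) set" where
  "coboundaries p G = {f. \<exists>h \<in> cochains p G. f = cobdry p G h}"

text \<open>Cup product: (f u g)(g1..g(m+n)) = f(g1..gm) g(g(m+1)..g(m+n)), summed over all splittings
 (which is the graded cup product on total cochains).\<close>
definition cup :: "nat \<Rightarrow> ('a list \<Rightarrow> int) \<Rightarrow> ('a list \<Rightarrow> int) \<Rightarrow> ('a list \<Rightarrow> int)" where
  "cup p f g = (\<lambda>xs. (\<Sum>k\<le>length xs. f (take k xs) * g (drop k xs)) mod int p)"

definition cocycle_ring :: "nat \<Rightarrow> ('a, 'b) monoid_scheme \<Rightarrow> ('a list \<Rightarrow> int) ring" where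
  "cocycle_ring p G =
     \<lparr>carrier = cocycles p G, monoid.mult = cup p,
      one = (\<lambda>xs. if xs = [] then 1 else 0), ring.zero = (\<lambda>xs. 0),
      ring.add = (\<lambda>f g xs. (f xs + g xs) mod int p)\<rparr>"

text \<open>H^*(G) = Z^*(G) / B^*(G), the cohomology ring with F_p coefficients.\<close>
definition cohom_ring :: "nat \<Rightarrow> ('a, 'b) monoid_scheme \<Rightarrow> ('a list \<Rightarrow> int) set ring" where
  "cohom_ring p G = cocycle_ring p G Quot coboundaries p G"

text \<open>Pullback of cochains along a homomorphism phi : Q -> G, and induced map phi^* on cohomology.\<close>
definition pullback :: "('a, 'b) monoid_scheme \<Rightarrow> ('a \<Rightarrow> 'c) \<Rightarrow> ('c list \<Rightarrow> int) \<Rightarrow> ('a list \<Rightarrow> int)" where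
  "pullback Q \<phi> z = (\<lambda>xs. if set xs \<subseteq> carrier Q then z (map \<phi> xs) else 0)"

definition res :: "nat \<Rightarrow> ('a, 'b) monoid_scheme \<Rightarrow> ('a \<Rightarrow> 'c) \<Rightarrow> ('c list \<Rightarrow> int) set \<Rightarrow> ('a list \<Rightarrow> int) set" where
  "res p Q \<phi> Xc = Union ((\<lambda>z. a_r_coset (cocycle_ring p Q) (coboundaries p Q) (pullback Q \<phi> z)) ` Xc)"

section \<open>The ring I(C) = lim H^*(Q)\<close>

text \<open>Objects are indexed by Obj; G Q is the group of object Q; Mor Q Q' is the set of morphisms.\<close>
definition compat_ring :: "nat \<Rightarrow> 'i set \<Rightarrow> ('i \<Rightarrow> 'a monoid) \<Rightarrow> ('i \<Rightarrow> 'i \<Rightarrow> ('a \<Rightarrow> 'a) set)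
    \<Rightarrow> ('i \<Rightarrow> ('a list \<Rightarrow> int) set) ring" where
  "compat_ring p Obj G Mor =
     \<lparr>carrier = {x \<in> (\<Pi>\<^sub>E Q\<in>Obj. carrier (cohom_ring p (G Q))).
                   \<forall>Q\<in>Obj. \<forall>Q'\<in>Obj. \<forall>\<phi>\<in>Mor Q Q'. res p (G Q) \<phi> (x Q') = x Q},
      monoid.mult = (\<lambda>x y. \<lambda>Q\<in>Obj. x Q \<otimes>\<^bsub>cohom_ring p (G Q)\<^esub> y Q),
      one = (\<lambda>Q\<in>Obj. \<one>\<^bsub>cohom_ring p (G Q)\<^esub>),
      ring.zero = (\<lambda>Q\<in>Obj. \<zero>\<^bsub>cohom_ring p (G Q)\<^esub>),
      ring.add = (\<lambda>x y. \<lambda>Q\<in>Obj. x Q \<oplus>\<^bsub>cohom_ring p (G Q)\<^esub> y Q)\<rparr>"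

text \<open>rho : H^*(Gamma) -> I(C), x |-> (iota_Q^* x)_Q\<close>
definition rho :: "nat \<Rightarrow> 'i set \<Rightarrow> ('i \<Rightarrow> 'a monoid) \<Rightarrow> ('i \<Rightarrow> 'a \<Rightarrow> 'g)
    \<Rightarrow> ('g list \<Rightarrow> int) set \<Rightarrow> ('i \<Rightarrow> ('a list \<Rightarrow> int) set)" where
  "rho p Obj G \<iota> Xc = (\<lambda>Q\<in>Obj. res p (G Q) (\<iota> Q) Xc)"

definition nilrad :: "('a, 'b) ring_scheme \<Rightarrow> 'a set" where
  "nilrad R = {x \<in> carrier R. \<exists>n::nat. x [^]\<^bsub>R\<^esub> n = \<zero>\<^bsub>R\<^esub>}"

section \<open>Categories of finite groups and injective homomorphisms\<close>

definition finite_inj_group_category :: "'i set \<Rightarrow> ('i \<Rightarrow> 'a monoid) \<Rightarrow> ('i \<Rightarrow> 'i \<Rightarrow> ('a \<Rightarrow> 'a) set) \<Rightarrow> bool" where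
  "finite_inj_group_category Obj G Mor \<longleftrightarrow>
     finite Obj \<and>
     (\<forall>Q\<in>Obj. group (G Q) \<and> finite (carrier (G Q))) \<and>
     (\<forall>Q\<in>Obj. \<forall>Q'\<in>Obj. finite (Mor Q Q') \<and>
        (\<forall>\<phi>\<in>Mor Q Q'. \<phi> \<in> hom (G Q) (G Q') \<and> inj_on \<phi> (carrier (G Q)) \<and>
                         \<phi> \<in> extensional (carrier (G Q)))) \<and>
     (\<forall>Q\<in>Obj. (\<lambda>x\<in>carrier (G Q). x) \<in> Mor Q Q) \<and>
     (\<forall>Q\<in>Obj. \<forall>Q'\<in>Obj. \<forall>Q''\<in>Obj. \<forall>\<phi>\<in>Mor Q Q'. \<forall>\<psi>\<in>Mor Q' Q''.
         (\<lambda>x\<in>carrier (G Q). \<psi> (\<phi> x)) \<in> Mor Q Q'')"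

definition connected_category :: "'i set \<Rightarrow> ('i \<Rightarrow> 'i \<Rightarrow> 'm set) \<Rightarrow> bool" where
  "connected_category Obj Mor \<longleftrightarrow> Obj \<noteq> {} \<and>
     (let R = {(Q, Q'). Q \<in> Obj \<and> Q' \<in> Obj \<and> Mor Q Q' \<noteq> {}} in
        \<forall>Q\<in>Obj. \<forall>Q'\<in>Obj. (Q, Q') \<in> (R \<union> R\<inverse>)\<^sup>*)"

section \<open>Free groups\<close>

text \<open>Words in S and its inverses: (True, s) stands for s, (False, s) for s^-1.\<close>
definition reduced_word :: "(bool \<times> 'g) list \<Rightarrow> bool" where
  "reduced_word w \<longleftrightarrow> (\<forall>i. Suc i < length w \<longrightarrow>
      \<not> (snd (w ! i) = snd (w ! Suc i) \<and> fst (w ! i) \<noteq> fst (w ! Suc i)))"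

definition eval_word :: "('g, 'b) monoid_scheme \<Rightarrow> (bool \<times> 'g) list \<Rightarrow> 'g" where
  "eval_word \<Gamma> w = foldr (\<lambda>(b, s) acc. (if b then s else inv\<^bsub>\<Gamma>\<^esub> s) \<otimes>\<^bsub>\<Gamma>\<^esub> acc) w \<one>\<^bsub>\<Gamma>\<^esub>"

text \<open>N is a free (sub)group of Gamma: it has a free basis S.\<close>
definition free_subgroup :: "('g, 'b) monoid_scheme \<Rightarrow> 'g set \<Rightarrow> bool" where
  "free_subgroup \<Gamma> N \<longleftrightarrow> (\<exists>S \<subseteq> N. generate \<Gamma> S = N \<and>
      (\<forall>w. w \<noteq> [] \<and> set (map snd w) \<subseteq> S \<and> reduced_word w \<longrightarrow> eval_word \<Gamma> w \<noteq> \<one>\<^bsub>\<Gamma>\<^esub>))"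

end

(* Let Gamma be generated by the groups Q of the category and one stable letter for each morphism phi,
   which conjugates Q to phi(Q); that is, Gamma acts on a tree with vertex and edge stabilisers
   conjugates of the groups Q and of a trivial group (a base vertex with free orbit makes a choice of
   maximal tree unnecessary). Cochains with values in functions on the vertices and edges give a short
   exact sequence 0 -> F_p -> F_p^vertices -> F_p^edges -> 0, whose long exact sequence together with
   Shapiro's lemma shows that H^*(Gamma) maps onto the limit. If z = dc and z' = dc' with c, c' valued in
   functions on the vertices, then the edge difference of c u z' is the coboundary of a cup product on
   the edges, so c u z' can be corrected to a cochain of Gamma bounding z u z'.

   All groups Q act freely on their product Y, and two free actions of Q on a finite set are conjugate,
   so Gamma maps to the symmetric group K of Y, injectively on each Q. After adding free
   stable letters at the base vertex, one for each nontrivial element of K, these letters are a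
   transversal of the kernel, and the Reidemeister-Schreier generators of the kernel reduce to a free
   basis; freeness is seen on an action of Gamma on K x (reduced words). *)

theory Submission
  imports Defs "HOL-Library.Countable_Set"
begin

section \<open>The bar complex of an action groupoid\<close>

text \<open>Cochains are integer-valued functions on lists, and F_p enters only as divisibility by
  \<open>p\<close>. The divisor is a parameter \<open>c\<close> in the basic estimates, so that
  \<open>c = 0\<close> turns each of them into an equality. A cochain with values in functions on a
  G-set is a cochain on the composable strings of the action groupoid. One differential therefore
  serves trivial coefficients (a one-point set) and coinduced ones (left-invariant functions on G),
  and Shapiro's lemma comes from functors and natural transformations with explicit homotopies. The
  tree enters only through two statements about functions on Gamma: invariant functions are
  constant, and prescribed edge differences can be attained. They express connectedness and the
  absence of cycles. Both are read off from the presentation, the second by letting Gamma act on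
  Gamma x Z. The trivial group at the base vertex contributes F_p in degree 0 and is joined to all
  objects at once. A compatible family must therefore have a single degree-0 value, which is where
  connectedness of the category enters.\<close>

text \<open>The bar differential without its first face, which is the only face that moves the base
  point. In the recursion on the first letter the signs alternate by themselves.\<close>

fun bar :: "('g, 'b) monoid_scheme \<Rightarrow> ('g list \<Rightarrow> int) \<Rightarrow> 'g list \<Rightarrow> int" where
  "bar G f [] = 0"
| "bar G f [x] = - f []"
| "bar G f (x # y # xs) = - f ((x \<otimes>\<^bsub>G\<^esub> y) # xs) - bar G (\<lambda>zs. f (x # zs)) (y # xs)"

text \<open>On the empty list this is the last face, so that \<open>bar_Cons\<close> holds for
  strings of every positive length.\<close>

definition merge_hd :: "('g, 'b) monoid_scheme \<Rightarrow> 'g \<Rightarrow> ('g list \<Rightarrow> int) \<Rightarrow> 'g list \<Rightarrow> int" where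
  "merge_hd G x f zs = (case zs of [] \<Rightarrow> f [] | y # ys \<Rightarrow> f ((x \<otimes>\<^bsub>G\<^esub> y) # ys))"

lemma merge_hd_simps [simp]:
  "merge_hd G x f [] = f []" "merge_hd G x f (y # ys) = f ((x \<otimes>\<^bsub>G\<^esub> y) # ys)"
  by (simp_all add: merge_hd_def)

lemma bar_Cons: "bar G f (x # zs) = - merge_hd G x f zs - bar G (\<lambda>ys. f (x # ys)) zs"
  by (cases zs) auto

lemma bar_add: "bar G (\<lambda>zs. f zs + g zs) xs = bar G f xs + bar G g xs"
  by (induction G f xs arbitrary: g rule: bar.induct) auto

lemma bar_scale: "bar G (\<lambda>zs. c * f zs) xs = c * bar G f xs"
  by (induction G f xs rule: bar.induct) (auto simp: algebra_simps)

lemma bar_uminus: "bar G (\<lambda>zs. - f zs) xs = - bar G f xs"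
  using bar_scale[of G "-1" f xs] by simp

lemma bar_diff: "bar G (\<lambda>zs. f zs - g zs) xs = bar G f xs - bar G g xs"
  using bar_add[of G f "\<lambda>zs. - g zs" xs] by (simp add: bar_uminus)

lemma bar_zero [simp]: "bar G (\<lambda>zs. 0) xs = 0"
  using bar_scale[of G 0 "\<lambda>_. 0" xs] by simp

lemma (in monoid) bar_dvd:
  assumes "set xs \<subseteq> carrier G" "\<And>ys. set ys \<subseteq> carrier G \<Longrightarrow> c dvd f ys"
  shows "c dvd bar G f xs"
  using assms
proof (induction xs arbitrary: f)
  case (Cons x xs)
  have "c dvd bar G (\<lambda>zs. f (x # zs)) xs"
    using Cons by auto
  moreover have "c dvd merge_hd G x f xs"
    using Cons.prems by (cases xs) auto
  ultimately show ?case by (simp add: bar_Cons)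
qed simp

lemma (in monoid) bar_cong:
  assumes "set xs \<subseteq> carrier G" "\<And>ys. set ys \<subseteq> carrier G \<Longrightarrow> f ys = g ys"
  shows "bar G f xs = bar G g xs"
  using bar_dvd[OF assms(1), of 0 "\<lambda>ys. f ys - g ys"] assms(2) by (simp add: bar_diff)

lemma (in monoid) bar_merge_hd:
  assumes "x \<in> carrier G" "y \<in> carrier G" "set xs \<subseteq> carrier G"
  shows "bar G (merge_hd G x f) (y # xs) = bar G f ((x \<otimes> y) # xs)"
  using assms by (cases xs) (auto simp: m_assoc)

text \<open>After peeling one letter, the mixed term \<open>bar (merge_hd x f)\<close> is
  \<open>bar f\<close> with the first two letters merged. It cancels the merged term of the outer
  \<open>bar\<close>, and the rest is the induction hypothesis.\<close>

lemma (in monoid) bar_bar: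
  assumes "set xs \<subseteq> carrier G"
  shows "bar G (bar G f) xs = 0"
  using assms
proof (induction xs arbitrary: f)
  case (Cons x xs)
  show ?case
  proof (cases xs)
    case (Cons y ys)
    have "bar G (\<lambda>zs. bar G f (x # zs)) xs =
        - bar G (merge_hd G x f) xs - bar G (bar G (\<lambda>ys. f (x # ys))) xs"
      unfolding bar_Cons using bar_diff[of G "\<lambda>zs. - merge_hd G x f zs" _ xs]
      by (simp add: bar_uminus)
    moreover have "bar G (bar G (\<lambda>ys. f (x # ys))) xs = 0"
      using Cons.IH Cons.prems by simp
    moreover have "bar G (merge_hd G x f) xs = bar G f ((x \<otimes> y) # ys)"
      using Cons Cons.prems by (simp add: bar_merge_hd)
    ultimately show ?thesis using Cons by simp
  qed simp
qed simp

section \<open>Cochains with values in functions on a G-set\<close>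

text \<open>\<open>f xs s\<close> is the value on the string of arrows \<open>xs\<close> that starts
  at the object \<open>s\<close> of the action groupoid; dropping the first arrow moves the start
  along it. The differential raises degrees, hence the value 0 on \<open>[]\<close>.\<close>

definition dd :: "('g, 'b) monoid_scheme \<Rightarrow> ('s \<Rightarrow> 'g \<Rightarrow> 's) \<Rightarrow> ('g list \<Rightarrow> 's \<Rightarrow> int) \<Rightarrow> 'g list \<Rightarrow> 's \<Rightarrow> int" where
  "dd G act f xs s = (if xs = [] then 0 else f (tl xs) (act s (hd xs)) + bar G (\<lambda>zs. f zs s) xs)"

lemma dd_simps [simp]:
  "dd G act f [] s = 0"
  "dd G act f (x # xs) s = f xs (act s x) + bar G (\<lambda>zs. f zs s) (x # xs)"
  by (simp_all add: dd_def)

lemma dd_diff: "dd G act (\<lambda>xs s. f xs s - g xs s) xs s = dd G act f xs s - dd G act g xs s"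
  by (simp add: dd_def bar_diff)

locale right_action = group G for G (structure) +
  fixes S :: "'s set" and act :: "'s \<Rightarrow> 'a \<Rightarrow> 's"
  assumes act_closed [simp]: "\<lbrakk>s \<in> S; x \<in> carrier G\<rbrakk> \<Longrightarrow> act s x \<in> S"
    and act_mult: "\<lbrakk>s \<in> S; x \<in> carrier G; y \<in> carrier G\<rbrakk> \<Longrightarrow> act s (x \<otimes> y) = act (act s x) y"
begin

lemma dd_dvd:
  assumes "set xs \<subseteq> carrier G" "s \<in> S"
    and "\<And>ys t. set ys \<subseteq> carrier G \<Longrightarrow> t \<in> S \<Longrightarrow> c dvd f ys t"
  shows "c dvd dd G act f xs s"
proof (cases xs)
  case (Cons x ys)
  then have "c dvd bar G (\<lambda>zs. f zs s) (x # ys)"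
    using assms by (intro bar_dvd) auto
  then show ?thesis using Cons assms by simp
qed simp

lemma dd_cong:
  assumes "set xs \<subseteq> carrier G" "s \<in> S"
    and "\<And>ys t. set ys \<subseteq> carrier G \<Longrightarrow> t \<in> S \<Longrightarrow> c dvd f ys t - g ys t"
  shows "c dvd dd G act f xs s - dd G act g xs s"
  using dd_dvd[OF assms(1,2), of c "\<lambda>xs s. f xs s - g xs s"] assms(3) by (simp add: dd_diff)

text \<open>After \<open>bar_bar\<close> only terms with a first face remain. They cancel because
  dropping a merged arrow ends at the same object as dropping its two factors in turn.\<close>

lemma dd_dd:
  assumes "set xs \<subseteq> carrier G" "s \<in> S"
  shows "dd G act (dd G act f) xs s = 0"
proof (cases xs)
  case (Cons x ys)
  have *: "bar G (\<lambda>zs. dd G act f zs s) xs =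
      bar G (\<lambda>zs. if zs = [] then 0 else f (tl zs) (act s (hd zs))) xs"
  proof -
    have "(\<lambda>zs. dd G act f zs s) =
        (\<lambda>zs. (if zs = [] then 0 else f (tl zs) (act s (hd zs))) + bar G (\<lambda>zs. f zs s) zs)"
      by (auto simp: dd_def)
    then show ?thesis using bar_bar[OF assms(1)] by (simp add: bar_add)
  qed
  show ?thesis
  proof (cases ys)
    case Nil
    then show ?thesis using Cons * by (simp add: dd_def)
  next
    case (Cons y zs)
    then show ?thesis using \<open>xs = x # ys\<close> * assms by (simp add: act_mult dd_def)
  qed
qed simp

end

section \<open>Cup products and the Leibniz rule\<close>

text \<open>The left factor keeps the start of the whole string as its base point, which is
  therefore frozen into \<open>F\<close>. Only the right factor sees the moving point.\<close>

fun cupa :: "('s \<Rightarrow> 'g \<Rightarrow> 's) \<Rightarrow> ('g list \<Rightarrow> int) \<Rightarrow> ('g list \<Rightarrow> 's \<Rightarrow> int) \<Rightarrow> 's \<Rightarrow> 'g list \<Rightarrow> int" where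
  "cupa act F g s [] = F [] * g [] s"
| "cupa act F g s (x # xs) = F [] * g (x # xs) s + cupa act (\<lambda>zs. F (x # zs)) g (act s x) xs"

definition cupf :: "('s \<Rightarrow> 'g \<Rightarrow> 's) \<Rightarrow> ('g list \<Rightarrow> 's \<Rightarrow> int) \<Rightarrow> ('g list \<Rightarrow> 's \<Rightarrow> int) \<Rightarrow> 'g list \<Rightarrow> 's \<Rightarrow> int" where
  "cupf act f g xs s = cupa act (\<lambda>zs. f zs s) g s xs"

text \<open>Total cochains have components in several degrees, so the sign of the Leibniz rule has
  to be an operator.\<close>

definition alt :: "('g list \<Rightarrow> int) \<Rightarrow> 'g list \<Rightarrow> int" where
  "alt f xs = (-1) ^ length xs * f xs"

lemma alt_Nil [simp]: "alt f [] = f []"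
  by (simp add: alt_def)

lemma alt_Cons: "alt f (x # xs) = - alt (\<lambda>zs. f (x # zs)) xs"
  by (simp add: alt_def)

lemma alt_alt [simp]: "alt (alt f) = f"
  by (auto simp: alt_def simp flip: mult.assoc power_mult_distrib)

lemma cupa_add: "cupa act (\<lambda>zs. f zs + f' zs) g s xs = cupa act f g s xs + cupa act f' g s xs"
  by (induction xs arbitrary: f f' s) (auto simp: algebra_simps)

lemma cupa_scale: "cupa act (\<lambda>zs. c * f zs) g s xs = c * cupa act f g s xs"
  by (induction act f g s xs rule: cupa.induct) (auto simp: algebra_simps)

lemma cupa_uminus: "cupa act (\<lambda>zs. - f zs) g s xs = - cupa act f g s xs"
  using cupa_scale[of act "-1" f g s xs] by simp

lemma cupa_diff: "cupa act (\<lambda>zs. f zs - f' zs) g s xs = cupa act f g s xs - cupa act f' g s xs"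
  using cupa_add[of act f "\<lambda>zs. - f' zs" g s xs] by (simp add: cupa_uminus)

lemma cupa_add_right: "cupa act f (\<lambda>xs s. g xs s + g' xs s) s xs = cupa act f g s xs + cupa act f g' s xs"
  by (induction act f g s xs rule: cupa.induct) (auto simp: algebra_simps)

lemma cupa_diff_right: "cupa act f (\<lambda>xs s. g xs s - g' xs s) s xs = cupa act f g s xs - cupa act f g' s xs"
  by (induction act f g s xs rule: cupa.induct) (auto simp: algebra_simps)

lemma cupa_dvd_left:
  assumes "set xs \<subseteq> A" "\<And>ys. set ys \<subseteq> A \<Longrightarrow> c dvd f ys"
  shows "c dvd cupa act f g s xs"
  using assms by (induction act f g s xs rule: cupa.induct) (auto intro!: dvd_add dvd_mult2)

context right_action
begin

lemma cupa_dvd_right: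
  assumes "set xs \<subseteq> carrier G" "s \<in> S"
    and "\<And>ys t. set ys \<subseteq> carrier G \<Longrightarrow> t \<in> S \<Longrightarrow> c dvd g ys t"
  shows "c dvd cupa act f g s xs"
  using assms(1,2)
proof (induction xs arbitrary: f s)
  case (Cons x xs)
  then show ?case using assms(3)[of "x # xs" s] by (auto intro!: dvd_add dvd_mult)
qed (use assms(3) in auto)

text \<open>The last face of the left factor cancels the first face of the right factor. This is why
  the full \<open>dd\<close> stands on the right, while the left factor carries only
  \<open>bar\<close>; its first face is added in \<open>leibniz\<close>.\<close>

lemma bar_cupa:
  assumes "set xs \<subseteq> carrier G" "s \<in> S"
  shows "bar G (cupa act f g s) xs =
    cupa act (bar G f) g s xs + cupa act (alt f) (dd G act g) s xs"
  using assms
proof (induction xs arbitrary: f s)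
  case (Cons x xs)
  have 1: "cupa act (\<lambda>zs. bar G f (x # zs)) g (act s x) xs =
      - cupa act (merge_hd G x f) g (act s x) xs - cupa act (bar G (\<lambda>ys. f (x # ys))) g (act s x) xs"
    unfolding bar_Cons using cupa_diff[of act "\<lambda>zs. - merge_hd G x f zs"] by (simp add: cupa_uminus)
  have 2: "cupa act (\<lambda>zs. alt f (x # zs)) (dd G act g) (act s x) xs =
      - cupa act (alt (\<lambda>zs. f (x # zs))) (dd G act g) (act s x) xs"
    unfolding alt_Cons by (rule cupa_uminus)
  have 3: "bar G (\<lambda>zs. cupa act f g s (x # zs)) xs =
      f [] * bar G (\<lambda>zs. g (x # zs) s) xs + bar G (cupa act (\<lambda>zs. f (x # zs)) g (act s x)) xs"
    by (simp add: bar_add bar_scale)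
  show ?case
  proof (cases xs)
    case Nil
    then show ?thesis by (simp add: algebra_simps)
  next
    case (Cons y ys)
    have IH: "bar G (cupa act (\<lambda>zs. f (x # zs)) g (act s x)) xs =
      cupa act (bar G (\<lambda>zs. f (x # zs))) g (act s x) xs +
      cupa act (alt (\<lambda>zs. f (x # zs))) (dd G act g) (act s x) xs"
      using Cons.prems by (intro Cons.IH) auto
    have "act s (x \<otimes> y) = act (act s x) y"
      using Cons Cons.prems by (simp add: act_mult)
    moreover have "bar G (cupa act f g s) (x # xs) = - cupa act f g s ((x \<otimes> y) # ys)
        - bar G (\<lambda>zs. cupa act f g s (x # zs)) xs"
      using Cons by simp
    moreover have "cupa act (bar G f) g s (x # xs) = cupa act (\<lambda>zs. bar G f (x # zs)) g (act s x) xs"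
      by simp
    moreover have "cupa act (alt f) (dd G act g) s (x # xs) =
        f [] * dd G act g (x # xs) s + cupa act (\<lambda>zs. alt f (x # zs)) (dd G act g) (act s x) xs"
      by simp
    moreover have "cupa act (merge_hd G x f) g (act s x) xs = f [] * g xs (act s x)
        + cupa act (\<lambda>zs. f ((x \<otimes> y) # zs)) g (act (act s x) y) ys"
      using Cons by simp
    moreover have "f [] * dd G act g (x # xs) s = f [] * g xs (act s x) - f [] * g ((x \<otimes> y) # ys) s
        - f [] * bar G (\<lambda>zs. g (x # zs) s) xs"
      using Cons by (simp add: algebra_simps)
    moreover have "cupa act f g s ((x \<otimes> y) # ys) = f [] * g ((x \<otimes> y) # ys) s
        + cupa act (\<lambda>zs. f ((x \<otimes> y) # zs)) g (act s (x \<otimes> y)) ys"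
      by simp
    ultimately show ?thesis using 1 2 3 IH by (simp only:)
  qed
qed simp

lemma leibniz:
  assumes "set xs \<subseteq> carrier G" "s \<in> S"
  shows "dd G act (cupf act f g) xs s =
    cupf act (dd G act f) g xs s + cupf act (\<lambda>xs s. alt (\<lambda>zs. f zs s) xs) (dd G act g) xs s"
proof (cases xs)
  case (Cons x ys)
  have "(\<lambda>zs. dd G act f (x # zs) s) = (\<lambda>zs. f zs (act s x) + bar G (\<lambda>zs. f zs s) (x # zs))"
    by auto
  then have "cupf act (dd G act f) g xs s = cupa act (\<lambda>zs. f zs (act s x)) g (act s x) ys
      + cupa act (bar G (\<lambda>zs. f zs s)) g s xs"
    using Cons by (simp add: cupf_def cupa_add)
  then show ?thesis
    using Cons bar_cupa[OF assms, of "\<lambda>zs. f zs s" g] by (simp add: cupf_def dd_def)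
qed (simp add: cupf_def)

lemma dd_alt: "dd G act (\<lambda>xs s. alt (\<lambda>zs. f zs s) xs) xs s = - alt (\<lambda>zs. dd G act f zs s) xs"
proof -
  have *: "bar G (alt F) ys = - alt (bar G F) ys" for F ys
  proof (induction ys arbitrary: F)
    case (Cons y ys)
    have "bar G (\<lambda>zs. alt F (y # zs)) ys = alt (bar G (\<lambda>zs. F (y # zs))) ys"
      unfolding alt_Cons by (simp add: bar_uminus Cons.IH)
    moreover have "merge_hd G y (alt F) ys = alt (merge_hd G y F) ys"
      by (cases ys) (auto simp: alt_def)
    ultimately show ?case
      unfolding bar_Cons by (simp add: alt_Cons bar_Cons[abs_def]) (simp add: alt_def algebra_simps)
  qed (simp add: alt_def)
  show ?thesis
  proof (cases xs)
    case (Cons x ys)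
    have "bar G (\<lambda>zs. alt (\<lambda>zs. f zs s) zs) (x # ys) = - alt (bar G (\<lambda>zs. f zs s)) (x # ys)"
      by (rule *)
    then show ?thesis using Cons by (simp only: dd_simps alt_def) (simp add: algebra_simps)
  qed simp
qed

end

text \<open>\<open>arrows\<close> applies a functor, given on arrows by \<open>r\<close>, to a composable string of the action groupoid.\<close>

fun arrows :: "('s \<Rightarrow> 'g \<Rightarrow> 's) \<Rightarrow> ('s \<Rightarrow> 'g \<Rightarrow> 'h) \<Rightarrow> 's \<Rightarrow> 'g list \<Rightarrow> 'h list" where
  "arrows act r s [] = []"
| "arrows act r s (x # xs) = r s x # arrows act r (act s x) xs"

lemma arrows_const: "arrows act (\<lambda>_. f) s xs = map f xs"
  by (induction xs arbitrary: s) auto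

text \<open>The homotopy induced by a natural transformation \<open>\<eta>\<close> from the identity to the functor \<open>r\<close>.\<close>

fun prism :: "('s \<Rightarrow> 'g \<Rightarrow> 's) \<Rightarrow> ('s \<Rightarrow> 'g) \<Rightarrow> ('s \<Rightarrow> 'g \<Rightarrow> 'g) \<Rightarrow> ('g list \<Rightarrow> int) \<Rightarrow> 's \<Rightarrow> 'g list \<Rightarrow> int" where
  "prism act \<eta> r F s [] = F [\<eta> s]"
| "prism act \<eta> r F s (x # xs) = F (\<eta> s # arrows act r s (x # xs)) - prism act \<eta> r (\<lambda>zs. F (x # zs)) (act s x) xs"

lemma prism_add: "prism act \<eta> r (\<lambda>zs. f zs + f' zs) s xs = prism act \<eta> r f s xs + prism act \<eta> r f' s xs"
  by (induction act \<eta> r f s xs arbitrary: f' rule: prism.induct) auto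

lemma prism_uminus: "prism act \<eta> r (\<lambda>zs. - f zs) s xs = - prism act \<eta> r f s xs"
  by (induction act \<eta> r f s xs rule: prism.induct) auto

lemma prism_diff: "prism act \<eta> r (\<lambda>zs. f zs - f' zs) s xs = prism act \<eta> r f s xs - prism act \<eta> r f' s xs"
  using prism_add[of act \<eta> r f "\<lambda>zs. - f' zs" s xs] by (simp add: prism_uminus)

text \<open>Merging arrows commutes with any functor from the action groupoid to \<open>H\<close>. A
  constant \<open>r\<close> covers group homomorphisms, the functor \<open>step\<close> below covers
  induction from a subgroup.\<close>

lemma (in right_action) bar_arrows:
  fixes H (structure)
  assumes "\<And>s x y. \<lbrakk>s \<in> S; x \<in> carrier G; y \<in> carrier G\<rbrakk> \<Longrightarrow> r s (x \<otimes>\<^bsub>G\<^esub> y) = r s x \<otimes>\<^bsub>H\<^esub> r (act s x) y"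
    and "s \<in> S" "set xs \<subseteq> carrier G"
  shows "bar H f (arrows act r s xs) = bar G (\<lambda>zs. f (arrows act r s zs)) xs"
  using assms(2,3)
proof (induction xs arbitrary: f s)
  case (Cons x xs)
  then show ?case using Cons.IH[of "act s x" "\<lambda>zs. f (r s x # zs)"]
    by (cases xs) (auto simp: assms(1) act_mult)
qed simp

section \<open>Natural transformations and homotopies\<close>

text \<open>\<open>\<eta> s\<close> is an arrow from \<open>s\<close> to
  \<open>act s (\<eta> s)\<close>, and \<open>r\<close> is the functor that makes
  \<open>\<eta>\<close> natural. Two cases matter: a constant \<open>\<eta>\<close> for inner
  automorphisms, and the retraction onto one coset for Shapiro's lemma.\<close>

locale action_transformation = right_action +
  fixes \<eta> :: "'c \<Rightarrow> 'a" and r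
  assumes \<eta>_closed [simp]: "s \<in> S \<Longrightarrow> \<eta> s \<in> carrier G"
    and r_def: "r s x = inv (\<eta> s) \<otimes> x \<otimes> \<eta> (act s x)"
begin

lemma r_closed [simp]: "\<lbrakk>s \<in> S; x \<in> carrier G\<rbrakk> \<Longrightarrow> r s x \<in> carrier G"
  by (simp add: r_def)

lemma natural: "\<lbrakk>s \<in> S; x \<in> carrier G\<rbrakk> \<Longrightarrow> \<eta> s \<otimes> r s x = x \<otimes> \<eta> (act s x)"
  by (simp add: r_def inv_solve_left' m_assoc flip: m_assoc[of "\<eta> s"])

lemma r_mult:
  assumes "s \<in> S" "x \<in> carrier G" "y \<in> carrier G"
  shows "r s (x \<otimes> y) = r s x \<otimes> r (act s x) y"
proof -
  have "\<eta> s \<otimes> r s (x \<otimes> y) = x \<otimes> (y \<otimes> \<eta> (act (act s x) y))"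
    using assms by (simp add: natural act_mult m_assoc)
  also have "\<dots> = x \<otimes> (\<eta> (act s x) \<otimes> r (act s x) y)"
    using assms by (simp add: natural)
  also have "\<dots> = (\<eta> s \<otimes> r s x) \<otimes> r (act s x) y"
    using assms by (subst natural) (simp_all add: m_assoc)
  also have "\<dots> = \<eta> s \<otimes> (r s x \<otimes> r (act s x) y)"
    using assms by (simp add: m_assoc)
  finally show ?thesis
    using assms by simp
qed

lemma set_arrows: "\<lbrakk>s \<in> S; set xs \<subseteq> carrier G\<rbrakk> \<Longrightarrow> set (arrows act r s xs) \<subseteq> carrier G"
  by (induction xs arbitrary: s) auto

lemma prism_dvd:
  assumes "set xs \<subseteq> carrier G" "s \<in> S" "\<And>ys. set ys \<subseteq> carrier G \<Longrightarrow> c dvd f ys"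
  shows "c dvd prism act \<eta> r f s xs"
  using assms
proof (induction xs arbitrary: f s)
  case (Cons x xs)
  have "c dvd f (\<eta> s # arrows act r s (x # xs))"
    using Cons.prems set_arrows[of s "x # xs"] by (intro Cons.prems(3)) auto
  then show ?case using Cons by (auto intro!: dvd_diff)
qed auto

text \<open>Naturality cancels the faces shared by neighbouring simplices of the prism. Only the end
  \<open>- f xs\<close> is left, because the opposite end of the prism is a first face and
  \<open>bar\<close> has none; \<open>homotopy\<close> supplies it.\<close>

lemma prism_bar:
  assumes "set xs \<subseteq> carrier G" "s \<in> S"
  shows "prism act \<eta> r (bar G f) s xs + bar G (prism act \<eta> r f s) xs = - f xs"
  using assms
proof (induction xs arbitrary: f s)
  case (Cons x xs)
  let ?fx = "\<lambda>zs. f (x # zs)" and ?s = "act s x"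
  have P: "prism act \<eta> r (\<lambda>zs. bar G f (x # zs)) ?s xs =
      - prism act \<eta> r (merge_hd G x f) ?s xs - prism act \<eta> r (bar G ?fx) ?s xs"
    unfolding bar_Cons using prism_diff[of act \<eta> r "\<lambda>zs. - merge_hd G x f zs"] by (simp add: prism_uminus)
  have IH: "prism act \<eta> r (bar G ?fx) ?s xs + bar G (prism act \<eta> r ?fx ?s) xs = - f (x # xs)"
    using Cons by auto
  have nat: "\<eta> s \<otimes> r s x = x \<otimes> \<eta> ?s"
    using Cons.prems by (simp add: natural)
  show ?case
  proof (cases xs)
    case Nil
    then show ?thesis using P IH nat by simp
  next
    case (Cons y ys)
    let ?g = "\<lambda>zs. f (\<eta> s # zs)"
    have B: "bar G (\<lambda>zs. prism act \<eta> r f s (x # zs)) xs =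
        bar G (\<lambda>zs. ?g (r s x # arrows act r ?s zs)) xs - bar G (prism act \<eta> r ?fx ?s) xs"
      by (simp add: bar_diff)
    have A: "bar G (\<lambda>zs. ?g (r s x # arrows act r ?s zs)) xs = bar G (\<lambda>zs. ?g (r s x # zs)) (arrows act r ?s xs)"
      using Cons.prems by (subst bar_arrows[where H = G]) (auto simp: r_mult)
    have *: "r s (x \<otimes> y) = r s x \<otimes> r ?s y" "act s (x \<otimes> y) = act ?s y"
      using Cons Cons.prems by (auto simp: r_mult act_mult)
    have 1: "prism act \<eta> r (bar G f) s (x # xs) = 
      - f ((\<eta> s \<otimes> r s x) # arrows act r ?s xs) + ?g ((r s x \<otimes> r ?s y) # arrows act r (act ?s y) ys)
      + bar G (\<lambda>zs. ?g (r s x # zs)) (arrows act r ?s xs) - prism act \<eta> r (\<lambda>zs. bar G f (x # zs)) ?s xs"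
      using Cons by simp
    have 2: "prism act \<eta> r (merge_hd G x f) ?s xs = f ((x \<otimes> \<eta> ?s) # arrows act r ?s xs)
       - prism act \<eta> r (\<lambda>zs. f ((x \<otimes> y) # zs)) (act ?s y) ys"
      using Cons by simp
    have 3: "bar G (prism act \<eta> r f s) (x # xs) = - ?g ((r s x \<otimes> r ?s y) # arrows act r (act ?s y) ys)
       + prism act \<eta> r (\<lambda>zs. f ((x \<otimes> y) # zs)) (act ?s y) ys
       - bar G (\<lambda>zs. prism act \<eta> r f s (x # zs)) xs"
      using Cons * by simp
    show ?thesis
      using P IH unfolding 1 3 B A 2 nat by simp
  qed
qed simp

lemma homotopy:
  assumes "set xs \<subseteq> carrier G" "s \<in> S"
  shows "dd G act (\<lambda>xs s. prism act \<eta> r (\<lambda>zs. f zs s) s xs) xs s + prism act \<eta> r (\<lambda>zs. dd G act f zs s) s xs =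
    f (arrows act r s xs) (act s (\<eta> s)) - f xs s"
proof (cases xs)
  case (Cons x ys)
  have "(\<lambda>zs. dd G act f (x # zs) s) = (\<lambda>zs. f zs (act s x) + bar G (\<lambda>zs. f zs s) (x # zs))"
    by auto
  then have "prism act \<eta> r (\<lambda>zs. dd G act f zs s) s xs = f (arrows act r s xs) (act s (\<eta> s))
     - prism act \<eta> r (\<lambda>zs. f zs (act s x)) (act s x) ys + prism act \<eta> r (bar G (\<lambda>zs. f zs s)) s xs"
    using Cons by (simp add: prism_add)
  then show ?thesis
    using Cons prism_bar[OF assms, of "\<lambda>zs. f zs s"] by (simp add: dd_def)
qed simp

end

section \<open>The cohomology ring\<close>

text \<open>Trivial coefficients are functions on a one-point set, so the Leibniz rule and the
  homotopies specialise to \<open>cob\<close> and \<open>cp\<close>.\<close>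

definition cob :: "('g, 'b) monoid_scheme \<Rightarrow> ('g list \<Rightarrow> int) \<Rightarrow> 'g list \<Rightarrow> int" where
  "cob G h xs = dd G (\<lambda>s _. s) (\<lambda>xs _. h xs) xs ()"

definition cp :: "('g list \<Rightarrow> int) \<Rightarrow> ('g list \<Rightarrow> int) \<Rightarrow> 'g list \<Rightarrow> int" where
  "cp f g xs = cupa (\<lambda>s _. s) f (\<lambda>xs _. g xs) () xs"

text \<open>Computations take place with arbitrary integer functions up to this congruence, which
  keeps \<open>mod\<close> out of them; \<open>cnorm\<close> leads back to the residues and the
  support that \<open>cochains\<close> demands.\<close>

definition ceq :: "nat \<Rightarrow> ('g, 'b) monoid_scheme \<Rightarrow> ('g list \<Rightarrow> int) \<Rightarrow> ('g list \<Rightarrow> int) \<Rightarrow> bool" where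
  "ceq p G f g \<longleftrightarrow> (\<forall>xs. set xs \<subseteq> carrier G \<longrightarrow> int p dvd f xs - g xs)"

definition cnorm :: "nat \<Rightarrow> ('g, 'b) monoid_scheme \<Rightarrow> ('g list \<Rightarrow> int) \<Rightarrow> 'g list \<Rightarrow> int" where
  "cnorm p G f xs = (if set xs \<subseteq> carrier G then f xs mod int p else 0)"

text \<open>Cochains of the cohomology ring vanish in large degrees, whereas primitives and glued
  cochains arise as functions on all lists and have to be cut off.\<close>

definition trunc :: "nat \<Rightarrow> ('g list \<Rightarrow> int) \<Rightarrow> 'g list \<Rightarrow> int" where
  "trunc N f xs = (if length xs \<le> N then f xs else 0)"

lemma cob_Nil [simp]: "cob G h [] = 0"
  by (simp add: cob_def)

lemma cob_Cons: "cob G h (x # xs) = h xs + bar G h (x # xs)"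
  by (simp add: cob_def)

lemma cob_add: "cob G (\<lambda>xs. f xs + g xs) xs = cob G f xs + cob G g xs"
  by (cases xs) (simp_all add: cob_Cons bar_add)

lemma cob_uminus: "cob G (\<lambda>xs. - f xs) xs = - cob G f xs"
  by (cases xs) (simp_all add: cob_Cons bar_uminus)

lemma bar_length_cong:
  "(\<And>ys. Suc (length ys) = length xs \<Longrightarrow> f ys = g ys) \<Longrightarrow> bar G f xs = bar G g xs"
proof (induction xs arbitrary: f g)
  case (Cons x xs)
  have "merge_hd G x f xs = merge_hd G x g xs"
    using Cons.prems by (cases xs) auto
  moreover have "bar G (\<lambda>zs. f (x # zs)) xs = bar G (\<lambda>zs. g (x # zs)) xs"
    using Cons.prems by (intro Cons.IH) auto
  ultimately show ?case by (simp add: bar_Cons)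
qed simp

lemma cob_length_cong:
  "(\<And>ys. Suc (length ys) = length xs \<Longrightarrow> f ys = g ys) \<Longrightarrow> cob G f xs = cob G g xs"
  using bar_length_cong[of xs f g G] by (cases xs) (simp_all add: cob_Cons)

lemma cob_zero [simp]: "cob G (\<lambda>xs. 0) xs = 0"
  by (cases xs) (simp_all add: cob_Cons)

text \<open>The differential is homogeneous of degree one. The shift from \<open>N\<close> to
  \<open>Suc N\<close> decides where functions are cut off in \<open>coboundaries_iff\<close> and in
  the surjectivity proof.\<close>

lemma cob_trunc: "cob G (trunc N f) xs = trunc (Suc N) (cob G f) xs"
proof (cases "length xs \<le> Suc N")
  case True
  then show ?thesis
    using cob_length_cong[of xs "trunc N f" f G] by (simp add: trunc_def)
next
  case False
  then show ?thesis
    using cob_length_cong[of xs "trunc N f" "\<lambda>_. 0" G] by (simp add: trunc_def)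
qed

lemma merge_at_Cons: "0 < i \<Longrightarrow> merge_at G (Suc i) (x # xs) = x # merge_at G i xs"
  by (cases i) (simp_all add: merge_at_def)

lemma bar_eq_sum:
  assumes "xs \<noteq> []"
  shows "bar G f xs = (\<Sum>i\<in>{1..<length xs}. (-1) ^ i * f (merge_at G i xs)) + (-1) ^ length xs * f (butlast xs)"
  using assms
proof (induction G f xs rule: bar.induct)
  case (3 G f x y xs)
  let ?n = "length (y # xs)"
  have "(\<Sum>i\<in>{1..<length (x # y # xs)}. (-1) ^ i * f (merge_at G i (x # y # xs))) =
      - f (merge_at G 1 (x # y # xs)) + (\<Sum>i\<in>{Suc 1..<Suc ?n}. (-1) ^ i * f (merge_at G i (x # y # xs)))"
    by (subst sum.atLeast_Suc_lessThan) simp_all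
  also have "merge_at G 1 (x # y # xs) = (x \<otimes>\<^bsub>G\<^esub> y) # xs"
    by (simp add: merge_at_def)
  also have "(\<Sum>i\<in>{Suc 1..<Suc ?n}. (-1) ^ i * f (merge_at G i (x # y # xs))) =
      - (\<Sum>i\<in>{1..<?n}. (-1) ^ i * f (x # merge_at G i (y # xs)))"
    unfolding sum_negf[symmetric] sum.atLeast_Suc_lessThan_Suc_shift
    by (intro sum.cong) (auto simp: merge_at_Cons)
  finally show ?case using 3 by simp
qed auto

lemma cobdry_eq: "cobdry p G f = cnorm p G (cob G f)"
proof
  fix xs show "cobdry p G f xs = cnorm p G (cob G f) xs"
    by (cases xs) (auto simp: cobdry_def cnorm_def cob_Cons bar_eq_sum simp del: bar.simps intro!: arg_cong[where f = "\<lambda>z. z mod int p"])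
qed

lemma cp_eq_sum: "cp f g xs = (\<Sum>k\<le>length xs. f (take k xs) * g (drop k xs))"
proof (induction xs arbitrary: f)
  case (Cons x xs)
  have "cp f g (x # xs) = f [] * g (x # xs) + cp (\<lambda>zs. f (x # zs)) g xs"
    by (simp add: cp_def)
  then show ?case
    using Cons by (simp add: sum.atMost_Suc_shift del: sum.atMost_Suc)
qed (simp add: cp_def)

lemma cup_eq: "cup p f g xs = cp f g xs mod int p"
  by (simp add: cup_def cp_eq_sum)

lemma cp_Nil [simp]: "cp f g [] = f [] * g []"
  by (simp add: cp_def)

lemma cp_Cons: "cp f g (x # xs) = f [] * g (x # xs) + cp (\<lambda>zs. f (x # zs)) g xs"
  by (simp add: cp_def)

lemma cp_add_left: "cp (\<lambda>zs. f zs + f' zs) g xs = cp f g xs + cp f' g xs"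
  by (simp add: cp_def cupa_add)

lemma cp_scale_left: "cp (\<lambda>zs. c * f zs) g xs = c * cp f g xs"
  by (simp add: cp_def cupa_scale)

lemma cp_add_right: "cp f (\<lambda>zs. g zs + g' zs) xs = cp f g xs + cp f g' xs"
  by (simp add: cp_def cupa_add_right)

lemma cp_assoc: "cp (cp f g) h xs = cp f (cp g h) xs"
proof (induction xs arbitrary: f)
  case (Cons x xs)
  have "cp (\<lambda>zs. cp f g (x # zs)) h xs = f [] * cp (\<lambda>zs. g (x # zs)) h xs + cp (cp (\<lambda>zs. f (x # zs)) g) h xs"
    unfolding cp_Cons by (simp add: cp_add_left cp_scale_left)
  then show ?case using Cons by (simp add: cp_Cons algebra_simps)
qed simp

lemma cp_cong:
  assumes "set xs \<subseteq> A" "\<And>ys. set ys \<subseteq> A \<Longrightarrow> c dvd f ys - f' ys" "\<And>ys. set ys \<subseteq> A \<Longrightarrow> c dvd g ys - g' ys"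
  shows "c dvd cp f g xs - cp f' g' xs"
proof -
  have "c dvd cp f g xs - cp f' g xs"
    using cupa_dvd_left[OF assms(1), of c "\<lambda>zs. f zs - f' zs"] assms(2) by (simp add: cp_def cupa_diff)
  moreover have "c dvd cp f' (\<lambda>zs. g zs - g' zs) xs"
    unfolding cp_eq_sum using assms(1,3)
    by (intro dvd_sum dvd_mult assms(3)) (use set_drop_subset in fastforce)
  then have "c dvd cp f' g xs - cp f' g' xs"
    by (simp add: cp_def cupa_diff_right)
  ultimately have "c dvd (cp f g xs - cp f' g xs) + (cp f' g xs - cp f' g' xs)"
    by (rule dvd_add)
  then show ?thesis by simp
qed

lemma mod_dvd_diff: "c dvd x mod c - (x::int)" "c dvd x - x mod c"
  by (simp_all add: mod_eq_dvd_iff[symmetric])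

lemma cup_mod_left: "cup p (\<lambda>xs. f xs mod int p) g = cup p f g"
  unfolding cup_eq[abs_def] mod_eq_dvd_iff[abs_def] fun_eq_iff
  by (auto simp: mod_eq_dvd_iff mod_dvd_diff intro!: cp_cong[where A = UNIV])

lemma cup_mod_right: "cup p f (\<lambda>xs. g xs mod int p) = cup p f g"
  unfolding cup_eq[abs_def] mod_eq_dvd_iff[abs_def] fun_eq_iff
  by (auto simp: mod_eq_dvd_iff mod_dvd_diff intro!: cp_cong[where A = UNIV])

lemma ceq_refl [simp]: "ceq p G f f"
  by (simp add: ceq_def)

lemma ceq_sym: "ceq p G f g \<Longrightarrow> ceq p G g f"
  by (auto simp: ceq_def dvd_diff_commute)

lemma ceq_trans [trans]: "\<lbrakk>ceq p G f g; ceq p G g h\<rbrakk> \<Longrightarrow> ceq p G f h"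
  unfolding ceq_def by (metis diff_add_cancel diff_diff_eq2 dvd_add_right_iff dvd_diff_commute add_diff_eq dvd_add)

lemma ceq_add: "\<lbrakk>ceq p G f f'; ceq p G g g'\<rbrakk> \<Longrightarrow> ceq p G (\<lambda>xs. f xs + g xs) (\<lambda>xs. f' xs + g' xs)"
  by (auto simp: ceq_def add_diff_add intro: dvd_add)

lemma ceq_uminus: "ceq p G f f' \<Longrightarrow> ceq p G (\<lambda>xs. - f xs) (\<lambda>xs. - f' xs)"
  by (auto simp: ceq_def) (metis dvd_diff_commute)

lemma ceq_cnorm: "ceq p G (cnorm p G f) f"
  by (auto simp: ceq_def cnorm_def mod_dvd_diff)

lemma ceq_mod: "ceq p G (\<lambda>xs. f xs mod int p) f"
  by (auto simp: ceq_def mod_dvd_diff)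

lemma ceq_cp: "\<lbrakk>ceq p G f f'; ceq p G g g'\<rbrakk> \<Longrightarrow> ceq p G (cp f g) (cp f' g')"
  unfolding ceq_def by (auto intro!: cp_cong[where A = "carrier G"])

lemma ceq_cup: "ceq p G (cup p f g) (cp f g)"
  by (simp add: cup_eq ceq_def mod_dvd_diff)

lemma ceq_trunc: "ceq p G f g \<Longrightarrow> ceq p G (trunc N f) (trunc N g)"
  by (auto simp: ceq_def trunc_def)

section \<open>The ring of cocycles modulo coboundaries\<close>

locale fp_group = group G for G (structure) +
  fixes p :: nat
  assumes p_gt_1: "1 < p"
begin

sublocale triv: right_action G "UNIV :: unit set" "\<lambda>s _. s"
  by unfold_locales auto

abbreviation Cn where "Cn \<equiv> cochains p G"
abbreviation Z where "Z \<equiv> cocycles p G"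
abbreviation B where "B \<equiv> coboundaries p G"
abbreviation ZR where "ZR \<equiv> cocycle_ring p G"
abbreviation eq (infix "\<asymp>" 50) where "f \<asymp> g \<equiv> ceq p G f g"
abbreviation d where "d \<equiv> cob G"

lemma ceq_cob: "f \<asymp> g \<Longrightarrow> d f \<asymp> d g"
  using triv.dd_cong[of _ "()" "int p" "\<lambda>xs _. f xs" "\<lambda>xs _. g xs"] by (simp add: ceq_def cob_def)

lemma cob_cob: "d (d f) \<asymp> (\<lambda>_. 0)"
  using triv.dd_dd[of _ "()" "\<lambda>xs _. f xs"] by (auto simp: ceq_def cob_def[abs_def])

lemma cob_cp: "set xs \<subseteq> carrier G \<Longrightarrow> d (cp f g) xs = cp (d f) g xs + cp (alt f) (d g) xs"
proof -
  assume xs: "set xs \<subseteq> carrier G"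
  have *: "(\<lambda>xs s. cupf (\<lambda>s _. s) (\<lambda>xs _. f xs) (\<lambda>xs _. g xs) xs s) = (\<lambda>xs (_::unit). cp f g xs)"
    "dd G (\<lambda>s _. s) (\<lambda>xs (_::unit). h xs) = (\<lambda>xs _. d h xs)" for h
    by (auto simp: cob_def cp_def cupf_def fun_eq_iff)
  show ?thesis
    using triv.leibniz[OF xs, of "()" "\<lambda>xs _. f xs" "\<lambda>xs _. g xs"] unfolding *
    by (simp add: cupf_def cp_def)
qed

lemma cob_alt: "d (alt f) xs = - alt (d f) xs"
  using triv.dd_alt[of "\<lambda>xs _. f xs" xs "()"] by (simp add: cob_def[abs_def])

lemma cochainsI:
  assumes "\<And>xs. f xs \<in> {0..<int p}" "\<And>xs. \<not> set xs \<subseteq> carrier G \<Longrightarrow> f xs = 0"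
    "\<And>xs. N < length xs \<Longrightarrow> f xs = 0"
  shows "f \<in> Cn"
  using assms unfolding cochains_def by blast

lemma cochain_range: "f \<in> Cn \<Longrightarrow> f xs mod int p = f xs"
  by (auto simp: cochains_def)

lemma cochain_support: "\<lbrakk>f \<in> Cn; \<not> set xs \<subseteq> carrier G\<rbrakk> \<Longrightarrow> f xs = 0"
  by (auto simp: cochains_def)

lemma cochain_bound: "f \<in> Cn \<Longrightarrow> \<exists>N. \<forall>xs. N < length xs \<longrightarrow> f xs = 0"
  by (auto simp: cochains_def)

lemma mod_range: "x mod int p \<in> {0..<int p}"
  using p_gt_1 by auto

lemma cnorm_cochain:
  assumes "\<And>xs. set xs \<subseteq> carrier G \<Longrightarrow> N < length xs \<Longrightarrow> f xs = 0"
  shows "cnorm p G f \<in> Cn"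
  using assms p_gt_1 by (intro cochainsI[where N = N]) (auto simp: cnorm_def)

lemma trunc_cochain: "cnorm p G (trunc N f) \<in> Cn"
  by (rule cnorm_cochain[where N = N]) (auto simp: trunc_def)

lemma cnorm_id: "f \<in> Cn \<Longrightarrow> cnorm p G f = f"
  by (auto simp: cnorm_def cochain_range cochain_support)

lemma cnorm_cong: "f \<asymp> g \<Longrightarrow> cnorm p G f = cnorm p G g"
  by (auto simp: cnorm_def ceq_def mod_eq_dvd_iff)

lemma zero_cochain: "(\<lambda>_. 0) \<in> Cn"
  using p_gt_1 by (intro cochainsI[where N = 0]) auto

lemma one_cochain: "(\<lambda>xs. if xs = [] then 1 else 0) \<in> Cn"
  using p_gt_1 by (intro cochainsI[where N = 0]) auto

lemma add_cochain: "\<lbrakk>f \<in> Cn; g \<in> Cn\<rbrakk> \<Longrightarrow> (\<lambda>xs. (f xs + g xs) mod int p) \<in> Cn"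
proof -
  assume *: "f \<in> Cn" "g \<in> Cn"
  then obtain N M where "\<forall>xs. N < length xs \<longrightarrow> f xs = 0" "\<forall>xs. M < length xs \<longrightarrow> g xs = 0"
    by (meson cochain_bound)
  then show ?thesis using * p_gt_1
    by (intro cochainsI[where N = "max N M"]) (auto simp: cochain_support)
qed

lemma uminus_cochain: "f \<in> Cn \<Longrightarrow> (\<lambda>xs. (- f xs) mod int p) \<in> Cn"
proof -
  assume *: "f \<in> Cn"
  then obtain N where "\<forall>xs. N < length xs \<longrightarrow> f xs = 0"
    by (meson cochain_bound)
  then show ?thesis using * p_gt_1
    by (intro cochainsI[where N = N]) (auto simp: cochain_support)
qed

lemma cp_bound:
  assumes "\<forall>xs. N < length xs \<longrightarrow> f xs = 0" "\<forall>xs. M < length xs \<longrightarrow> g xs = 0" "N + M < length xs"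
  shows "cp f g xs = 0"
  unfolding cp_eq_sum
proof (rule sum.neutral, rule ballI)
  fix k assume "k \<in> {..length xs}"
  then have "N < length (take k xs) \<or> M < length (drop k xs)"
    using assms(3) by auto
  then show "f (take k xs) * g (drop k xs) = 0" using assms by auto
qed

lemma cup_cochain: "\<lbrakk>f \<in> Cn; g \<in> Cn\<rbrakk> \<Longrightarrow> cup p f g \<in> Cn"
proof -
  assume *: "f \<in> Cn" "g \<in> Cn"
  then obtain N M where "\<forall>xs. N < length xs \<longrightarrow> f xs = 0" "\<forall>xs. M < length xs \<longrightarrow> g xs = 0"
    by (meson cochain_bound)
  moreover have "cp f g xs = 0" if "\<not> set xs \<subseteq> carrier G" for xs
    unfolding cp_eq_sum
  proof (rule sum.neutral, rule ballI)
    fix k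
    have "\<not> set (take k xs) \<subseteq> carrier G \<or> \<not> set (drop k xs) \<subseteq> carrier G"
      using that by (metis append_take_drop_id set_append Un_least)
    then show "f (take k xs) * g (drop k xs) = 0"
      using cochain_support[OF *(1)] cochain_support[OF *(2)] by (auto simp del: set_take_subset set_drop_subset)
  qed
  ultimately show ?thesis using p_gt_1
    by (intro cochainsI[where N = "N + M"]) (auto simp: cup_eq cp_bound)
qed

lemma cocycles_iff: "f \<in> Z \<longleftrightarrow> f \<in> Cn \<and> d f \<asymp> (\<lambda>_. 0)"
  by (auto simp: cocycles_def cobdry_eq cnorm_def ceq_def fun_eq_iff mod_eq_0_iff_dvd)

text \<open>A primitive may be any integer function: if \<open>f\<close> vanishes above degree
  \<open>N\<close>, then cutting \<open>h\<close> at \<open>N\<close> cuts \<open>d h\<close> at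
  \<open>Suc N\<close> and leaves the congruence with \<open>f\<close> intact.\<close>

lemma coboundaries_iff: "f \<in> B \<longleftrightarrow> f \<in> Cn \<and> (\<exists>h. f \<asymp> d h)"
proof safe
  assume "f \<in> B"
  then obtain h where h: "h \<in> Cn" "f = cnorm p G (d h)"
    by (auto simp: coboundaries_def cobdry_eq)
  then show "\<exists>h. f \<asymp> d h" by (auto intro: ceq_cnorm)
  obtain N where N: "\<forall>xs. N < length xs \<longrightarrow> h xs = 0"
    using h cochain_bound by blast
  have "d h xs = 0" if "Suc N < length xs" for xs
  proof -
    have "d h xs = d (\<lambda>_. 0) xs"
      using that N by (intro cob_length_cong) auto
    then show ?thesis by simp
  qed
  then show "f \<in> Cn" using h(2) by (auto intro: cnorm_cochain[where N = "Suc N"])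
next
  fix h assume f: "f \<in> Cn" "f \<asymp> d h"
  then obtain N where N: "\<forall>xs. N < length xs \<longrightarrow> f xs = 0"
    using cochain_bound by blast
  let ?h = "cnorm p G (trunc N h)"
  have "trunc (Suc N) f = f" using N by (auto simp: trunc_def fun_eq_iff)
  then have "f \<asymp> trunc (Suc N) (d h)"
    using ceq_trunc[OF f(2), of "Suc N"] by simp
  then have "f \<asymp> d (trunc N h)" by (simp add: cob_trunc[abs_def])
  also have "d (trunc N h) \<asymp> d ?h" by (intro ceq_cob ceq_sym[OF ceq_cnorm])
  finally have "f = cnorm p G (d ?h)"
    using cnorm_cong cnorm_id f(1) by metis
  then show "f \<in> B" using trunc_cochain by (auto simp: coboundaries_def cobdry_eq)
qed

lemma B_subset_Z: "B \<subseteq> Z"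
proof
  fix f assume "f \<in> B"
  then obtain h where h: "f \<in> Cn" "f \<asymp> d h" by (auto simp: coboundaries_iff)
  have "d f \<asymp> d (d h)" using h ceq_cob by blast
  also have "\<dots> \<asymp> (\<lambda>_. 0)" by (rule cob_cob)
  finally show "f \<in> Z" using h by (simp add: cocycles_iff)
qed

lemma add_cocycle: "\<lbrakk>f \<in> Z; g \<in> Z\<rbrakk> \<Longrightarrow> (\<lambda>xs. (f xs + g xs) mod int p) \<in> Z"
proof -
  assume *: "f \<in> Z" "g \<in> Z"
  have "d (\<lambda>xs. (f xs + g xs) mod int p) \<asymp> d (\<lambda>xs. f xs + g xs)"
    by (intro ceq_cob ceq_mod)
  also have "d (\<lambda>xs. f xs + g xs) = (\<lambda>xs. d f xs + d g xs)" by (simp add: cob_add fun_eq_iff)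
  also have "(\<lambda>xs. d f xs + d g xs) \<asymp> (\<lambda>xs. 0 + 0)"
    using * by (intro ceq_add) (auto simp: cocycles_iff)
  finally show ?thesis using * by (simp add: cocycles_iff add_cochain)
qed

lemma uminus_cocycle: "f \<in> Z \<Longrightarrow> (\<lambda>xs. (- f xs) mod int p) \<in> Z"
proof -
  assume *: "f \<in> Z"
  have "d (\<lambda>xs. (- f xs) mod int p) \<asymp> d (\<lambda>xs. - f xs)"
    by (intro ceq_cob ceq_mod)
  also have "d (\<lambda>xs. - f xs) = (\<lambda>xs. - d f xs)" by (simp add: cob_uminus fun_eq_iff)
  also have "(\<lambda>xs. - d f xs) \<asymp> (\<lambda>xs. - 0)"
    using * by (intro ceq_uminus) (auto simp: cocycles_iff)
  finally show ?thesis using * by (simp add: cocycles_iff uminus_cochain)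
qed

lemma ceq_alt_zero: "f \<asymp> (\<lambda>_. 0) \<Longrightarrow> alt f \<asymp> (\<lambda>_. 0)"
  by (simp add: ceq_def alt_def)

lemma cp_zero_left [simp]: "cp (\<lambda>_. 0) g xs = 0" 
  by (simp add: cp_eq_sum)

lemma cp_zero_right [simp]: "cp f (\<lambda>_. 0) xs = 0" 
  by (simp add: cp_eq_sum)

lemma cob_cp_ceq: "d (cp f g) \<asymp> (\<lambda>xs. cp (d f) g xs + cp (alt f) (d g) xs)"
  by (simp add: ceq_def cob_cp)

lemma cup_cocycle: "\<lbrakk>f \<in> Z; g \<in> Z\<rbrakk> \<Longrightarrow> cup p f g \<in> Z"
proof -
  assume *: "f \<in> Z" "g \<in> Z"
  have "d (cup p f g) \<asymp> d (cp f g)" by (intro ceq_cob ceq_cup)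
  also have "d (cp f g) \<asymp> (\<lambda>xs. cp (d f) g xs + cp (alt f) (d g) xs)" by (rule cob_cp_ceq)
  also have "\<dots> \<asymp> (\<lambda>xs. cp (\<lambda>_. 0) g xs + cp (alt f) (\<lambda>_. 0) xs)"
    using * by (intro ceq_add ceq_cp) (auto simp: cocycles_iff)
  finally show ?thesis using * by (simp add: cocycles_iff cup_cochain)
qed

lemma one_cocycle: "(\<lambda>xs. if xs = [] then 1 else 0) \<in> Z"
proof -
  have "d (\<lambda>xs. if xs = [] then 1 else 0) xs = 0" for xs
  proof (cases xs rule: remdups_adj.cases)
    case (3 x y ys)
    have "d (\<lambda>xs. if xs = [] then 1 else 0) xs = d (\<lambda>_. 0) xs"
      using 3 by (intro cob_length_cong) auto
    then show ?thesis by simp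
  qed (auto simp: cob_Cons)
  then have "d (\<lambda>xs. if xs = [] then 1 else 0) \<asymp> (\<lambda>_. 0)" by (simp add: ceq_def)
  then show ?thesis using one_cochain by (simp add: cocycles_iff)
qed

lemma ZR_simps [simp]:
  "carrier ZR = Z" "f \<otimes>\<^bsub>ZR\<^esub> g = cup p f g" "\<one>\<^bsub>ZR\<^esub> = (\<lambda>xs. if xs = [] then 1 else 0)"
  "\<zero>\<^bsub>ZR\<^esub> = (\<lambda>_. 0)" "f \<oplus>\<^bsub>ZR\<^esub> g = (\<lambda>xs. (f xs + g xs) mod int p)"
  by (simp_all add: cocycle_ring_def)

lemma zero_cocycle: "(\<lambda>_. 0) \<in> Z"
  using zero_cochain by (simp add: cocycles_iff ceq_def)

lemma cup_assoc: "cup p (cup p f g) h = cup p f (cup p g h)"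
proof -
  have "cup p (cup p f g) h = cup p (cp f g) h"
    unfolding cup_eq[of p f g, abs_def] by (rule cup_mod_left)
  also have "\<dots> = cup p f (cp g h)" by (auto simp: cup_eq cp_assoc)
  also have "\<dots> = cup p f (cup p g h)"
    unfolding cup_eq[of p g h, abs_def] by (rule cup_mod_right[symmetric])
  finally show ?thesis .
qed

lemma cocycle_range: "f \<in> Z \<Longrightarrow> f xs mod int p = f xs"
  by (simp add: cocycles_iff cochain_range)

lemma cp_one_left: "cp (\<lambda>xs. if xs = [] then 1 else 0) f xs = f xs"
proof (cases xs)
  case (Cons y ys)
  show ?thesis unfolding Cons cp_Cons by simp
qed simp

lemma cp_one_right: "cp f (\<lambda>xs. if xs = [] then 1 else 0) xs = f xs"
  by (induction xs arbitrary: f) (auto simp: cp_Cons)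

lemma ring_ZR: "ring ZR"
proof (rule ringI)
  show "abelian_group ZR"
  proof (rule abelian_groupI)
    fix x assume x: "x \<in> carrier ZR"
    then have "(\<lambda>xs. (- x xs) mod int p) \<oplus>\<^bsub>ZR\<^esub> x = \<zero>\<^bsub>ZR\<^esub>"
      by (simp add: mod_simps)
    then show "\<exists>y\<in>carrier ZR. y \<oplus>\<^bsub>ZR\<^esub> x = \<zero>\<^bsub>ZR\<^esub>"
      using uminus_cocycle x by auto
  qed (auto simp: add_cocycle zero_cocycle mod_simps cocycle_range algebra_simps)
  show "Group.monoid ZR"
    by (rule Group.monoidI)
      (auto simp: cup_cocycle one_cocycle cup_assoc cup_eq cp_one_left cp_one_right cocycle_range)
next
  fix x y z assume *: "x \<in> carrier ZR" "y \<in> carrier ZR" "z \<in> carrier ZR"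
  show "(x \<oplus>\<^bsub>ZR\<^esub> y) \<otimes>\<^bsub>ZR\<^esub> z = x \<otimes>\<^bsub>ZR\<^esub> z \<oplus>\<^bsub>ZR\<^esub> y \<otimes>\<^bsub>ZR\<^esub> z"
    unfolding ZR_simps cup_mod_left by (simp add: cup_eq fun_eq_iff cp_add_left mod_simps)
  show "z \<otimes>\<^bsub>ZR\<^esub> (x \<oplus>\<^bsub>ZR\<^esub> y) = z \<otimes>\<^bsub>ZR\<^esub> x \<oplus>\<^bsub>ZR\<^esub> z \<otimes>\<^bsub>ZR\<^esub> y"
    unfolding ZR_simps cup_mod_right by (simp add: cup_eq fun_eq_iff cp_add_right mod_simps)
qed

sublocale ZR: ring ZR
  by (rule ring_ZR)

lemma ZR_uminus: "f \<in> Z \<Longrightarrow> \<ominus>\<^bsub>ZR\<^esub> f = (\<lambda>xs. (- f xs) mod int p)"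
  by (rule ZR.minus_equality) (auto simp: uminus_cocycle mod_simps)

lemma coboundariesI: "\<lbrakk>f \<in> Z; f \<asymp> d h\<rbrakk> \<Longrightarrow> f \<in> B"
  by (auto simp: coboundaries_iff cocycles_iff)

lemma ideal_B: "ideal B ZR"
proof (rule idealI[OF ring_ZR])
  show "subgroup B (add_monoid ZR)"
  proof (rule group.subgroupI[OF ZR.a_group])
    show "B \<subseteq> carrier (add_monoid ZR)" using B_subset_Z by simp
    have "(\<lambda>_. 0) \<asymp> d (\<lambda>_. 0)" by (simp add: ceq_def)
    then show "B \<noteq> {}" using coboundariesI zero_cocycle by blast
  next
    fix a assume a: "a \<in> B"
    then obtain h where h: "a \<asymp> d h" by (auto simp: coboundaries_iff)
    have "(\<lambda>xs. (- a xs) mod int p) \<asymp> (\<lambda>xs. - a xs)" by (rule ceq_mod)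
    also have "\<dots> \<asymp> (\<lambda>xs. - d h xs)" using h by (rule ceq_uminus)
    also have "(\<lambda>xs. - d h xs) = d (\<lambda>xs. - h xs)" by (simp add: cob_uminus fun_eq_iff)
    finally have "(\<lambda>xs. (- a xs) mod int p) \<in> B"
      using a B_subset_Z by (intro coboundariesI uminus_cocycle) auto
    moreover have "inv\<^bsub>add_monoid ZR\<^esub> a = (\<lambda>xs. (- a xs) mod int p)"
      using ZR_uminus[of a] a B_subset_Z by (auto simp: a_inv_def)
    ultimately show "inv\<^bsub>add_monoid ZR\<^esub> a \<in> B" by simp
  next
    fix a b assume ab: "a \<in> B" "b \<in> B"
    then obtain h k where h: "a \<asymp> d h" "b \<asymp> d k" by (auto simp: coboundaries_iff)
    have "(\<lambda>xs. (a xs + b xs) mod int p) \<asymp> (\<lambda>xs. a xs + b xs)" by (rule ceq_mod)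
    also have "\<dots> \<asymp> (\<lambda>xs. d h xs + d k xs)" using h by (rule ceq_add)
    also have "(\<lambda>xs. d h xs + d k xs) = d (\<lambda>xs. h xs + k xs)" by (simp add: cob_add fun_eq_iff)
    finally show "a \<otimes>\<^bsub>add_monoid ZR\<^esub> b \<in> B"
      using ab B_subset_Z by (auto intro!: coboundariesI add_cocycle)
  qed
next
  fix a x assume a: "a \<in> B" and x: "x \<in> carrier ZR"
  then obtain h where h: "a \<asymp> d h" by (auto simp: coboundaries_iff)
  have aZ: "a \<in> Z" using a B_subset_Z by auto
  have dx: "d x \<asymp> (\<lambda>_. 0)" using x by (simp add: cocycles_iff)
  have "cup p x a \<asymp> cp x a" by (rule ceq_cup)
  also have "cp x a \<asymp> cp x (d h)" using h by (intro ceq_cp) auto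
  \<comment> \<open>The primitive is \<open>cp (alt x) h\<close>. As \<open>x\<close> is a cocycle
    and \<open>alt\<close> is an involution, its Leibniz rule leaves exactly \<open>x\<close> times
    \<open>d h\<close>.\<close>
  also have "cp x (d h) = (\<lambda>xs. 0 + cp (alt (alt x)) (d h) xs)" by simp
  also have "(\<lambda>xs. 0 + cp (alt (alt x)) (d h) xs) \<asymp> (\<lambda>xs. cp (d (alt x)) h xs + cp (alt (alt x)) (d h) xs)"
  proof (intro ceq_add ceq_refl)
    have "cp (\<lambda>_. - 0) h \<asymp> cp (\<lambda>xs. - alt (d x) xs) h"
      using dx by (intro ceq_cp ceq_refl ceq_uminus) (auto intro: ceq_sym ceq_alt_zero)
    moreover have "(\<lambda>xs. - alt (d x) xs) = d (alt x)" by (simp add: cob_alt fun_eq_iff)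
    moreover have "cp (\<lambda>_. - 0) h = (\<lambda>_. 0)" by (simp add: fun_eq_iff)
    ultimately show "(\<lambda>_. 0) \<asymp> cp (d (alt x)) h" by simp
  qed
  also have "\<dots> \<asymp> d (cp (alt x) h)" by (rule ceq_sym[OF cob_cp_ceq])
  finally show "x \<otimes>\<^bsub>ZR\<^esub> a \<in> B"
    using x aZ by (auto intro: coboundariesI cup_cocycle)
  have "cup p a x \<asymp> cp a x" by (rule ceq_cup)
  also have "cp a x \<asymp> cp (d h) x" using h by (intro ceq_cp) auto
  also have "cp (d h) x = (\<lambda>xs. cp (d h) x xs + cp (alt h) (\<lambda>_. 0) xs)" by simp
  also have "\<dots> \<asymp> (\<lambda>xs. cp (d h) x xs + cp (alt h) (d x) xs)"
    using dx by (intro ceq_add ceq_refl ceq_cp) (rule ceq_sym)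
  also have "\<dots> \<asymp> d (cp h x)" by (rule ceq_sym[OF cob_cp_ceq])
  finally show "a \<otimes>\<^bsub>ZR\<^esub> x \<in> B"
    using x aZ by (auto intro: coboundariesI cup_cocycle)
qed

sublocale B: ideal B ZR
  by (rule ideal_B)

definition cls where "cls f = B +>\<^bsub>ZR\<^esub> f"

abbreviation H where "H \<equiv> cohom_ring p G"

lemma ring_H: "ring H"
  unfolding cohom_ring_def by (rule B.quotient_is_ring)

lemma carrier_H: "carrier H = cls ` Z"
  by (auto simp: cohom_ring_def FactRing_def A_RCOSETS_def' cls_def)

lemma cls_in_H: "f \<in> Z \<Longrightarrow> cls f \<in> carrier H"
  by (simp add: carrier_H)

lemma cls_eq_iff:
  assumes "f \<in> Z" "g \<in> Z"
  shows "cls f = cls g \<longleftrightarrow> (\<exists>h. f \<asymp> (\<lambda>xs. g xs + d h xs))"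
proof -
  have "f \<ominus>\<^bsub>ZR\<^esub> g = (\<lambda>xs. (f xs + (- g xs) mod int p) mod int p)"
    using assms by (simp add: a_minus_def ZR_uminus)
  then have fg: "f \<ominus>\<^bsub>ZR\<^esub> g = (\<lambda>xs. (f xs - g xs) mod int p)"
    by (simp add: mod_simps)
  have "cls f = cls g \<longleftrightarrow> f \<ominus>\<^bsub>ZR\<^esub> g \<in> B"
    unfolding cls_def using assms ZR.quotient_eq_iff_same_a_r_cos[OF ideal_B, of f g] by simp
  also have "\<dots> \<longleftrightarrow> (\<exists>h. f \<ominus>\<^bsub>ZR\<^esub> g \<asymp> d h)"
    using assms ZR.minus_closed[of f g] by (auto simp: coboundaries_iff cocycles_iff)
  also have "\<dots> \<longleftrightarrow> (\<exists>h. f \<asymp> (\<lambda>xs. g xs + d h xs))"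
  proof -
    have "int p dvd (f xs - g xs) mod int p - d h xs \<longleftrightarrow> int p dvd f xs - (g xs + d h xs)" for h xs
      by (simp add: mod_eq_dvd_iff[symmetric] mod_simps) (simp add: mod_eq_dvd_iff algebra_simps)
    then show ?thesis unfolding fg ceq_def by simp
  qed
  finally show ?thesis .
qed

lemma cls_mult: "\<lbrakk>f \<in> Z; g \<in> Z\<rbrakk> \<Longrightarrow> cls f \<otimes>\<^bsub>H\<^esub> cls g = cls (cup p f g)"
  using B.rcoset_mult_add[of f g] by (simp add: cls_def cohom_ring_def FactRing_def)

lemma cls_add: "\<lbrakk>f \<in> Z; g \<in> Z\<rbrakk> \<Longrightarrow> cls f \<oplus>\<^bsub>H\<^esub> cls g = cls (\<lambda>xs. (f xs + g xs) mod int p)"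
  using B.a_rcos_sum[of f g] by (simp add: cls_def cohom_ring_def FactRing_def)

lemma one_H: "\<one>\<^bsub>H\<^esub> = cls (\<lambda>xs. if xs = [] then 1 else 0)"
  by (simp add: cls_def cohom_ring_def FactRing_def)

lemma zero_H: "\<zero>\<^bsub>H\<^esub> = cls (\<lambda>_. 0)"
  using B.a_rcos_const[of "(\<lambda>_. 0)"] zero_cocycle B.additive_subgroup_axioms additive_subgroup.zero_closed[of B ZR]
  by (simp add: cls_def cohom_ring_def FactRing_def)

lemma cls_eqI: "\<lbrakk>f \<in> Z; g \<in> Z; f \<asymp> (\<lambda>xs. g xs + d h xs)\<rbrakk> \<Longrightarrow> cls f = cls g"
  using cls_eq_iff by blast

end

section \<open>Functoriality in the group\<close>

lemma cob_map:
  assumes "group P" "\<phi> \<in> hom P G" "set xs \<subseteq> carrier P"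
  shows "cob G f (map \<phi> xs) = cob P (\<lambda>ys. f (map \<phi> ys)) xs"
proof -
  interpret P: group P by fact
  interpret right_action P "UNIV :: unit set" "\<lambda>s _. s" by unfold_locales auto
  have "bar G f (map \<phi> xs) = bar P (\<lambda>ys. f (map \<phi> ys)) xs"
    using bar_arrows[of "\<lambda>_. \<phi>" G "()" xs f] assms by (auto simp: arrows_const hom_mult)
  then show ?thesis by (cases xs) (auto simp: cob_Cons simp del: bar.simps)
qed

lemma cp_map: "cp f g (map \<phi> xs) = cp (\<lambda>ys. f (map \<phi> ys)) (\<lambda>ys. g (map \<phi> ys)) xs"
  by (simp add: cp_eq_sum take_map drop_map)

lemma ceq_map:
  assumes "\<phi> \<in> carrier P \<rightarrow> carrier G" "ceq p G f g"
  shows "ceq p P (\<lambda>xs. f (map \<phi> xs)) (\<lambda>xs. g (map \<phi> xs))"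
proof -
  have "set (map \<phi> xs) \<subseteq> carrier G" if "set xs \<subseteq> carrier P" for xs
    using that assms(1) by auto
  then show ?thesis using assms(2) by (simp add: ceq_def)
qed

locale fp_hom = P: fp_group P p + G: fp_group G p for P G p +
  fixes \<phi> assumes hom: "\<phi> \<in> hom P G"
begin

lemma closed: "\<phi> \<in> carrier P \<rightarrow> carrier G"
  using hom by (auto simp: hom_def)

lemma pullback_ceq: "ceq p P (pullback P \<phi> z) (\<lambda>xs. z (map \<phi> xs))"
  by (auto simp: ceq_def pullback_def)

lemma pullback_cocycle:
  assumes "z \<in> G.Z"
  shows "pullback P \<phi> z \<in> P.Z"
proof -
  obtain N where "\<forall>xs. N < length xs \<longrightarrow> z xs = 0"
    using assms G.cochain_bound by (auto simp: G.cocycles_iff)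
  moreover have "z xs \<in> {0..<int p}" for xs
    using G.mod_range[of "z xs"] assms by (simp add: G.cocycle_range)
  ultimately have "pullback P \<phi> z \<in> P.Cn"
    using G.p_gt_1 by (intro P.cochainsI[where N = N]) (auto simp: pullback_def)
  moreover have "ceq p P (P.d (pullback P \<phi> z)) (\<lambda>_. 0)"
  proof -
    have "ceq p P (P.d (pullback P \<phi> z)) (P.d (\<lambda>xs. z (map \<phi> xs)))"
      by (intro P.ceq_cob pullback_ceq)
    also have "ceq p P \<dots> (\<lambda>xs. G.d z (map \<phi> xs))"
      using cob_map[OF P.group_axioms hom] by (simp add: ceq_def)
    also have "ceq p P \<dots> (\<lambda>xs. 0)"
      using assms by (intro ceq_map[where g = "\<lambda>_. 0", OF closed]) (simp add: G.cocycles_iff)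
    finally show ?thesis .
  qed
  ultimately show ?thesis by (simp add: P.cocycles_iff)
qed

lemma cls_pullback_cong:
  assumes "f \<in> G.Z" "g \<in> G.Z" "G.cls f = G.cls g"
  shows "P.cls (pullback P \<phi> f) = P.cls (pullback P \<phi> g)"
proof -
  obtain h where h: "ceq p G f (\<lambda>xs. g xs + G.d h xs)"
    using assms G.cls_eq_iff by blast
  have "ceq p P (pullback P \<phi> f) (\<lambda>xs. f (map \<phi> xs))" by (rule pullback_ceq)
  also have "ceq p P \<dots> (\<lambda>xs. g (map \<phi> xs) + G.d h (map \<phi> xs))"
    by (rule ceq_map[OF closed h])
  also have "ceq p P \<dots> (\<lambda>xs. pullback P \<phi> g xs + P.d (\<lambda>xs. h (map \<phi> xs)) xs)"
    using cob_map[OF P.group_axioms hom] by (simp add: ceq_def pullback_def)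
  finally show ?thesis
    using assms by (intro P.cls_eqI pullback_cocycle)
qed

text \<open>\<open>res\<close> is a union over all representatives of the class. By
  \<open>cls_pullback_cong\<close> the cosets in this union coincide, so it is a single
  coset.\<close>

lemma res_cls:
  assumes "z \<in> G.Z"
  shows "res p P \<phi> (G.cls z) = P.cls (pullback P \<phi> z)"
proof -
  have "z \<in> G.cls z"
    unfolding G.cls_def using assms by (intro G.B.a_rcos_self) simp
  moreover have "P.cls (pullback P \<phi> w) = P.cls (pullback P \<phi> z)" if "w \<in> G.cls z" for w
  proof -
    have "G.cls w = G.cls z"
      using that assms unfolding G.cls_def by (intro G.B.a_repr_independence'[symmetric]) auto
    moreover have "w \<in> G.Z"
      using that assms G.ZR.a_r_coset_subset_G[of G.B z] G.B_subset_Z unfolding G.cls_def by auto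
    ultimately show ?thesis using assms cls_pullback_cong by blast
  qed
  ultimately show ?thesis unfolding res_def P.cls_def[symmetric] by blast
qed

end

section \<open>Shapiro's lemma and graphs of subgroups\<close>

text \<open>By freeness an orbit becomes a copy of Q once a representative is chosen, and
  \<open>\<kappa>\<close> is the resulting coordinate. The lemma provides coset coordinates in Gamma
  and in the finite quotient, and compares free actions on a finite set.\<close>

lemma free_action_equivariant_map:
  assumes "group Q"
    and closed: "\<And>q y. \<lbrakk>q \<in> carrier Q; y \<in> Y\<rbrakk> \<Longrightarrow> a q y \<in> Y"
    and mult: "\<And>q r y. \<lbrakk>q \<in> carrier Q; r \<in> carrier Q; y \<in> Y\<rbrakk> \<Longrightarrow> a (q \<otimes>\<^bsub>Q\<^esub> r) y = a q (a r y)"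
    and one: "\<And>y. y \<in> Y \<Longrightarrow> a \<one>\<^bsub>Q\<^esub> y = y"
    and free: "\<And>q y. \<lbrakk>q \<in> carrier Q; y \<in> Y; a q y = y\<rbrakk> \<Longrightarrow> q = \<one>\<^bsub>Q\<^esub>"
    and "y\<^sub>0 \<in> Y"
  obtains \<kappa> where "\<And>y. y \<in> Y \<Longrightarrow> \<kappa> y \<in> carrier Q"
    "\<And>q y. \<lbrakk>q \<in> carrier Q; y \<in> Y\<rbrakk> \<Longrightarrow> \<kappa> (a q y) = q \<otimes>\<^bsub>Q\<^esub> \<kappa> y" "\<kappa> y\<^sub>0 = \<one>\<^bsub>Q\<^esub>"
proof -
  interpret Q: group Q by fact
  define orb where "orb y = (\<lambda>q. a q y) ` carrier Q" for y
  \<comment> \<open>\<open>y\<^sub>0\<close> is made the representative of its own orbit, which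
    normalises its coordinate to the identity.\<close>
  define \<theta> where "\<theta> y = (if y\<^sub>0 \<in> orb y then y\<^sub>0 else (SOME z. z \<in> orb y))" for y
  have orb: "orb (a q y) = orb y" if "q \<in> carrier Q" "y \<in> Y" for q y
  proof safe
    fix z assume "z \<in> orb (a q y)"
    then show "z \<in> orb y" using that by (auto simp: orb_def mult[symmetric])
  next
    fix z assume "z \<in> orb y"
    then obtain r where r: "r \<in> carrier Q" "z = a r y" by (auto simp: orb_def)
    have "a (r \<otimes>\<^bsub>Q\<^esub> inv\<^bsub>Q\<^esub> q) (a q y) = a r y"
      using r that by (simp add: mult[symmetric] Q.m_assoc)
    then show "z \<in> orb (a q y)" using r that unfolding orb_def
      by (metis Q.inv_closed Q.m_closed image_eqI)
  qed
  have \<theta>: "\<theta> y \<in> orb y" if "y \<in> Y" for y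
  proof -
    have "y \<in> orb y" using that one by (force simp: orb_def)
    then show ?thesis by (auto simp: \<theta>_def intro: someI)
  qed
  define \<kappa> where "\<kappa> y = (SOME q. q \<in> carrier Q \<and> a q (\<theta> y) = y)" for y
  have \<theta>Y: "\<theta> y \<in> Y" if "y \<in> Y" for y
    using \<theta>[OF that] that closed by (auto simp: orb_def)
  have \<kappa>: "\<kappa> y \<in> carrier Q \<and> a (\<kappa> y) (\<theta> y) = y" if y: "y \<in> Y" for y
  proof -
    obtain r where "r \<in> carrier Q" "\<theta> y = a r y" using \<theta>[OF y] by (auto simp: orb_def)
    then have "inv\<^bsub>Q\<^esub> r \<in> carrier Q \<and> a (inv\<^bsub>Q\<^esub> r) (\<theta> y) = y"
      using y by (simp add: mult[symmetric] one)
    then show ?thesis unfolding \<kappa>_def by (rule someI)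
  qed
  have uniq: "q = r" if "q \<in> carrier Q" "r \<in> carrier Q" "y \<in> Y" "a q y = a r y" for q r y
  proof -
    have "a (inv\<^bsub>Q\<^esub> r \<otimes>\<^bsub>Q\<^esub> q) y = y"
      using that by (simp add: mult one flip: mult[of "inv\<^bsub>Q\<^esub> r" r])
    then have "inv\<^bsub>Q\<^esub> r \<otimes>\<^bsub>Q\<^esub> q = \<one>\<^bsub>Q\<^esub>" using that free by auto
    then show ?thesis using that by (metis Q.inv_closed Q.inv_inv Q.inv_equality)
  qed
  show ?thesis
  proof (rule that[of \<kappa>])
    show "\<kappa> (a q y) = q \<otimes>\<^bsub>Q\<^esub> \<kappa> y" if "q \<in> carrier Q" "y \<in> Y" for q y
    proof (rule uniq)
      have "\<theta> (a q y) = \<theta> y" using orb[OF that] by (simp add: \<theta>_def)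
      then have "a (\<kappa> (a q y)) (\<theta> y) = a q y" using \<kappa>[of "a q y"] that closed by auto
      also have "\<dots> = a (q \<otimes>\<^bsub>Q\<^esub> \<kappa> y) (\<theta> y)" using \<kappa>[OF that(2)] that \<theta>Y by (simp add: mult)
      finally show "a (\<kappa> (a q y)) (\<theta> y) = a (q \<otimes>\<^bsub>Q\<^esub> \<kappa> y) (\<theta> y)" .
    qed (use that \<kappa> closed \<theta>Y in auto)
    have "y\<^sub>0 \<in> orb y\<^sub>0" unfolding orb_def using one[OF \<open>y\<^sub>0 \<in> Y\<close>] Q.one_closed by (metis image_eqI)
    then have "\<theta> y\<^sub>0 = y\<^sub>0" by (simp add: \<theta>_def)
    then show "\<kappa> y\<^sub>0 = \<one>\<^bsub>Q\<^esub>" using \<kappa>[OF \<open>y\<^sub>0 \<in> Y\<close>] free[OF _ \<open>y\<^sub>0 \<in> Y\<close>] by simp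
  qed (use \<kappa> in blast)
qed

section \<open>Functions on cosets of a subgroup\<close>

context fp_group
begin

sublocale reg: right_action G "carrier G" "monoid.mult G"
  by unfold_locales (auto simp: m_assoc)

abbreviation D where "D \<equiv> dd G (monoid.mult G)"

text \<open>These are the functions on the cosets Qg, that is, the coefficients coinduced from Q.
  The right action behind \<open>D\<close> commutes with left translations, so \<open>D\<close>
  preserves them.\<close>

definition left_invariant :: "('q, 'r) monoid_scheme \<Rightarrow> ('q \<Rightarrow> 'a) \<Rightarrow> ('a list \<Rightarrow> 'a \<Rightarrow> int) \<Rightarrow> bool" where
  "left_invariant Q \<iota> f \<longleftrightarrow> (\<forall>xs q g. set xs \<subseteq> carrier G \<longrightarrow> q \<in> carrier Q \<longrightarrow> g \<in> carrier G \<longrightarrow>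
    f xs (\<iota> q \<otimes> g) = f xs g)"

lemma left_invariantD:
  "\<lbrakk>left_invariant Q \<iota> f; set xs \<subseteq> carrier G; q \<in> carrier Q; g \<in> carrier G\<rbrakk> \<Longrightarrow> f xs (\<iota> q \<otimes> g) = f xs g"
  by (simp add: left_invariant_def)

lemma left_invariant_diff:
  "\<lbrakk>left_invariant Q \<iota> f; left_invariant Q \<iota> f'\<rbrakk> \<Longrightarrow> left_invariant Q \<iota> (\<lambda>xs g. f xs g - f' xs g)"
  by (simp add: left_invariant_def)

lemma left_invariant_D:
  assumes "left_invariant Q \<iota> f" "\<iota> \<in> carrier Q \<rightarrow> carrier G"
  shows "left_invariant Q \<iota> (D f)"
  unfolding left_invariant_def
proof safe
  fix xs q g assume *: "set xs \<subseteq> carrier G" "q \<in> carrier Q" "g \<in> carrier G"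
  have "\<iota> q \<in> carrier G" using * assms(2) by auto
  moreover have "bar G (\<lambda>zs. f zs (\<iota> q \<otimes> g)) xs = bar G (\<lambda>zs. f zs g) xs"
    using * assms(1) by (intro bar_cong) (auto simp: left_invariant_def)
  moreover have "f ys (\<iota> q \<otimes> (g \<otimes> x)) = f ys (g \<otimes> x)" if "xs = x # ys" for x ys
    using * that assms(1) by (auto simp: left_invariant_def)
  ultimately show "D f xs (\<iota> q \<otimes> g) = D f xs g"
    using * by (cases xs) (auto simp: m_assoc dd_def)
qed

lemma left_invariant_cupf:
  assumes "left_invariant Q \<iota> f" "left_invariant Q \<iota> f'" "\<iota> \<in> carrier Q \<rightarrow> carrier G"
  shows "left_invariant Q \<iota> (cupf (monoid.mult G) f f')"
proof -
  have 1: "cupa (monoid.mult G) F f' (\<iota> q \<otimes> g) xs = cupa (monoid.mult G) F f' g xs"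
    if "set xs \<subseteq> carrier G" "q \<in> carrier Q" "g \<in> carrier G" for F q g xs
    using that
  proof (induction xs arbitrary: F g)
    case Nil
    then show ?case using assms(2) by (simp add: left_invariant_def)
  next
    case (Cons x xs)
    have "\<iota> q \<in> carrier G" using Cons.prems assms(3) by auto
    then have "\<iota> q \<otimes> g \<otimes> x = \<iota> q \<otimes> (g \<otimes> x)" using Cons.prems by (simp add: m_assoc)
    then show ?case
      using Cons left_invariantD[OF assms(2), of "x # xs" q g] by simp
  qed
  have "cupa (monoid.mult G) (\<lambda>zs. f zs (\<iota> q \<otimes> g)) f' g xs = cupa (monoid.mult G) (\<lambda>zs. f zs g) f' g xs"
    if "set xs \<subseteq> carrier G" "q \<in> carrier Q" "g \<in> carrier G" for q g xs
    using cupa_dvd_left[OF that(1), of 0 "\<lambda>zs. f zs (\<iota> q \<otimes> g) - f zs g" "monoid.mult G" f' g] assms(1) that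
    by (simp add: left_invariant_def cupa_diff)
  then show ?thesis using 1 by (simp add: left_invariant_def cupf_def)
qed

lemma D_translate:
  assumes "\<tau> \<in> carrier G" "set xs \<subseteq> carrier G" "g \<in> carrier G"
  shows "D (\<lambda>xs g. f xs (\<tau> \<otimes> g)) xs g = D f xs (\<tau> \<otimes> g)"
  using assms by (cases xs) (auto simp: m_assoc dd_def)

lemma D_const: "D (\<lambda>xs _. x xs) xs g = cob G x xs"
  by (cases xs) (auto simp: cob_Cons)

text \<open>The first face moves the base point from the identity to an element of Q, and invariance
  moves it back. Evaluation at the identity is thus a chain map to the cochains of Q.\<close>

lemma D_restrict:
  assumes "group Q" "\<iota> \<in> hom Q G" "left_invariant Q \<iota> f" "set qs \<subseteq> carrier Q"
  shows "D f (map \<iota> qs) \<one> = cob Q (\<lambda>qs. f (map \<iota> qs) \<one>) qs"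
proof (cases qs)
  case (Cons q rs)
  have "set (map \<iota> rs) \<subseteq> carrier G" "\<iota> q \<in> carrier G"
    using assms(2,4) Cons by (auto simp: hom_def)
  then have "f (map \<iota> rs) (\<one> \<otimes> \<iota> q) = f (map \<iota> rs) \<one>"
    using left_invariantD[OF assms(3), of "map \<iota> rs" q \<one>] assms(4) Cons by simp
  moreover have "cob G (\<lambda>zs. f zs \<one>) (map \<iota> qs) = cob Q (\<lambda>qs. f (map \<iota> qs) \<one>) qs"
    using assms by (intro cob_map)
  ultimately show ?thesis using Cons by (simp add: cob_Cons del: bar.simps)
qed simp

text \<open>On the groupoid with one object, conjugation is a functor isomorphic to the identity
  through the constant transformation \<open>\<gamma>\<close>; the prism of this transformation
  bounds the difference.\<close>

lemma conj_cohomologous: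
  assumes "\<gamma> \<in> carrier G" "cob G z \<asymp> (\<lambda>_. 0)"
  shows "\<exists>h. (\<lambda>xs. z (map (\<lambda>x. inv \<gamma> \<otimes> x \<otimes> \<gamma>) xs)) \<asymp> (\<lambda>xs. z xs + cob G h xs)"
proof -
  define r where conj_def: "r = (\<lambda>(_::unit) x. inv \<gamma> \<otimes> x \<otimes> \<gamma>)"
  interpret action_transformation G "UNIV :: unit set" "\<lambda>s _. s" "\<lambda>_. \<gamma>" r
    using assms(1) by unfold_locales (auto simp: conj_def)
  let ?h = "\<lambda>xs. prism (\<lambda>s _. s) (\<lambda>_. \<gamma>) r z () xs"
  have "int p dvd z (map (r ()) xs) - (z xs + cob G ?h xs)" if "set xs \<subseteq> carrier G" for xs
  proof -
    have "cob G ?h xs + prism (\<lambda>s _. s) (\<lambda>_. \<gamma>) r (cob G z) () xs = z (arrows (\<lambda>s _. s) r () xs) - z xs"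
      using homotopy[OF that, of "()" "\<lambda>xs _. z xs"] by (simp add: cob_def[abs_def])
    moreover have "int p dvd prism (\<lambda>s _. s) (\<lambda>_. \<gamma>) r (cob G z) () xs"
      using that assms(2) by (intro prism_dvd) (auto simp: ceq_def)
    moreover have "arrows (\<lambda>s _. s) r () xs = map (r ()) xs"
      by (induction xs) auto
    ultimately have "z (map (r ()) xs) - (z xs + cob G ?h xs) = prism (\<lambda>s _. s) (\<lambda>_. \<gamma>) r (cob G z) () xs"
      and "int p dvd prism (\<lambda>s _. s) (\<lambda>_. \<gamma>) r (cob G z) () xs" by simp_all
    then show ?thesis by presburger
  qed
  then have "(\<lambda>xs. z (map (r ()) xs)) \<asymp> (\<lambda>xs. z xs + cob G ?h xs)"
    by (simp add: ceq_def)
  moreover have "r () = (\<lambda>x. inv \<gamma> \<otimes> x \<otimes> \<gamma>)" by (simp add: conj_def)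
  ultimately show ?thesis by auto
qed

end

text \<open>\<open>\<kappa>\<close> is the Q-coordinate with respect to coset representatives among
  which the identity represents Q itself.\<close>

locale embedded_group = fp_group G p + Q: group Q for G (structure) and p and Q +
  fixes \<iota> and \<kappa>
  assumes \<iota>_hom: "\<iota> \<in> hom Q G"
    and \<kappa>_closed [simp]: "g \<in> carrier G \<Longrightarrow> \<kappa> g \<in> carrier Q"
    and \<kappa>_mult: "\<lbrakk>q \<in> carrier Q; g \<in> carrier G\<rbrakk> \<Longrightarrow> \<kappa> (\<iota> q \<otimes> g) = q \<otimes>\<^bsub>Q\<^esub> \<kappa> g"
    and \<kappa>_one: "\<kappa> \<one> = \<one>\<^bsub>Q\<^esub>"
begin

lemma \<iota>_closed [simp]: "q \<in> carrier Q \<Longrightarrow> \<iota> q \<in> carrier G"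
  using \<iota>_hom by (auto simp: hom_def)

lemma \<iota>_mult: "\<lbrakk>q \<in> carrier Q; r \<in> carrier Q\<rbrakk> \<Longrightarrow> \<iota> (q \<otimes>\<^bsub>Q\<^esub> r) = \<iota> q \<otimes> \<iota> r"
  using \<iota>_hom by (auto simp: hom_def)

lemma \<iota>_inv: "q \<in> carrier Q \<Longrightarrow> \<iota> (inv\<^bsub>Q\<^esub> q) = inv (\<iota> q)"
  using \<iota>_hom group_hom.hom_inv[of Q G \<iota>] by (simp add: group_hom_def group_hom_axioms_def Q.group_axioms group_axioms)

text \<open>The coordinates turn an arrow of the action groupoid into an element of Q. This is a
  functor by \<open>step_mult\<close>, and by \<open>step_invariant\<close> it depends only on the
  coset of the base point.\<close>

definition step where "step g x = inv\<^bsub>Q\<^esub> (\<kappa> g) \<otimes>\<^bsub>Q\<^esub> \<kappa> (g \<otimes> x)"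

abbreviation steps where "steps \<equiv> arrows (monoid.mult G) step"

lemma steps_closed: "\<lbrakk>g \<in> carrier G; set xs \<subseteq> carrier G\<rbrakk> \<Longrightarrow> set (steps g xs) \<subseteq> carrier Q"
  by (induction xs arbitrary: g) (auto simp: step_def)

lemma step_invariant: "\<lbrakk>q \<in> carrier Q; g \<in> carrier G; x \<in> carrier G\<rbrakk> \<Longrightarrow> step (\<iota> q \<otimes> g) x = step g x"
  by (simp add: step_def \<kappa>_mult m_assoc Q.inv_mult_group Q.m_assoc flip: Q.m_assoc[of "inv\<^bsub>Q\<^esub> q" q])

lemma steps_invariant: "\<lbrakk>q \<in> carrier Q; g \<in> carrier G; set xs \<subseteq> carrier G\<rbrakk> \<Longrightarrow> steps (\<iota> q \<otimes> g) xs = steps g xs"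
proof (induction xs arbitrary: g)
  case (Cons x xs)
  then have "\<iota> q \<otimes> g \<otimes> x = \<iota> q \<otimes> (g \<otimes> x)" by (simp add: m_assoc)
  then show ?case using Cons by (simp add: step_invariant)
qed simp

lemma step_mult: "\<lbrakk>g \<in> carrier G; x \<in> carrier G; y \<in> carrier G\<rbrakk> \<Longrightarrow> step g (x \<otimes> y) = step g x \<otimes>\<^bsub>Q\<^esub> step (g \<otimes> x) y"
  by (simp add: step_def m_assoc Q.m_assoc flip: Q.m_assoc[of "\<kappa> (g \<otimes> x)"])

text \<open>Pulling back along \<open>steps\<close> is a chain map from the cochains of Q to the
  left-invariant ones. By \<open>steps_one\<close> it is a section of the evaluation at the
  identity.\<close>

lemma D_induced:
  assumes "g \<in> carrier G" "set xs \<subseteq> carrier G"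
  shows "D (\<lambda>xs g. y (steps g xs)) xs g = cob Q y (steps g xs)"
proof -
  have "bar Q y (steps g xs) = bar G (\<lambda>zs. y (steps g zs)) xs"
    using assms by (intro reg.bar_arrows) (auto simp: step_mult)
  then show ?thesis by (cases xs) (auto simp: cob_Cons dd_def)
qed

text \<open>Elements that \<open>\<tau>\<close> conjugates into Q keep the base point in the coset
  of \<open>\<tau>\<close>, so the string is read in Q up to conjugation by the coordinate of
  \<open>\<tau>\<close>. With \<open>\<tau> = \<one>\<close> this is the restriction to Q, with a
  stable letter it is the comparison along an edge.\<close>

lemma steps_map:
  assumes "\<tau> \<in> carrier G" "set qs \<subseteq> L"
    and "\<And>a. a \<in> L \<Longrightarrow> j a \<in> carrier G \<and> \<psi> a \<in> carrier Q \<and> \<tau> \<otimes> j a = \<iota> (\<psi> a) \<otimes> \<tau>"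
  shows "steps \<tau> (map j qs) = map (\<lambda>a. inv\<^bsub>Q\<^esub> (\<kappa> \<tau>) \<otimes>\<^bsub>Q\<^esub> \<psi> a \<otimes>\<^bsub>Q\<^esub> \<kappa> \<tau>) qs"
  using assms(2)
proof (induction qs)
  case (Cons q qs)
  have *: "set (map j qs) \<subseteq> carrier G" "j q \<in> carrier G" "\<psi> q \<in> carrier Q" "\<tau> \<otimes> j q = \<iota> (\<psi> q) \<otimes> \<tau>"
    using Cons.prems assms(3) by auto
  have "step \<tau> (j q) = inv\<^bsub>Q\<^esub> (\<kappa> \<tau>) \<otimes>\<^bsub>Q\<^esub> \<psi> q \<otimes>\<^bsub>Q\<^esub> \<kappa> \<tau>"
    using * assms(1) by (simp add: step_def \<kappa>_mult Q.m_assoc)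
  moreover have "steps (\<tau> \<otimes> j q) (map j qs) = steps \<tau> (map j qs)"
    using * assms(1) by (simp add: steps_invariant)
  ultimately show ?case using Cons by simp
qed simp

lemma steps_one:
  assumes "set qs \<subseteq> carrier Q"
  shows "steps \<one> (map \<iota> qs) = qs"
proof -
  have "steps \<one> (map \<iota> qs) = map (\<lambda>a. inv\<^bsub>Q\<^esub> (\<kappa> \<one>) \<otimes>\<^bsub>Q\<^esub> a \<otimes>\<^bsub>Q\<^esub> \<kappa> \<one>) qs"
    using assms by (intro steps_map[where L = "carrier Q"]) auto
  also have "\<dots> = qs" using assms by (intro map_idI) (auto simp: \<kappa>_one)
  finally show ?thesis .
qed

text \<open>The natural transformation behind Shapiro's lemma: it moves the base point \<open>g\<close> of the action
  groupoid to \<open>\<iota> (\<kappa> g)\<close>, which lies in the coset of the identity.\<close>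

lemma shapiro_injective:
  assumes f: "left_invariant Q \<iota> f"
    and cocycle: "\<And>xs g. \<lbrakk>set xs \<subseteq> carrier G; g \<in> carrier G\<rbrakk> \<Longrightarrow> int p dvd D f xs g"
    and bd: "\<And>qs. set qs \<subseteq> carrier Q \<Longrightarrow> int p dvd f (map \<iota> qs) \<one> - cob Q y qs"
  shows "\<exists>e. left_invariant Q \<iota> e \<and>
    (\<forall>xs g. set xs \<subseteq> carrier G \<longrightarrow> g \<in> carrier G \<longrightarrow> int p dvd f xs g - D e xs g)"
proof -
  define \<eta> where "\<eta> g = inv g \<otimes> \<iota> (\<kappa> g)" for g
  define r where "r g x = inv (\<eta> g) \<otimes> x \<otimes> \<eta> (g \<otimes> x)" for g x
  interpret t: action_transformation G "carrier G" "monoid.mult G" \<eta> r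
    by unfold_locales (auto simp: \<eta>_def r_def)
  have r: "r g x = \<iota> (step g x)" if "g \<in> carrier G" "x \<in> carrier G" for g x
  proof -
    have "r g x = inv (\<iota> (\<kappa> g)) \<otimes> ((g \<otimes> x) \<otimes> inv (g \<otimes> x)) \<otimes> \<iota> (\<kappa> (g \<otimes> x))"
      unfolding r_def \<eta>_def using that by (simp only: inv_mult_group inv_inv m_assoc m_closed inv_closed \<iota>_closed \<kappa>_closed)
    then show ?thesis using that by (simp add: step_def \<iota>_mult \<iota>_inv del: inv_mult_group)
  qed
  have arr: "arrows (monoid.mult G) r g xs = map \<iota> (steps g xs)" if "g \<in> carrier G" "set xs \<subseteq> carrier G" for g xs
    using that by (induction xs arbitrary: g) (auto simp: r)
  let ?H = "\<lambda>xs g. prism (monoid.mult G) \<eta> r (\<lambda>zs. f zs g) g xs"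
  have \<eta>_inv: "\<eta> (\<iota> q \<otimes> g) = \<eta> g" if "q \<in> carrier Q" "g \<in> carrier G" for q g
    using that by (simp add: \<eta>_def \<kappa>_mult inv_mult_group \<iota>_mult m_assoc flip: m_assoc[of "inv (\<iota> q)" "\<iota> q"])
  have arr_inv: "arrows (monoid.mult G) r (\<iota> q \<otimes> g) xs = arrows (monoid.mult G) r g xs"
    if "q \<in> carrier Q" "g \<in> carrier G" "set xs \<subseteq> carrier G" for q g xs
    using that by (simp add: arr steps_invariant)
  have prism_inv: "prism (monoid.mult G) \<eta> r F (\<iota> q \<otimes> g) xs = prism (monoid.mult G) \<eta> r F g xs"
    if "q \<in> carrier Q" "g \<in> carrier G" "set xs \<subseteq> carrier G" for F q g xs
    using that
  proof (induction xs arbitrary: F g)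
    case (Cons x xs)
    then have "\<iota> q \<otimes> g \<otimes> x = \<iota> q \<otimes> (g \<otimes> x)" by (simp add: m_assoc)
    then show ?case using Cons arr_inv[of q g "x # xs"] by (simp add: \<eta>_inv)
  qed (simp add: \<eta>_inv)
  have "left_invariant Q \<iota> ?H"
    unfolding left_invariant_def
  proof safe
    fix xs q g assume *: "set xs \<subseteq> carrier G" "q \<in> carrier Q" "g \<in> carrier G"
    have "prism (monoid.mult G) \<eta> r (\<lambda>zs. f zs (\<iota> q \<otimes> g)) g xs - prism (monoid.mult G) \<eta> r (\<lambda>zs. f zs g) g xs = 0"
      using t.prism_dvd[OF *(1,3), of 0 "\<lambda>zs. f zs (\<iota> q \<otimes> g) - f zs g"] f *
      by (simp add: prism_diff left_invariant_def)
    then show "?H xs (\<iota> q \<otimes> g) = ?H xs g" using * by (simp add: prism_inv)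
  qed
  moreover have "left_invariant Q \<iota> (\<lambda>xs g. y (steps g xs))"
    by (simp add: left_invariant_def steps_invariant)
  \<comment> \<open>The homotopy identifies \<open>f\<close> modulo \<open>p\<close> with its
    restriction to Q pulled back along \<open>steps\<close>, up to \<open>D\<close> of the prism.
    The pulled-back part is bounded by \<open>y (steps g xs)\<close>, hence this primitive.\<close>
  ultimately have "left_invariant Q \<iota> (\<lambda>xs g. y (steps g xs) - ?H xs g)"
    by (intro left_invariant_diff)
  moreover have "int p dvd f xs g - D (\<lambda>xs g. y (steps g xs) - ?H xs g) xs g"
    if xs: "set xs \<subseteq> carrier G" and g: "g \<in> carrier G" for xs g
  proof -
    have qs: "set (steps g xs) \<subseteq> carrier Q" using that by (intro steps_closed)
    have "g \<otimes> \<eta> g = \<iota> (\<kappa> g) \<otimes> \<one>" using g by (simp add: \<eta>_def flip: m_assoc)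
    moreover have "set (map \<iota> (steps g xs)) \<subseteq> carrier G" using qs by auto
    ultimately have "f (arrows (monoid.mult G) r g xs) (g \<otimes> \<eta> g) = f (map \<iota> (steps g xs)) \<one>"
      using left_invariantD[OF f, of "map \<iota> (steps g xs)" "\<kappa> g" \<one>] g xs by (simp add: arr)
    then have "D ?H xs g + prism (monoid.mult G) \<eta> r (\<lambda>zs. D f zs g) g xs = f (map \<iota> (steps g xs)) \<one> - f xs g"
      using t.homotopy[OF xs g, of f] by simp
    moreover have "int p dvd prism (monoid.mult G) \<eta> r (\<lambda>zs. D f zs g) g xs"
      using that by (intro t.prism_dvd cocycle)
    moreover have "int p dvd f (map \<iota> (steps g xs)) \<one> - cob Q y (steps g xs)"
      using bd[OF qs] .
    moreover have "D (\<lambda>xs g. y (steps g xs) - ?H xs g) xs g = cob Q y (steps g xs) - D ?H xs g"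
      using that by (simp only: dd_diff D_induced)
    ultimately have "f xs g - D (\<lambda>xs g. y (steps g xs) - ?H xs g) xs g =
        (f (map \<iota> (steps g xs)) \<one> - cob Q y (steps g xs)) - prism (monoid.mult G) \<eta> r (\<lambda>zs. D f zs g) g xs"
      by linarith
    then show ?thesis
      using bd[OF qs] t.prism_dvd[OF xs g cocycle[OF _ g]] by (simp only: dvd_diff)
  qed
  ultimately show ?thesis by blast
qed

end

lemma (in fp_group) embedded_groupI:
  assumes "group Q" "\<iota> \<in> hom Q G" "inj_on \<iota> (carrier Q)"
  shows "\<exists>\<kappa>. embedded_group G p Q \<iota> \<kappa>"
proof -
  interpret Q: group Q by fact
  interpret h: group_hom Q G \<iota> using assms by (simp add: group_hom_def group_hom_axioms_def group_axioms)
  obtain \<kappa> where "\<And>g. g \<in> carrier G \<Longrightarrow> \<kappa> g \<in> carrier Q"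
    "\<And>q g. \<lbrakk>q \<in> carrier Q; g \<in> carrier G\<rbrakk> \<Longrightarrow> \<kappa> (\<iota> q \<otimes> g) = q \<otimes>\<^bsub>Q\<^esub> \<kappa> g" "\<kappa> \<one> = \<one>\<^bsub>Q\<^esub>"
  proof (rule free_action_equivariant_map[of Q "carrier G" "\<lambda>q g. \<iota> q \<otimes> g" \<one>])
    fix q y assume *: "q \<in> carrier Q" "y \<in> carrier G" "\<iota> q \<otimes> y = y"
    then have "\<iota> q = \<iota> \<one>\<^bsub>Q\<^esub>" by (metis h.hom_closed h.hom_one one_closed r_cancel_one)
    then show "q = \<one>\<^bsub>Q\<^esub>" using * assms(3) by (metis inj_onD Q.one_closed)
  qed (use assms in \<open>auto simp: m_assoc\<close>)
  then show ?thesis using assms(2)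
    by (intro exI[of _ \<kappa>]) (unfold_locales, auto)
qed


section \<open>Cohomology of a graph of groups\<close>

text \<open>A function \<open>w v\<close> invariant under \<open>P v\<close> is a function on the
  vertices of type \<open>v\<close> in the tree. The edge of type \<open>e\<close> at
  \<open>g\<close> joins \<open>g\<close> in type \<open>src e\<close> to
  \<open>\<tau> e \<otimes> g\<close> in type \<open>tgt e\<close>. The last two assumptions are
  exactness of the coefficient sequence in the middle and on the right, over the integers; reduction
  modulo \<open>p\<close> takes place in \<open>glue\<close>.\<close>

locale cohomology_graph = fp_group G p for G (structure) and p +
  fixes V :: "'v set" and P :: "'v \<Rightarrow> 'q monoid" and \<iota> :: "'v \<Rightarrow> 'q \<Rightarrow> 'a"
    and E :: "'e set" and src tgt :: "'e \<Rightarrow> 'v"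
    and \<phi> :: "'e \<Rightarrow> 'q \<Rightarrow> 'q" and \<tau> :: "'e \<Rightarrow> 'a"
  assumes V_nonempty: "V \<noteq> {}"
    and P_group: "v \<in> V \<Longrightarrow> group (P v)"
    and \<iota>_hom: "v \<in> V \<Longrightarrow> \<iota> v \<in> hom (P v) G"
    and \<iota>_inj: "v \<in> V \<Longrightarrow> inj_on (\<iota> v) (carrier (P v))"
    and src_V: "e \<in> E \<Longrightarrow> src e \<in> V" and tgt_V: "e \<in> E \<Longrightarrow> tgt e \<in> V"
    and \<phi>_hom: "e \<in> E \<Longrightarrow> \<phi> e \<in> hom (P (src e)) (P (tgt e))"
    and \<tau>_closed: "e \<in> E \<Longrightarrow> \<tau> e \<in> carrier G"
    and \<tau>_conj: "\<lbrakk>e \<in> E; a \<in> carrier (P (src e))\<rbrakk> \<Longrightarrow> \<tau> e \<otimes> \<iota> (src e) a = \<iota> (tgt e) (\<phi> e a) \<otimes> \<tau> e"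
    and invariant_const: "\<And>w. \<lbrakk>\<And>v q g. \<lbrakk>v \<in> V; q \<in> carrier (P v); g \<in> carrier G\<rbrakk> \<Longrightarrow> w v (\<iota> v q \<otimes> g) = w v g;
        \<And>e g. \<lbrakk>e \<in> E; g \<in> carrier G\<rbrakk> \<Longrightarrow> w (tgt e) (\<tau> e \<otimes> g) = w (src e) g\<rbrakk>
      \<Longrightarrow> \<exists>c :: int. \<forall>v\<in>V. \<forall>g\<in>carrier G. w v g = c"
    and solvable: "\<And>u. (\<And>e a g. \<lbrakk>e \<in> E; a \<in> carrier (P (src e)); g \<in> carrier G\<rbrakk> \<Longrightarrow> u e (\<iota> (src e) a \<otimes> g) = u e g)
      \<Longrightarrow> \<exists>w. (\<forall>v\<in>V. \<forall>q\<in>carrier (P v). \<forall>g\<in>carrier G. w v (\<iota> v q \<otimes> g) = w v g) \<and>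
        (\<forall>e\<in>E. \<forall>g\<in>carrier G. w (tgt e) (\<tau> e \<otimes> g) - w (src e) g = (u e g :: int))"
begin

lemma \<iota>_closed [simp]: "\<lbrakk>v \<in> V; q \<in> carrier (P v)\<rbrakk> \<Longrightarrow> \<iota> v q \<in> carrier G"
  using \<iota>_hom by (auto simp: hom_def)

lemma \<iota>_Pi: "v \<in> V \<Longrightarrow> \<iota> v \<in> carrier (P v) \<rightarrow> carrier G"
  by auto

lemma \<phi>_closed [simp]: "\<lbrakk>e \<in> E; a \<in> carrier (P (src e))\<rbrakk> \<Longrightarrow> \<phi> e a \<in> carrier (P (tgt e))"
  using \<phi>_hom by (auto simp: hom_def)

abbreviation difference where
  "difference c e xs g \<equiv> c (tgt e) xs (\<tau> e \<otimes> g) - c (src e) xs g"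

abbreviation vertex_invariant where
  "vertex_invariant c \<equiv> \<forall>v\<in>V. left_invariant (P v) (\<iota> v) (c v)"

lemma difference_invariant:
  assumes "vertex_invariant c" "e \<in> E"
  shows "left_invariant (P (src e)) (\<iota> (src e)) (difference c e)"
  unfolding left_invariant_def
proof safe
  fix xs a g assume *: "set xs \<subseteq> carrier G" "a \<in> carrier (P (src e))" "g \<in> carrier G"
  have "\<tau> e \<otimes> (\<iota> (src e) a \<otimes> g) = \<iota> (tgt e) (\<phi> e a) \<otimes> (\<tau> e \<otimes> g)"
    using * assms(2) \<tau>_conj[of e a] by (simp add: src_V tgt_V \<tau>_closed flip: m_assoc)
  then show "difference c e xs (\<iota> (src e) a \<otimes> g) = difference c e xs g"
    using * assms
      left_invariantD[of "P (tgt e)" "\<iota> (tgt e)" "c (tgt e)" xs "\<phi> e a" "\<tau> e \<otimes> g"]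
      left_invariantD[of "P (src e)" "\<iota> (src e)" "c (src e)" xs a g]
    by (simp add: src_V tgt_V \<tau>_closed)
qed

lemma D_difference:
  assumes "e \<in> E" "set xs \<subseteq> carrier G" "g \<in> carrier G"
  shows "D (difference c e) xs g = D (c (tgt e)) xs (\<tau> e \<otimes> g) - D (c (src e)) xs g"
  using assms D_translate[OF \<tau>_closed, of e xs g "c (tgt e)"] by (simp add: dd_diff)

text \<open>Exactness of the coefficient sequence, applied degreewise.\<close>

lemma glue:
  assumes c: "vertex_invariant c"
    and \<epsilon>: "\<And>e. e \<in> E \<Longrightarrow> left_invariant (P (src e)) (\<iota> (src e)) (\<epsilon> e)"
    and bd: "\<And>e xs g. \<lbrakk>e \<in> E; set xs \<subseteq> carrier G; g \<in> carrier G\<rbrakk> \<Longrightarrow>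
      int p dvd difference c e xs g - D (\<epsilon> e) xs g"
  shows "\<exists>x w. vertex_invariant w \<and> (\<forall>v\<in>V. \<forall>xs g. set xs \<subseteq> carrier G \<longrightarrow> g \<in> carrier G \<longrightarrow>
    int p dvd x xs - (c v xs g - D (w v) xs g))"
proof -
  \<comment> \<open>Invariance of \<open>\<epsilon>\<close> is known only for strings over G; the
    zero function elsewhere makes \<open>solvable\<close> applicable to every list, so that one
    choice function results.\<close>
  let ?u = "\<lambda>xs e g. if set xs \<subseteq> carrier G then \<epsilon> e xs g mod int p else 0"
  have "\<exists>w. (\<forall>v\<in>V. \<forall>q\<in>carrier (P v). \<forall>g\<in>carrier G. w v (\<iota> v q \<otimes> g) = w v g) \<and>
        (\<forall>e\<in>E. \<forall>g\<in>carrier G. w (tgt e) (\<tau> e \<otimes> g) - w (src e) g = ?u xs e g)" for xs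
    using \<epsilon> by (intro solvable) (auto simp: left_invariant_def)
  then obtain W where W: "\<And>xs v q g. \<lbrakk>v \<in> V; q \<in> carrier (P v); g \<in> carrier G\<rbrakk> \<Longrightarrow> W xs v (\<iota> v q \<otimes> g) = W xs v g"
    "\<And>xs e g. \<lbrakk>e \<in> E; g \<in> carrier G\<rbrakk> \<Longrightarrow> W xs (tgt e) (\<tau> e \<otimes> g) - W xs (src e) g = ?u xs e g"
    by metis
  define w where "w = (\<lambda>v xs. W xs v)"
  have w: "vertex_invariant w" using W(1) by (simp add: left_invariant_def w_def)
  \<comment> \<open>\<open>w\<close> has edge differences congruent to \<open>\<epsilon>\<close>. As
    \<open>D\<close> commutes with edge differences, those of \<open>c - D w\<close> vanish modulo
    \<open>p\<close>.\<close>
  define c' where "c' v xs g = c v xs g - D (w v) xs g" for v xs g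
  have c': "left_invariant (P v) (\<iota> v) (c' v)" if "v \<in> V" for v
    unfolding c'_def using that c w \<iota>_Pi by (intro left_invariant_diff left_invariant_D) auto
  have diff: "int p dvd difference c' e xs g" if "e \<in> E" "set xs \<subseteq> carrier G" "g \<in> carrier G" for e xs g
  proof -
    have "difference c' e xs g =
        (difference c e xs g - D (\<epsilon> e) xs g) + (D (\<epsilon> e) xs g - D (difference w e) xs g)"
      using D_difference[OF that, of w] unfolding c'_def by linarith
    moreover have "int p dvd D (\<epsilon> e) xs g - D (difference w e) xs g"
      using that W(2) by (intro reg.dd_cong) (auto simp: w_def mod_dvd_diff)
    ultimately show ?thesis
      using bd[OF that] by (simp only: dvd_add)
  qed
  \<comment> \<open>\<open>invariant_const\<close> asks for equalities, which hold after passing to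
    residues.\<close>
  have "\<exists>x. \<forall>v\<in>V. \<forall>g\<in>carrier G. c' v xs g mod int p = x" if xs: "set xs \<subseteq> carrier G" for xs
  proof (rule invariant_const)
    show "c' v xs (\<iota> v q \<otimes> g) mod int p = c' v xs g mod int p"
      if "v \<in> V" "q \<in> carrier (P v)" "g \<in> carrier G" for v q g
      using left_invariantD[OF c'[OF that(1)] xs that(2,3)] by simp
    show "c' (tgt e) xs (\<tau> e \<otimes> g) mod int p = c' (src e) xs g mod int p" if "e \<in> E" "g \<in> carrier G" for e g
      using diff[OF that(1) xs that(2)] by (simp add: mod_eq_dvd_iff)
  qed
  then obtain x where "\<And>xs v g. \<lbrakk>set xs \<subseteq> carrier G; v \<in> V; g \<in> carrier G\<rbrakk> \<Longrightarrow> c' v xs g mod int p = x xs"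
    by metis
  then have "int p dvd x xs - c' v xs g" if "set xs \<subseteq> carrier G" "v \<in> V" "g \<in> carrier G" for xs v g
    using that mod_dvd_diff(1)[of "int p" "c' v xs g"] by simp
  then show ?thesis using w unfolding c'_def by blast
qed

text \<open>\<open>x\<close> arises from \<open>c\<close> by subtracting \<open>D w\<close>, which
  \<open>D\<close> annihilates. Evaluating at the identity loses nothing, since \<open>x\<close> is
  constant in the base point.\<close>

lemma cob_glued:
  assumes "v \<in> V" and "\<And>xs g. \<lbrakk>set xs \<subseteq> carrier G; g \<in> carrier G\<rbrakk> \<Longrightarrow> int p dvd x xs - (c xs g - D w xs g)"
    and "set xs \<subseteq> carrier G"
  shows "int p dvd cob G x xs - D c xs \<one>"
proof -
  have "int p dvd D (\<lambda>xs _. x xs) xs \<one> - D (\<lambda>xs g. c xs g - D w xs g) xs \<one>"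
    using assms by (intro reg.dd_cong) auto
  moreover have "D (\<lambda>xs g. c xs g - D w xs g) xs \<one> = D c xs \<one>"
    using reg.dd_dd[OF assms(3), of \<one> w] by (simp add: dd_diff)
  ultimately show ?thesis by (simp add: D_const)
qed

text \<open>Each \<open>z v\<close> induces an invariant cocycle \<open>c v\<close> on the vertices
  of its type. Compatibility makes the edge differences coboundaries on the edge groups, hence by
  Shapiro's lemma coboundaries on the edges, and \<open>glue\<close> corrects the \<open>c v\<close>
  to a cochain constant in the base point.\<close>

theorem restriction_surjective:
  assumes z: "\<And>v. v \<in> V \<Longrightarrow> ceq p (P v) (cob (P v) (z v)) (\<lambda>_. 0)"
    and compat: "\<And>e. e \<in> E \<Longrightarrow> \<exists>y. ceq p (P (src e)) (\<lambda>qs. z (tgt e) (map (\<phi> e) qs)) (\<lambda>qs. z (src e) qs + cob (P (src e)) y qs)"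
  shows "\<exists>x. cob G x \<asymp> (\<lambda>_. 0) \<and>
    (\<forall>v\<in>V. \<exists>h. ceq p (P v) (\<lambda>qs. x (map (\<iota> v) qs)) (\<lambda>qs. z v qs + cob (P v) h qs))"
proof -
  have "\<forall>v\<in>V. \<exists>\<kappa>. embedded_group G p (P v) (\<iota> v) \<kappa>"
    using P_group \<iota>_hom \<iota>_inj by (auto intro!: embedded_groupI)
  then obtain \<kappa> where \<kappa>: "\<And>v. v \<in> V \<Longrightarrow> embedded_group G p (P v) (\<iota> v) (\<kappa> v)"
    by metis
  define c where "c v xs g = z v (embedded_group.steps G (P v) (\<kappa> v) g xs)" for v xs g
  have c_inv: "left_invariant (P v) (\<iota> v) (c v)" if "v \<in> V" for v
  proof -
    interpret embedded_group G p "P v" "\<iota> v" "\<kappa> v" using \<kappa>[OF that] .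
    show ?thesis by (simp add: left_invariant_def c_def steps_invariant)
  qed
  have Dc: "int p dvd D (c v) xs g" if "v \<in> V" "set xs \<subseteq> carrier G" "g \<in> carrier G" for v xs g
  proof -
    interpret embedded_group G p "P v" "\<iota> v" "\<kappa> v" using \<kappa>[OF that(1)] .
    show ?thesis using z[OF that(1)] D_induced[OF that(3,2), of "z v"] steps_closed[OF that(3,2)]
      by (simp add: ceq_def c_def[abs_def])
  qed
  have c_one: "c v (map (\<iota> v) qs) \<one> = z v qs" if "v \<in> V" "set qs \<subseteq> carrier (P v)" for v qs
  proof -
    interpret embedded_group G p "P v" "\<iota> v" "\<kappa> v" using \<kappa>[OF that(1)] .
    show ?thesis using that(2) by (simp add: c_def steps_one)
  qed
  have "\<exists>\<epsilon>. left_invariant (P (src e)) (\<iota> (src e)) \<epsilon> \<and> (\<forall>xs g. set xs \<subseteq> carrier G \<longrightarrow> g \<in> carrier G \<longrightarrow>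
      int p dvd difference c e xs g - D \<epsilon> xs g)" if e: "e \<in> E" for e
  proof -
    have st: "src e \<in> V" "tgt e \<in> V" "\<tau> e \<in> carrier G" using e src_V tgt_V \<tau>_closed by auto
    interpret l: embedded_group G p "P (src e)" "\<iota> (src e)" "\<kappa> (src e)" using \<kappa>[OF st(1)] .
    interpret t: embedded_group G p "P (tgt e)" "\<iota> (tgt e)" "\<kappa> (tgt e)" using \<kappa>[OF st(2)] .
    interpret T: fp_group "P (tgt e)" p using p_gt_1 by unfold_locales
    obtain y where y: "ceq p (P (src e)) (\<lambda>qs. z (tgt e) (map (\<phi> e) qs)) (\<lambda>qs. z (src e) qs + cob (P (src e)) y qs)"
      using compat[OF e] by blast
    \<comment> \<open>The coordinate of \<open>\<tau> e\<close> in the target group need not be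
      trivial. At \<open>\<tau> e\<close> the induced cocycle is therefore \<open>z (tgt e)\<close>
      conjugated by \<open>k\<close>, and \<open>h\<close> accounts for the conjugation.\<close>
    define k where "k = \<kappa> (tgt e) (\<tau> e)"
    obtain h where h: "ceq p (P (tgt e)) (\<lambda>qs. z (tgt e) (map (\<lambda>x. inv\<^bsub>P (tgt e)\<^esub> k \<otimes>\<^bsub>P (tgt e)\<^esub> x \<otimes>\<^bsub>P (tgt e)\<^esub> k) qs))
        (\<lambda>qs. z (tgt e) qs + cob (P (tgt e)) h qs)"
      using T.conj_cohomologous[of k "z (tgt e)"] z[OF st(2)] st by (auto simp: k_def)
    show ?thesis
    proof (rule l.shapiro_injective[where y = "\<lambda>qs. y qs + h (map (\<phi> e) qs)"])
      show "left_invariant (P (src e)) (\<iota> (src e)) (difference c e)"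
        using c_inv e by (intro difference_invariant) auto
      show "int p dvd D (difference c e) xs g" if "set xs \<subseteq> carrier G" "g \<in> carrier G" for xs g
        using that e st Dc by (simp add: D_difference)
      fix qs assume qs: "set qs \<subseteq> carrier (P (src e))"
      let ?\<phi> = "map (\<phi> e) qs"
      have "t.steps (\<tau> e) (map (\<iota> (src e)) qs) =
          map (\<lambda>a. inv\<^bsub>P (tgt e)\<^esub> k \<otimes>\<^bsub>P (tgt e)\<^esub> \<phi> e a \<otimes>\<^bsub>P (tgt e)\<^esub> k) qs"
        unfolding k_def using qs e st \<tau>_conj[OF e]
        by (intro t.steps_map[where L = "carrier (P (src e))"]) auto
      then have 1: "difference c e (map (\<iota> (src e)) qs) \<one> =
          z (tgt e) (map (\<lambda>x. inv\<^bsub>P (tgt e)\<^esub> k \<otimes>\<^bsub>P (tgt e)\<^esub> x \<otimes>\<^bsub>P (tgt e)\<^esub> k) ?\<phi>) - z (src e) qs"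
        using qs st c_one[OF st(1), of qs] by (simp add: c_def[of "tgt e"] comp_def)
      have "set ?\<phi> \<subseteq> carrier (P (tgt e))" using qs e by auto
      then have 2: "int p dvd z (tgt e) (map (\<lambda>x. inv\<^bsub>P (tgt e)\<^esub> k \<otimes>\<^bsub>P (tgt e)\<^esub> x \<otimes>\<^bsub>P (tgt e)\<^esub> k) ?\<phi>)
          - (z (tgt e) ?\<phi> + cob (P (tgt e)) h ?\<phi>)"
        using h unfolding ceq_def by blast
      have 3: "int p dvd z (tgt e) ?\<phi> - (z (src e) qs + cob (P (src e)) y qs)"
        using y qs unfolding ceq_def by blast
      have 4: "cob (P (tgt e)) h ?\<phi> = cob (P (src e)) (\<lambda>qs. h (map (\<phi> e) qs)) qs"
        using qs by (intro cob_map[OF P_group[OF st(1)] \<phi>_hom[OF e]])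
      have "difference c e (map (\<iota> (src e)) qs) \<one> - cob (P (src e)) (\<lambda>qs. y qs + h (map (\<phi> e) qs)) qs =
        (z (tgt e) (map (\<lambda>x. inv\<^bsub>P (tgt e)\<^esub> k \<otimes>\<^bsub>P (tgt e)\<^esub> x \<otimes>\<^bsub>P (tgt e)\<^esub> k) ?\<phi>)
          - (z (tgt e) ?\<phi> + cob (P (tgt e)) h ?\<phi>)) + (z (tgt e) ?\<phi> - (z (src e) qs + cob (P (src e)) y qs))"
        unfolding 1 4 cob_add by linarith
      then show "int p dvd difference c e (map (\<iota> (src e)) qs) \<one> - cob (P (src e)) (\<lambda>qs. y qs + h (map (\<phi> e) qs)) qs"
        using dvd_add[OF 2 3] by simp
    qed
  qed
  then obtain \<epsilon> where \<epsilon>: "\<And>e. e \<in> E \<Longrightarrow> left_invariant (P (src e)) (\<iota> (src e)) (\<epsilon> e)"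
    "\<And>e xs g. \<lbrakk>e \<in> E; set xs \<subseteq> carrier G; g \<in> carrier G\<rbrakk> \<Longrightarrow> int p dvd difference c e xs g - D (\<epsilon> e) xs g"
    by metis
  obtain x w where w: "vertex_invariant w"
    and x: "\<And>v xs g. \<lbrakk>v \<in> V; set xs \<subseteq> carrier G; g \<in> carrier G\<rbrakk> \<Longrightarrow> int p dvd x xs - (c v xs g - D (w v) xs g)"
    using glue[of c \<epsilon>] c_inv \<epsilon> by blast
  obtain v\<^sub>0 where v\<^sub>0: "v\<^sub>0 \<in> V" using V_nonempty by blast
  have cocycle: "int p dvd cob G x xs" if "set xs \<subseteq> carrier G" for xs
  proof -
    have "int p dvd cob G x xs - D (c v\<^sub>0) xs \<one>"
      using v\<^sub>0 x that by (intro cob_glued) auto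
    then show ?thesis using dvd_add[OF _ Dc[OF v\<^sub>0 that one_closed], of "cob G x xs - D (c v\<^sub>0) xs \<one>"] by simp
  qed
  \<comment> \<open>The correction subtracted in \<open>glue\<close> is \<open>D (w v)\<close>,
    which at the identity is the coboundary of the restricted \<open>w v\<close>; hence the minus
    sign.\<close>
  have "ceq p (P v) (\<lambda>qs. x (map (\<iota> v) qs)) (\<lambda>qs. z v qs + cob (P v) (\<lambda>qs. - w v (map (\<iota> v) qs) \<one>) qs)"
    if v: "v \<in> V" for v
    unfolding ceq_def
  proof safe
    fix qs assume qs: "set qs \<subseteq> carrier (P v)"
    have "D (w v) (map (\<iota> v) qs) \<one> = cob (P v) (\<lambda>qs. w v (map (\<iota> v) qs) \<one>) qs"
      using v qs w P_group \<iota>_hom by (intro D_restrict) auto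
    moreover have "int p dvd x (map (\<iota> v) qs) - (c v (map (\<iota> v) qs) \<one> - D (w v) (map (\<iota> v) qs) \<one>)"
      using v qs by (intro x) auto
    ultimately show "int p dvd x (map (\<iota> v) qs) - (z v qs + cob (P v) (\<lambda>qs. - w v (map (\<iota> v) qs) \<one>) qs)"
      using c_one[OF v qs] by (simp add: cob_uminus)
  qed
  moreover have "cob G x \<asymp> (\<lambda>_. 0)" using cocycle by (simp add: ceq_def)
  ultimately show ?thesis by blast
qed

theorem kernel_square_zero:
  assumes "cob G x \<asymp> (\<lambda>_. 0)" "cob G x' \<asymp> (\<lambda>_. 0)"
    and "\<And>v. v \<in> V \<Longrightarrow> \<exists>h. ceq p (P v) (\<lambda>qs. x (map (\<iota> v) qs)) (cob (P v) h)"
    and "\<And>v. v \<in> V \<Longrightarrow> \<exists>h. ceq p (P v) (\<lambda>qs. x' (map (\<iota> v) qs)) (cob (P v) h)"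
  shows "\<exists>m. cp x x' \<asymp> cob G m"
proof -
  \<comment> \<open>A class that vanishes on \<open>P v\<close> is a constant function on the cosets
    whose restriction is bounded, so \<open>shapiro_injective\<close> gives it a primitive on the
    vertices of type \<open>v\<close>.\<close>
  have lift: "\<exists>c. left_invariant (P v) (\<iota> v) c \<and> (\<forall>xs g. set xs \<subseteq> carrier G \<longrightarrow> g \<in> carrier G \<longrightarrow>
      int p dvd y xs - D c xs g)"
    if "cob G y \<asymp> (\<lambda>_. 0)" "v \<in> V" and bd: "\<exists>h. ceq p (P v) (\<lambda>qs. y (map (\<iota> v) qs)) (cob (P v) h)" for y v
  proof -
    obtain \<kappa> where "embedded_group G p (P v) (\<iota> v) \<kappa>"
      using embedded_groupI[OF P_group \<iota>_hom \<iota>_inj] \<open>v \<in> V\<close> by blast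
    then interpret embedded_group G p "P v" "\<iota> v" \<kappa> .
    obtain h where "ceq p (P v) (\<lambda>qs. y (map (\<iota> v) qs)) (cob (P v) h)" using bd by blast
    then show ?thesis using that(1)
      by (intro shapiro_injective[where y = h]) (auto simp: left_invariant_def D_const ceq_def)
  qed
  obtain c where c: "vertex_invariant c"
    "\<And>v xs g. \<lbrakk>v \<in> V; set xs \<subseteq> carrier G; g \<in> carrier G\<rbrakk> \<Longrightarrow> int p dvd x xs - D (c v) xs g"
    using lift[OF assms(1) _ assms(3)] by metis
  obtain c' where c': "vertex_invariant c'"
    "\<And>v xs g. \<lbrakk>v \<in> V; set xs \<subseteq> carrier G; g \<in> carrier G\<rbrakk> \<Longrightarrow> int p dvd x' xs - D (c' v) xs g"
    using lift[OF assms(2) _ assms(4)] by metis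
  let ?cup = "cupf (monoid.mult G)"
  let ?x' = "\<lambda>xs (_::'a). x' xs"
  have x'_inv: "left_invariant Q j ?x'" for Q :: "'q monoid" and j by (simp add: left_invariant_def)
  define b where "b v = ?cup (c v) ?x'" for v
  have b: "vertex_invariant b"
    unfolding b_def using c(1) x'_inv \<iota>_Pi by (auto intro!: left_invariant_cupf)
  \<comment> \<open>\<open>alt\<close> cancels the sign of the Leibniz rule, so that
    \<open>D (\<epsilon> e)\<close> contains the difference of \<open>c\<close> times
    \<open>D (c' (src e))\<close>. The other summand vanishes modulo \<open>p\<close>: the
    difference of \<open>c\<close> is a cocycle because \<open>D\<close> of \<open>c\<close> is
    congruent to \<open>x\<close> at both ends of the edge.\<close>
  define \<epsilon> where "\<epsilon> e = ?cup (\<lambda>xs g. alt (\<lambda>zs. difference c e zs g) xs) (c' (src e))" for e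
  have cup_const: "?cup f ?x' xs g = cp (\<lambda>zs. f zs g) x' xs" for f xs g
  proof -
    have "cupa (monoid.mult G) F ?x' g xs = cp F x' xs" for F
      by (induction xs arbitrary: F g) (auto simp: cp_Cons)
    then show ?thesis by (simp add: cupf_def)
  qed
  have \<epsilon>_inv: "left_invariant (P (src e)) (\<iota> (src e)) (\<epsilon> e)" if e: "e \<in> E" for e
    unfolding \<epsilon>_def
  proof (rule left_invariant_cupf)
    show "left_invariant (P (src e)) (\<iota> (src e)) (\<lambda>xs g. alt (\<lambda>zs. difference c e zs g) xs)"
      using difference_invariant[OF c(1) e] by (simp add: left_invariant_def alt_def)
    show "left_invariant (P (src e)) (\<iota> (src e)) (c' (src e))"
      using c'(1) src_V[OF e] by blast
    show "\<iota> (src e) \<in> carrier (P (src e)) \<rightarrow> carrier G"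
      using src_V[OF e] by (rule \<iota>_Pi)
  qed
  have \<epsilon>: "int p dvd difference b e xs g - D (\<epsilon> e) xs g"
    if e: "e \<in> E" and xs: "set xs \<subseteq> carrier G" and g: "g \<in> carrier G" for e xs g
  proof -
    have st: "src e \<in> V" "tgt e \<in> V" "\<tau> e \<in> carrier G" using e src_V tgt_V \<tau>_closed by auto
    let ?d = "\<lambda>xs g. alt (\<lambda>zs. difference c e zs g) xs"
    have "int p dvd D (difference c e) ys g" if "set ys \<subseteq> carrier G" for ys
    proof -
      have "int p dvd (x ys - D (c (src e)) ys g) - (x ys - D (c (tgt e)) ys (\<tau> e \<otimes> g))"
        using that g st by (intro dvd_diff c(2)) auto
      then show ?thesis using D_difference[OF e that g, of c] by simp
    qed
    then have "int p dvd D ?d ys g" if "set ys \<subseteq> carrier G" for ys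
      using that reg.dd_alt[of "difference c e" ys g] by (simp add: alt_def)
    then have 1: "int p dvd ?cup (D ?d) (c' (src e)) xs g"
      unfolding cupf_def by (intro cupa_dvd_left[OF xs])
    have "int p dvd cupa (monoid.mult G) (\<lambda>zs. difference c e zs g) (\<lambda>xs s. x' xs - D (c' (src e)) xs s) g xs"
      using st by (intro reg.cupa_dvd_right[OF xs g] c'(2))
    then have 2: "int p dvd ?cup (difference c e) ?x' xs g - ?cup (difference c e) (D (c' (src e))) xs g"
      by (simp add: cupf_def cupa_diff_right)
    have "difference b e xs g = ?cup (difference c e) ?x' xs g"
      unfolding b_def cup_const by (simp add: cp_def cupa_diff)
    moreover have "D (\<epsilon> e) xs g = ?cup (D ?d) (c' (src e)) xs g + ?cup (difference c e) (D (c' (src e))) xs g"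
      unfolding \<epsilon>_def using reg.leibniz[OF xs g, of ?d "c' (src e)"] by simp
    ultimately show ?thesis using dvd_diff[OF 2 1] by (simp add: algebra_simps)
  qed
  obtain m w where m: "\<And>v xs g. \<lbrakk>v \<in> V; set xs \<subseteq> carrier G; g \<in> carrier G\<rbrakk> \<Longrightarrow> int p dvd m xs - (b v xs g - D (w v) xs g)"
    using glue[OF b \<epsilon>_inv \<epsilon>] by blast
  obtain v\<^sub>0 where v\<^sub>0: "v\<^sub>0 \<in> V" using V_nonempty by blast
  have "int p dvd cp x x' xs - cob G m xs" if xs: "set xs \<subseteq> carrier G" for xs
  proof -
    have 1: "int p dvd cob G m xs - D (b v\<^sub>0) xs \<one>"
      using v\<^sub>0 m xs by (intro cob_glued) auto
    \<comment> \<open>Since \<open>D (c v\<^sub>0)\<close> is congruent to \<open>x\<close> and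
      \<open>x'\<close> is a cocycle, the coboundary of \<open>b v\<^sub>0\<close> is the product to
      be bounded.\<close>
    have D: "D (b v\<^sub>0) xs \<one> = ?cup (D (c v\<^sub>0)) ?x' xs \<one> +
        ?cup (\<lambda>xs g. alt (\<lambda>zs. c v\<^sub>0 zs g) xs) (D ?x') xs \<one>"
      unfolding b_def by (intro reg.leibniz xs one_closed)
    have 2: "int p dvd ?cup (\<lambda>xs g. alt (\<lambda>zs. c v\<^sub>0 zs g) xs) (D ?x') xs \<one>"
      unfolding cupf_def using assms(2)
      by (intro reg.cupa_dvd_right[OF xs one_closed]) (auto simp: D_const ceq_def)
    have 3: "int p dvd cp x x' xs - ?cup (D (c v\<^sub>0)) ?x' xs \<one>"
      unfolding cup_const using c(2)[OF v\<^sub>0] by (intro cp_cong[OF xs]) auto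
    show ?thesis using dvd_diff[OF dvd_diff[OF 3 2] 1] D by (simp add: algebra_simps)
  qed
  then show ?thesis by (auto simp: ceq_def)
qed

end

section \<open>The fundamental group of a based graph of groups\<close>

datatype ('v, 'q, 'e) letter = Vtx 'v 'q | Edge 'e | EdgeInv 'e

text \<open>The group of an edge is the whole group at its source.\<close>

locale group_graph =
  fixes V :: "'v set" and P :: "'v \<Rightarrow> 'q monoid"
    and E :: "'e set" and src tgt :: "'e \<Rightarrow> 'v" and \<phi> :: "'e \<Rightarrow> 'q \<Rightarrow> 'q"
  assumes finite_V: "finite V" and finite_E: "finite E"
    and P_group: "v \<in> V \<Longrightarrow> group (P v)" and P_finite: "v \<in> V \<Longrightarrow> finite (carrier (P v))"
    and src_V [simp]: "e \<in> E \<Longrightarrow> src e \<in> V" and tgt_V [simp]: "e \<in> E \<Longrightarrow> tgt e \<in> V"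
    and \<phi>_hom: "e \<in> E \<Longrightarrow> \<phi> e \<in> hom (P (src e)) (P (tgt e))"
begin

lemma P_closed [simp]:
  "\<lbrakk>v \<in> V; q \<in> carrier (P v); r \<in> carrier (P v)\<rbrakk> \<Longrightarrow> q \<otimes>\<^bsub>P v\<^esub> r \<in> carrier (P v)"
  "v \<in> V \<Longrightarrow> \<one>\<^bsub>P v\<^esub> \<in> carrier (P v)"
  "\<lbrakk>v \<in> V; q \<in> carrier (P v)\<rbrakk> \<Longrightarrow> inv\<^bsub>P v\<^esub> q \<in> carrier (P v)"
  using P_group by (auto simp: group.is_monoid monoid.m_closed monoid.one_closed group.inv_closed)

lemma \<phi>_closed [simp]: "\<lbrakk>e \<in> E; a \<in> carrier (P (src e))\<rbrakk> \<Longrightarrow> \<phi> e a \<in> carrier (P (tgt e))"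
  using \<phi>_hom by (auto simp: hom_def)

definition letters :: "('v, 'q, 'e) letter set" where
  "letters = (\<Union>v\<in>V. Vtx v ` carrier (P v)) \<union> Edge ` E \<union> EdgeInv ` E"

abbreviation "words \<equiv> lists letters"

lemma letters_iff [simp]:
  "Vtx v q \<in> letters \<longleftrightarrow> v \<in> V \<and> q \<in> carrier (P v)"
  "Edge e \<in> letters \<longleftrightarrow> e \<in> E" "EdgeInv e \<in> letters \<longleftrightarrow> e \<in> E"
  by (auto simp: letters_def)

inductive_set relators :: "(('v, 'q, 'e) letter list \<times> ('v, 'q, 'e) letter list) set" where
  "\<lbrakk>v \<in> V; q \<in> carrier (P v); r \<in> carrier (P v)\<rbrakk> \<Longrightarrow> ([Vtx v q, Vtx v r], [Vtx v (q \<otimes>\<^bsub>P v\<^esub> r)]) \<in> relators"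
| "v \<in> V \<Longrightarrow> ([Vtx v \<one>\<^bsub>P v\<^esub>], []) \<in> relators"
| "e \<in> E \<Longrightarrow> ([Edge e, EdgeInv e], []) \<in> relators"
| "e \<in> E \<Longrightarrow> ([EdgeInv e, Edge e], []) \<in> relators"
| "\<lbrakk>e \<in> E; a \<in> carrier (P (src e))\<rbrakk> \<Longrightarrow> ([Edge e, Vtx (src e) a], [Vtx (tgt e) (\<phi> e a), Edge e]) \<in> relators"

inductive weq :: "('v, 'q, 'e) letter list \<Rightarrow> ('v, 'q, 'e) letter list \<Rightarrow> bool" where
  step: "\<lbrakk>(l, r) \<in> relators; x \<in> words; y \<in> words\<rbrakk> \<Longrightarrow> weq (x @ l @ y) (x @ r @ y)"
| refl: "weq x x"
| sym: "weq x y \<Longrightarrow> weq y x"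
| trans: "weq x y \<Longrightarrow> weq y z \<Longrightarrow> weq x z"

lemma weq_context: "\<lbrakk>weq u w; x \<in> words; y \<in> words\<rbrakk> \<Longrightarrow> weq (x @ u @ y) (x @ w @ y)"
proof (induction rule: weq.induct)
  case (step l r x' y')
  then have "weq ((x @ x') @ l @ (y' @ y)) ((x @ x') @ r @ (y' @ y))"
    by (intro weq.step) auto
  then show ?case by simp
qed (auto intro: weq.intros)

lemma weq_append: "\<lbrakk>weq u u'; weq w w'; u' \<in> words; w \<in> words\<rbrakk> \<Longrightarrow> weq (u @ w) (u' @ w')"
  using weq_context[of u u' "[]" w] weq_context[of w w' u' "[]"] by (auto intro: weq.trans)

text \<open>The theorem places the group on the natural numbers. The chosen word depends only on the
  class of \<open>w\<close>, so its number encodes classes injectively.\<close>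

definition enc :: "('v, 'q, 'e) letter list \<Rightarrow> nat" where
  "enc w = to_nat_on words (SOME w'. w' \<in> words \<and> weq w w')"

lemma countable_words: "countable words"
proof -
  have "finite letters" by (simp add: letters_def finite_V finite_E P_finite)
  then show ?thesis by (intro countable_lists countable_finite)
qed

lemma enc_rep: "w \<in> words \<Longrightarrow> (SOME w'. w' \<in> words \<and> weq w w') \<in> words \<and> weq w (SOME w'. w' \<in> words \<and> weq w w')"
  by (rule someI[of _ w]) (auto intro: weq.refl)

lemma enc_eq_iff:
  assumes "u \<in> words" "w \<in> words"
  shows "enc u = enc w \<longleftrightarrow> weq u w"
proof
  assume "enc u = enc w"
  then have "(SOME w'. w' \<in> words \<and> weq u w') = (SOME w'. w' \<in> words \<and> weq w w')"
    unfolding enc_def using enc_rep[OF assms(1)] enc_rep[OF assms(2)] countable_words by simp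
  then show "weq u w" using enc_rep[OF assms(1)] enc_rep[OF assms(2)] by (metis weq.sym weq.trans)
next
  assume "weq u w"
  then have "weq u w' \<longleftrightarrow> weq w w'" for w' by (metis weq.sym weq.trans)
  then show "enc u = enc w" by (simp add: enc_def)
qed

definition dec :: "nat \<Rightarrow> ('v, 'q, 'e) letter list" where
  "dec n = (SOME w. w \<in> words \<and> enc w = n)"

lemma dec: "n \<in> enc ` words \<Longrightarrow> dec n \<in> words \<and> enc (dec n) = n"
  unfolding dec_def by (rule someI_ex) auto

definition \<Gamma> :: "nat monoid" where
  "\<Gamma> = \<lparr>carrier = enc ` words, monoid.mult = (\<lambda>a b. enc (dec a @ dec b)), one = enc []\<rparr>"

abbreviation gmult (infixl "\<cdot>" 70) where "g \<cdot> h \<equiv> g \<otimes>\<^bsub>\<Gamma>\<^esub> h"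

lemma enc_closed [simp]: "w \<in> words \<Longrightarrow> enc w \<in> carrier \<Gamma>"
  by (simp add: \<Gamma>_def)

lemma enc_mult:
  assumes "u \<in> words" "w \<in> words"
  shows "enc u \<cdot> enc w = enc (u @ w)"
proof -
  have u: "dec (enc u) \<in> words" "enc (dec (enc u)) = enc u" using assms by (auto simp: dec)
  have w: "dec (enc w) \<in> words" "enc (dec (enc w)) = enc w" using assms by (auto simp: dec)
  have "weq (dec (enc u)) u" using u assms by (simp flip: enc_eq_iff)
  moreover have "weq (dec (enc w)) w" using w assms by (simp flip: enc_eq_iff)
  ultimately have "weq (dec (enc u) @ dec (enc w)) (u @ w)" using u w assms by (intro weq_append)
  then show ?thesis using u w assms by (simp add: \<Gamma>_def enc_eq_iff)
qed

lemma one_enc: "\<one>\<^bsub>\<Gamma>\<^esub> = enc []"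
  by (simp add: \<Gamma>_def)

lemma enc_relator:
  assumes "(l, r) \<in> relators" "l \<in> words" "r \<in> words"
  shows "enc l = enc r"
  using assms weq.step[OF assms(1), of "[]" "[]"] by (simp add: enc_eq_iff)

lemma carrier_\<Gamma>: "g \<in> carrier \<Gamma> \<longleftrightarrow> (\<exists>w\<in>words. g = enc w)"
  by (auto simp: \<Gamma>_def)

fun letter_inv :: "('v, 'q, 'e) letter \<Rightarrow> ('v, 'q, 'e) letter" where
  "letter_inv (Vtx v q) = Vtx v (inv\<^bsub>P v\<^esub> q)"
| "letter_inv (Edge e) = EdgeInv e"
| "letter_inv (EdgeInv e) = Edge e"

lemma letter_inv:
  assumes "x \<in> letters"
  shows "letter_inv x \<in> letters" "enc [letter_inv x, x] = enc []"
proof -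
  show *: "letter_inv x \<in> letters"
    using assms P_group by (cases x) (auto intro: group.inv_closed)
  show "enc [letter_inv x, x] = enc []"
  proof (cases x)
    case (Vtx v q)
    then have v: "v \<in> V" "q \<in> carrier (P v)" using assms by auto
    interpret group "P v" using v P_group by blast
    have "enc [Vtx v (inv\<^bsub>P v\<^esub> q), Vtx v q] = enc [Vtx v (inv\<^bsub>P v\<^esub> q \<otimes>\<^bsub>P v\<^esub> q)]"
      using v by (intro enc_relator relators.intros) auto
    then have "enc [letter_inv x, x] = enc [Vtx v \<one>\<^bsub>P v\<^esub>]"
      using v Vtx by simp
    also have "\<dots> = enc []" using v by (auto intro!: enc_relator relators.intros)
    finally show ?thesis .
  qed (use assms in \<open>auto intro!: enc_relator relators.intros\<close>)
qed

sublocale \<Gamma>: group \<Gamma>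
proof (rule groupI)
  fix g assume "g \<in> carrier \<Gamma>"
  then obtain w where w: "w \<in> words" "g = enc w" by (auto simp: carrier_\<Gamma>)
  from w(1) have "\<exists>u\<in>words. enc (u @ w) = enc []"
  proof (induction w)
    case (Cons x w)
    then obtain u where u: "u \<in> words" "enc (u @ w) = enc []" by blast
    have "enc ((u @ [letter_inv x]) @ (x # w)) = enc u \<cdot> enc ([letter_inv x, x] @ w)"
      using Cons u letter_inv[of x] by (subst enc_mult) auto
    also have "enc ([letter_inv x, x] @ w) = enc [letter_inv x, x] \<cdot> enc w"
      using Cons letter_inv[of x] by (subst enc_mult) auto
    also have "\<dots> = enc w" using Cons letter_inv[of x] by (simp add: enc_mult)
    also have "enc u \<cdot> enc w = enc []" using u Cons by (simp add: enc_mult)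
    finally show ?case using Cons u letter_inv[of x] by (intro bexI[of _ "u @ [letter_inv x]"]) auto
  qed (auto intro: bexI[of _ "[]"])
  then show "\<exists>h\<in>carrier \<Gamma>. h \<cdot> g = \<one>\<^bsub>\<Gamma>\<^esub>"
    using w by (metis enc_closed enc_mult one_enc)
next
  fix g h assume "g \<in> carrier \<Gamma>" "h \<in> carrier \<Gamma>"
  then obtain u w where "u \<in> words" "w \<in> words" "g = enc u" "h = enc w" by (auto simp: carrier_\<Gamma>)
  then show "g \<cdot> h \<in> carrier \<Gamma>" by (simp add: enc_mult)
next
  fix g h k assume "g \<in> carrier \<Gamma>" "h \<in> carrier \<Gamma>" "k \<in> carrier \<Gamma>"
  then obtain u w x where "u \<in> words" "w \<in> words" "x \<in> words" "g = enc u" "h = enc w" "k = enc x"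
    by (auto simp: carrier_\<Gamma>)
  then show "g \<cdot> h \<cdot> k = g \<cdot> (h \<cdot> k)" by (simp add: enc_mult)
next
  fix g assume "g \<in> carrier \<Gamma>"
  then obtain u where "u \<in> words" "g = enc u" by (auto simp: carrier_\<Gamma>)
  then show "\<one>\<^bsub>\<Gamma>\<^esub> \<cdot> g = g" by (simp add: one_enc enc_mult)
qed (simp add: one_enc)

definition \<iota> :: "'v \<Rightarrow> 'q \<Rightarrow> nat" where "\<iota> v q = enc [Vtx v q]"
definition \<tau> :: "'e \<Rightarrow> nat" where "\<tau> e = enc [Edge e]"

lemma \<iota>_closed [simp]: "\<lbrakk>v \<in> V; q \<in> carrier (P v)\<rbrakk> \<Longrightarrow> \<iota> v q \<in> carrier \<Gamma>"
  by (simp add: \<iota>_def)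

lemma \<tau>_closed [simp]: "e \<in> E \<Longrightarrow> \<tau> e \<in> carrier \<Gamma>"
  by (simp add: \<tau>_def)

lemma \<iota>_hom: "v \<in> V \<Longrightarrow> \<iota> v \<in> hom (P v) \<Gamma>"
proof (rule homI)
  fix q r assume *: "v \<in> V" "q \<in> carrier (P v)" "r \<in> carrier (P v)"
  then have "q \<otimes>\<^bsub>P v\<^esub> r \<in> carrier (P v)" using P_group[of v] by (simp add: group.is_monoid monoid.m_closed)
  then have "enc [Vtx v q, Vtx v r] = enc [Vtx v (q \<otimes>\<^bsub>P v\<^esub> r)]"
    using * by (intro enc_relator relators.intros) auto
  then show "\<iota> v (q \<otimes>\<^bsub>P v\<^esub> r) = \<iota> v q \<cdot> \<iota> v r" using * by (simp add: \<iota>_def enc_mult)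
qed simp

lemma \<iota>_mult: "\<lbrakk>v \<in> V; q \<in> carrier (P v); r \<in> carrier (P v)\<rbrakk> \<Longrightarrow> \<iota> v (q \<otimes>\<^bsub>P v\<^esub> r) = \<iota> v q \<cdot> \<iota> v r"
  using \<iota>_hom by (auto simp: hom_def)

lemma \<iota>_group_hom: "v \<in> V \<Longrightarrow> group_hom (P v) \<Gamma> (\<iota> v)"
  by (simp add: group_hom_def group_hom_axioms_def P_group \<iota>_hom \<Gamma>.group_axioms)

lemma \<iota>_one [simp]: "v \<in> V \<Longrightarrow> \<iota> v \<one>\<^bsub>P v\<^esub> = \<one>\<^bsub>\<Gamma>\<^esub>"
  using \<iota>_group_hom group_hom.hom_one by blast

lemma \<tau>_conj: "\<lbrakk>e \<in> E; a \<in> carrier (P (src e))\<rbrakk> \<Longrightarrow> \<tau> e \<cdot> \<iota> (src e) a = \<iota> (tgt e) (\<phi> e a) \<cdot> \<tau> e"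
  by (auto simp: \<iota>_def \<tau>_def enc_mult intro!: enc_relator relators.intros)

lemma enc_EdgeInv: "e \<in> E \<Longrightarrow> enc [EdgeInv e] = inv\<^bsub>\<Gamma>\<^esub> (\<tau> e)"
  by (rule \<Gamma>.inv_equality[symmetric]) (auto simp: \<tau>_def enc_mult one_enc intro!: enc_relator relators.intros)

lemma enc_Cons: "\<lbrakk>x \<in> letters; w \<in> words\<rbrakk> \<Longrightarrow> enc (x # w) = enc [x] \<cdot> enc w"
  by (simp add: enc_mult)

lemma \<Gamma>_induct [consumes 1, case_names one vtx edge edge_inv]:
  assumes "g \<in> carrier \<Gamma>" "R \<one>\<^bsub>\<Gamma>\<^esub>"
    and "\<And>v q g. \<lbrakk>v \<in> V; q \<in> carrier (P v); g \<in> carrier \<Gamma>; R g\<rbrakk> \<Longrightarrow> R (\<iota> v q \<cdot> g)"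
    and "\<And>e g. \<lbrakk>e \<in> E; g \<in> carrier \<Gamma>; R g\<rbrakk> \<Longrightarrow> R (\<tau> e \<cdot> g)"
    and "\<And>e g. \<lbrakk>e \<in> E; g \<in> carrier \<Gamma>; R g\<rbrakk> \<Longrightarrow> R (inv\<^bsub>\<Gamma>\<^esub> (\<tau> e) \<cdot> g)"
  shows "R g"
proof -
  obtain w where "w \<in> words" "g = enc w" using assms(1) by (auto simp: carrier_\<Gamma>)
  moreover from this(1) have "R (enc w)"
  proof (induction w)
    case (Cons x w)
    then have "enc (x # w) = enc [x] \<cdot> enc w" "R (enc w)" "enc w \<in> carrier \<Gamma>" "x \<in> letters"
      by (simp_all add: enc_Cons[of x w])
    then show ?case using assms(3-5)
      by (cases x) (auto simp: enc_EdgeInv simp flip: \<iota>_def \<tau>_def)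
  qed (use assms(2) one_enc in simp)
  ultimately show ?thesis by simp
qed

section \<open>Universal property of the presentation\<close>

definition extends_action :: "'y set \<Rightarrow> (('v, 'q, 'e) letter \<Rightarrow> 'y \<Rightarrow> 'y) \<Rightarrow> (nat \<Rightarrow> 'y \<Rightarrow> 'y) \<Rightarrow> bool" where
  "extends_action Y act ext \<longleftrightarrow> (\<forall>y\<in>Y. ext \<one>\<^bsub>\<Gamma>\<^esub> y = y) \<and> (\<forall>g\<in>carrier \<Gamma>. \<forall>y\<in>Y. ext g y \<in> Y) \<and>
    (\<forall>g\<in>carrier \<Gamma>. \<forall>h\<in>carrier \<Gamma>. \<forall>y\<in>Y. ext (g \<cdot> h) y = ext g (ext h y)) \<and>
    (\<forall>x\<in>letters. \<forall>y\<in>Y. ext (enc [x]) y = act x y)"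

lemma extends_actionD:
  assumes "extends_action Y act ext" "y \<in> Y"
  shows "ext \<one>\<^bsub>\<Gamma>\<^esub> y = y" "g \<in> carrier \<Gamma> \<Longrightarrow> ext g y \<in> Y"
    "\<lbrakk>g \<in> carrier \<Gamma>; h \<in> carrier \<Gamma>\<rbrakk> \<Longrightarrow> ext (g \<cdot> h) y = ext g (ext h y)"
    "x \<in> letters \<Longrightarrow> ext (enc [x]) y = act x y"
  using assms unfolding extends_action_def by blast+

text \<open>This is the universal property of the presentation. It is phrased for actions on sets because these
  cover homomorphisms, derivations and the action on reduced words alike.\<close>

lemma action_extends:
  fixes act :: "('v, 'q, 'e) letter \<Rightarrow> 'y \<Rightarrow> 'y"
  assumes closed: "\<And>x y. \<lbrakk>x \<in> letters; y \<in> Y\<rbrakk> \<Longrightarrow> act x y \<in> Y"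
    and "\<And>v q r y. \<lbrakk>v \<in> V; q \<in> carrier (P v); r \<in> carrier (P v); y \<in> Y\<rbrakk> \<Longrightarrow>
      act (Vtx v q) (act (Vtx v r) y) = act (Vtx v (q \<otimes>\<^bsub>P v\<^esub> r)) y"
    and "\<And>v y. \<lbrakk>v \<in> V; y \<in> Y\<rbrakk> \<Longrightarrow> act (Vtx v \<one>\<^bsub>P v\<^esub>) y = y"
    and "\<And>e y. \<lbrakk>e \<in> E; y \<in> Y\<rbrakk> \<Longrightarrow> act (Edge e) (act (EdgeInv e) y) = y"
    and "\<And>e y. \<lbrakk>e \<in> E; y \<in> Y\<rbrakk> \<Longrightarrow> act (EdgeInv e) (act (Edge e) y) = y"
    and "\<And>e a y. \<lbrakk>e \<in> E; a \<in> carrier (P (src e)); y \<in> Y\<rbrakk> \<Longrightarrow>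
      act (Edge e) (act (Vtx (src e) a) y) = act (Vtx (tgt e) (\<phi> e a)) (act (Edge e) y)"
  shows "\<exists>ext. extends_action Y act ext"
proof -
  have fold_closed: "foldr act w y \<in> Y" if "w \<in> words" "y \<in> Y" for w y
    using that closed by (induction w) auto
  have rel: "foldr act l y = foldr act r y" if "(l, r) \<in> relators" "y \<in> Y" for l r y
    using that assms by (cases rule: relators.cases) auto
  have resp: "foldr act u y = foldr act w y" if "weq u w" "y \<in> Y" for u w y
    using that by (induction arbitrary: y rule: weq.induct) (simp_all add: rel fold_closed)
  define ext where "ext g = foldr act (dec g)" for g
  have ext: "ext (enc w) y = foldr act w y" if "w \<in> words" "y \<in> Y" for w y
    unfolding ext_def using that dec[of "enc w"] by (intro resp) (auto simp flip: enc_eq_iff)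
  have "ext (g \<cdot> h) y = ext g (ext h y)"
    if gh: "g \<in> carrier \<Gamma>" "h \<in> carrier \<Gamma>" and y: "y \<in> Y" for g h y
  proof -
    obtain u w where "u \<in> words" "g = enc u" "w \<in> words" "h = enc w" using gh by (auto simp: carrier_\<Gamma>)
    then show ?thesis using y by (simp add: enc_mult ext fold_closed)
  qed
  moreover have "ext g y \<in> Y" if "g \<in> carrier \<Gamma>" "y \<in> Y" for g y
    unfolding ext_def using that dec by (intro fold_closed) (auto simp: \<Gamma>_def)
  moreover have "ext (enc [x]) y = act x y" if "x \<in> letters" "y \<in> Y" for x y
    using ext[of "[x]" y] that by simp
  moreover have "ext \<one>\<^bsub>\<Gamma>\<^esub> y = y" if "y \<in> Y" for y
    using ext[of "[]" y] that by (simp add: one_enc)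
  ultimately show ?thesis unfolding extends_action_def by blast
qed

text \<open>The prescribed values let the generators act on K by left multiplication; the orbit map
  of the identity is the homomorphism.\<close>

lemma hom_extends:
  assumes "group K"
    and "\<And>v. v \<in> V \<Longrightarrow> j v \<in> hom (P v) K" and "\<And>e. e \<in> E \<Longrightarrow> k e \<in> carrier K"
    and "\<And>e a. \<lbrakk>e \<in> E; a \<in> carrier (P (src e))\<rbrakk> \<Longrightarrow> k e \<otimes>\<^bsub>K\<^esub> j (src e) a = j (tgt e) (\<phi> e a) \<otimes>\<^bsub>K\<^esub> k e"
  shows "\<exists>\<pi>\<in>hom \<Gamma> K. (\<forall>v\<in>V. \<forall>q\<in>carrier (P v). \<pi> (\<iota> v q) = j v q) \<and> (\<forall>e\<in>E. \<pi> (\<tau> e) = k e)"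
proof -
  interpret K: group K by fact
  define val where "val x = (case x of Vtx v q \<Rightarrow> j v q | Edge e \<Rightarrow> k e | EdgeInv e \<Rightarrow> inv\<^bsub>K\<^esub> (k e))" for x
  have [simp]: "val x \<in> carrier K" if "x \<in> letters" for x
    using that assms(2,3) by (cases x) (auto simp: val_def hom_def)
  have j: "j v q \<in> carrier K" if "v \<in> V" "q \<in> carrier (P v)" for v q
    using that assms(2) by (auto simp: hom_def)
  have j_mult: "j v (q \<otimes>\<^bsub>P v\<^esub> r) = j v q \<otimes>\<^bsub>K\<^esub> j v r" if "v \<in> V" "q \<in> carrier (P v)" "r \<in> carrier (P v)" for v q r
    using that assms(2) by (auto simp: hom_def)
  have j_one: "j v \<one>\<^bsub>P v\<^esub> = \<one>\<^bsub>K\<^esub>" if "v \<in> V" for v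
    using that P_group assms(1,2) by (metis group_hom.hom_one group_hom_axioms.intro group_hom.intro)
  have "\<exists>ext. extends_action (carrier K) (\<lambda>x y. val x \<otimes>\<^bsub>K\<^esub> y) ext"
  proof (rule action_extends)
    fix e a y assume *: "e \<in> E" "a \<in> carrier (P (src e))" "y \<in> carrier K"
    then show "val (Edge e) \<otimes>\<^bsub>K\<^esub> (val (Vtx (src e) a) \<otimes>\<^bsub>K\<^esub> y) =
        val (Vtx (tgt e) (\<phi> e a)) \<otimes>\<^bsub>K\<^esub> (val (Edge e) \<otimes>\<^bsub>K\<^esub> y)"
      using assms(3) assms(4)[OF *(1,2)] by (simp add: val_def j flip: K.m_assoc)
  next
    fix x y assume "x \<in> letters" "y \<in> carrier K"
    then show "val x \<otimes>\<^bsub>K\<^esub> y \<in> carrier K" by simp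
  qed (use assms(3) in \<open>auto simp: val_def j j_one j_mult K.m_assoc simp flip: K.m_assoc[of "k _" "inv\<^bsub>K\<^esub> k _"] K.m_assoc[of "inv\<^bsub>K\<^esub> k _" "k _"]\<close>)
  then obtain ext where "extends_action (carrier K) (\<lambda>x y. val x \<otimes>\<^bsub>K\<^esub> y) ext" by blast
  note ext = extends_actionD[OF this]
  \<comment> \<open>The extended action commutes with right multiplication by K, which makes the
    orbit map multiplicative.\<close>
  have right: "ext (enc w) y = ext (enc w) \<one>\<^bsub>K\<^esub> \<otimes>\<^bsub>K\<^esub> y" if "w \<in> words" "y \<in> carrier K" for w y
    using that
  proof (induction w)
    case Nil
    then show ?case using ext(1) one_enc by simp
  next
    case (Cons x w)
    have *: "ext (enc (x # w)) z = val x \<otimes>\<^bsub>K\<^esub> ext (enc w) z" if "z \<in> carrier K" for z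
      using that Cons.hyps ext by (simp add: enc_Cons[of x w])
    have "ext (enc (x # w)) y = val x \<otimes>\<^bsub>K\<^esub> (ext (enc w) \<one>\<^bsub>K\<^esub> \<otimes>\<^bsub>K\<^esub> y)"
      using *[of y] Cons by simp
    also have "\<dots> = ext (enc (x # w)) \<one>\<^bsub>K\<^esub> \<otimes>\<^bsub>K\<^esub> y"
      using *[of "\<one>\<^bsub>K\<^esub>"] Cons ext(2)[of "\<one>\<^bsub>K\<^esub>" "enc w"] by (simp add: K.m_assoc)
    finally show ?case .
  qed
  let ?\<pi> = "\<lambda>g. ext g \<one>\<^bsub>K\<^esub>"
  have "?\<pi> \<in> hom \<Gamma> K"
  proof (rule homI)
    fix g h assume gh: "g \<in> carrier \<Gamma>" "h \<in> carrier \<Gamma>"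
    then obtain w where "w \<in> words" "g = enc w" by (auto simp: carrier_\<Gamma>)
    then have "ext g (?\<pi> h) = ?\<pi> g \<otimes>\<^bsub>K\<^esub> ?\<pi> h"
      using right[of w "?\<pi> h"] ext(2)[OF K.one_closed gh(2)] by metis
    then show "?\<pi> (g \<cdot> h) = ?\<pi> g \<otimes>\<^bsub>K\<^esub> ?\<pi> h" using gh ext(3) by simp
  qed (use ext(2) in simp)
  then show ?thesis using ext(4) j assms(3) 
    by (intro bexI[of _ ?\<pi>]) (auto simp: \<iota>_def \<tau>_def val_def)
qed

end

text \<open>The base vertex, whose group is trivial, is joined to every other vertex by an edge on which
  the stable letter is trivial; together with the edges of \<open>E\<close> this is the quotient of a tree.\<close>

locale based_group_graph = group_graph V P E src tgt \<phi>
  for V :: "'v set" and P :: "'v \<Rightarrow> 'q monoid" and E :: "'e set" and src tgt \<phi> +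
  fixes v\<^sub>0 :: 'v
  assumes v\<^sub>0 [simp]: "v\<^sub>0 \<in> V" and P_base: "carrier (P v\<^sub>0) = {\<one>\<^bsub>P v\<^sub>0\<^esub>}"
    and \<iota>_inj: "v \<in> V \<Longrightarrow> inj_on (\<iota> v) (carrier (P v))"
begin

definition xedges :: "('v + 'e) set" where "xedges = Inl ` (V - {v\<^sub>0}) \<union> Inr ` E"
definition xsrc :: "'v + 'e \<Rightarrow> 'v" where "xsrc = case_sum (\<lambda>_. v\<^sub>0) src"
definition xtgt :: "'v + 'e \<Rightarrow> 'v" where "xtgt = case_sum (\<lambda>v. v) tgt"
definition x\<phi> :: "'v + 'e \<Rightarrow> 'q \<Rightarrow> 'q" where "x\<phi> = case_sum (\<lambda>v _. \<one>\<^bsub>P v\<^esub>) \<phi>"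
definition x\<tau> :: "'v + 'e \<Rightarrow> nat" where "x\<tau> = case_sum (\<lambda>_. \<one>\<^bsub>\<Gamma>\<^esub>) \<tau>"

lemmas xdefs = xsrc_def xtgt_def x\<phi>_def x\<tau>_def

text \<open>Connectedness of the tree: the auxiliary edges identify every \<open>w v\<close> with
  \<open>w v\<^sub>0\<close>, and this one function is then invariant under all generators.\<close>

lemma invariant_const:
  assumes vtx: "\<And>v q g. \<lbrakk>v \<in> V; q \<in> carrier (P v); g \<in> carrier \<Gamma>\<rbrakk> \<Longrightarrow> w v (\<iota> v q \<cdot> g) = w v g"
    and edge: "\<And>e g. \<lbrakk>e \<in> xedges; g \<in> carrier \<Gamma>\<rbrakk> \<Longrightarrow> w (xtgt e) (x\<tau> e \<cdot> g) = w (xsrc e) g"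
  shows "\<exists>c :: int. \<forall>v\<in>V. \<forall>g\<in>carrier \<Gamma>. w v g = c"
proof -
  have base: "w v g = w v\<^sub>0 g" if "v \<in> V" "g \<in> carrier \<Gamma>" for v g
    using that edge[of "Inl v" g] by (cases "v = v\<^sub>0") (auto simp: xdefs xedges_def)
  have Edge: "w v\<^sub>0 (\<tau> e \<cdot> g) = w v\<^sub>0 g" if "e \<in> E" "g \<in> carrier \<Gamma>" for e g
    using that edge[of "Inr e" g] base[of "src e"] base[of "tgt e"] by (auto simp: xdefs xedges_def)
  have "w v\<^sub>0 g = w v\<^sub>0 \<one>\<^bsub>\<Gamma>\<^esub>" if "g \<in> carrier \<Gamma>" for g
    using that
  proof (induction rule: \<Gamma>_induct)
    case (vtx v q g)
    then show ?case using vtx.prems assms(1)[of v q g] base[of v g] base[of v "\<iota> v q \<cdot> g"] by simp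
  next
    case (edge_inv e g)
    then show ?case using Edge[of e "inv\<^bsub>\<Gamma>\<^esub> (\<tau> e) \<cdot> g"] by (simp flip: \<Gamma>.m_assoc)
  qed (auto simp: Edge)
  then show ?thesis using base by metis
qed

text \<open>Normalising the solution by its values at the base vertex, it remains to find a function on
  \<open>\<Gamma>\<close> whose increments under left multiplication by the generators are prescribed.\<close>

lemma solvable:
  assumes u: "\<And>e a g. \<lbrakk>e \<in> xedges; a \<in> carrier (P (xsrc e)); g \<in> carrier \<Gamma>\<rbrakk> \<Longrightarrow> u e (\<iota> (xsrc e) a \<cdot> g) = u e g"
  shows "\<exists>w. (\<forall>v\<in>V. \<forall>q\<in>carrier (P v). \<forall>g\<in>carrier \<Gamma>. w v (\<iota> v q \<cdot> g) = w v g) \<and>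
        (\<forall>e\<in>xedges. \<forall>g\<in>carrier \<Gamma>. w (xtgt e) (x\<tau> e \<cdot> g) - w (xsrc e) g = (u e g :: int))"
proof -
  \<comment> \<open>The auxiliary edges force \<open>w v\<close> to exceed
    \<open>w v\<^sub>0\<close> by \<open>t v\<close>. The only unknown is
    \<open>w v\<^sub>0\<close>; the edge equations prescribe its increment \<open>inc\<close> under
    a stable letter, and invariance under the vertex groups prescribes the remaining values of
    \<open>\<beta>\<close>.\<close>
  define t where "t v g = (if v = v\<^sub>0 then 0 else u (Inl v) g)" for v g
  define inc where "inc e g = u (Inr e) g - t (tgt e) (\<tau> e \<cdot> g) + t (src e) g" for e g
  define \<beta> where "\<beta> x g = (case x of Vtx v q \<Rightarrow> t v g - t v (\<iota> v q \<cdot> g)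
      | Edge e \<Rightarrow> inc e g | EdgeInv e \<Rightarrow> - inc e (inv\<^bsub>\<Gamma>\<^esub> (\<tau> e) \<cdot> g))" for x g
  have ue: "u (Inr e) (\<iota> (src e) a \<cdot> g) = u (Inr e) g" if "e \<in> E" "a \<in> carrier (P (src e))" "g \<in> carrier \<Gamma>" for e a g
    using that u[of "Inr e" a g] by (simp add: xedges_def xdefs)
  let ?Y = "carrier \<Gamma> \<times> (UNIV :: int set)"
  \<comment> \<open>Increments that respect the relations amount to an action of Gamma on Gamma x Z,
    and the orbit of the identity with value 0 is the graph of the function sought. The conjugation
    relation is the one that needs the invariance of \<open>u\<close> under the edge group.\<close>
  let ?act = "\<lambda>x (g, n). (enc [x] \<cdot> g, n + \<beta> x g)"
  have "\<exists>ext. extends_action ?Y ?act ext"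
  proof (rule action_extends, goal_cases)
    case (1 x y)
    then show ?case by auto
  next
    case (2 v q r y)
    then show ?case by (auto simp: \<beta>_def \<iota>_mult \<Gamma>.m_assoc simp flip: \<iota>_def)
  next
    case (3 v y)
    then show ?case by (auto simp: \<beta>_def simp flip: \<iota>_def)
  next
    case (4 e y)
    then show ?case by (auto simp: \<beta>_def enc_EdgeInv simp flip: \<tau>_def \<Gamma>.m_assoc)
  next
    case (5 e y)
    then show ?case by (auto simp: \<beta>_def enc_EdgeInv simp flip: \<tau>_def \<Gamma>.m_assoc)
  next
    case (6 e a y)
    obtain g n where y: "y = (g, n)" "g \<in> carrier \<Gamma>" using 6 by auto
    have cl: "\<iota> (src e) a \<in> carrier \<Gamma>" "\<iota> (tgt e) (\<phi> e a) \<in> carrier \<Gamma>" "\<tau> e \<in> carrier \<Gamma>"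
      using 6 by auto
    have "\<tau> e \<cdot> (\<iota> (src e) a \<cdot> g) = \<iota> (tgt e) (\<phi> e a) \<cdot> (\<tau> e \<cdot> g)"
      using cl y \<tau>_conj[of e a] 6 by (simp flip: \<Gamma>.m_assoc)
    then show ?case using 6 y ue[of e a g] by (auto simp: \<beta>_def inc_def simp flip: \<iota>_def \<tau>_def)
  qed
  then obtain ext where "extends_action ?Y ?act ext" by blast
  note ext = extends_actionD[OF this]
  let ?o = "(\<one>\<^bsub>\<Gamma>\<^esub>, 0)"
  have fst_ext: "fst (ext (enc w) ?o) = enc w" if "w \<in> words" for w
    using that
  proof (induction w)
    case Nil
    then show ?case using ext(1)[of ?o] by (simp add: one_enc)
  next
    case (Cons x w)
    then show ?case using ext(3)[of ?o "enc [x]" "enc w"] ext(4)[of "ext (enc w) ?o" x] ext(2)[of ?o "enc w"]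
      by (auto simp: enc_Cons[of x w] split: prod.splits)
  qed
  define w where "w g = snd (ext g ?o)" for g
  have w: "w (enc [x] \<cdot> g) = w g + \<beta> x g" if x: "x \<in> letters" and g: "g \<in> carrier \<Gamma>" for x g
  proof -
    obtain u where "u \<in> words" "g = enc u" using g by (auto simp: carrier_\<Gamma>)
    then have "fst (ext g ?o) = g" using fst_ext by simp
    then have "ext g ?o = (g, w g)" by (metis prod.collapse w_def)
    then have "ext (enc [x] \<cdot> g) ?o = (enc [x] \<cdot> g, w g + \<beta> x g)"
      using x g ext(3)[of ?o "enc [x]" g] ext(4)[of "(g, w g)" x] by simp
    then show ?thesis by (simp add: w_def)
  qed
  show ?thesis
  proof (intro exI[of _ "\<lambda>v g. w g + t v g"] conjI ballI)
    fix v q g assume "v \<in> V" "q \<in> carrier (P v)" "g \<in> carrier \<Gamma>"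
    then show "w (\<iota> v q \<cdot> g) + t v (\<iota> v q \<cdot> g) = w g + t v g"
      using w[of "Vtx v q" g] by (simp add: \<beta>_def flip: \<iota>_def)
  next
    fix e g assume *: "e \<in> xedges" "g \<in> carrier \<Gamma>"
    show "w (x\<tau> e \<cdot> g) + t (xtgt e) (x\<tau> e \<cdot> g) - (w g + t (xsrc e) g) = u e g"
    proof (cases e)
      case (Inl v)
      then show ?thesis using * by (auto simp: xdefs xedges_def t_def)
    next
      case (Inr e')
      then show ?thesis using * w[of "Edge e'" g] by (auto simp: xdefs xedges_def \<beta>_def inc_def simp flip: \<tau>_def)
    qed
  qed
qed

lemma cohomology_graph:
  assumes "1 < p"
  shows "cohomology_graph \<Gamma> p V P \<iota> xedges xsrc xtgt x\<phi> x\<tau>"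
proof -
  show ?thesis
  proof (intro cohomology_graph.intro cohomology_graph_axioms.intro fp_group.intro fp_group_axioms.intro)
    fix e assume e: "e \<in> xedges"
    show "xsrc e \<in> V" "xtgt e \<in> V" "x\<tau> e \<in> carrier \<Gamma>"
      using e by (auto simp: xedges_def xdefs)
    show "x\<phi> e \<in> hom (P (xsrc e)) (P (xtgt e))"
      using e \<phi>_hom P_group by (auto simp: xedges_def xdefs hom_def group.is_monoid monoid.l_one)
  next
    fix e a assume "e \<in> xedges" "a \<in> carrier (P (xsrc e))"
    then show "x\<tau> e \<cdot> \<iota> (xsrc e) a = \<iota> (xtgt e) (x\<phi> e a) \<cdot> x\<tau> e"
      using \<tau>_conj P_base by (auto simp: xedges_def xdefs)
  next
    show "V \<noteq> {}" using v\<^sub>0 by blast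
  qed (use assms P_group \<iota>_hom \<iota>_inj invariant_const solvable in auto)
qed

end

section \<open>A free normal subgroup of finite index\<close>

lemma reduced_word_Nil [simp]: "reduced_word []"
  by (simp add: reduced_word_def)

lemma reduced_word_Cons:
  "reduced_word (x # w) \<longleftrightarrow>
    reduced_word w \<and> (w \<noteq> [] \<longrightarrow> \<not> (snd x = snd (hd w) \<and> fst x \<noteq> fst (hd w)))"
proof (cases w)
  case Nil
  then show ?thesis by (simp add: reduced_word_def)
next
  case (Cons y ys)
  have "(\<forall>i. Q i) \<longleftrightarrow> Q 0 \<and> (\<forall>i. Q (Suc i))" for Q :: "nat \<Rightarrow> bool"
    by (metis not0_implies_Suc)
  from this[of "\<lambda>i. Suc i < length (x # w) \<longrightarrow>
      \<not> (snd ((x # w) ! i) = snd ((x # w) ! Suc i) \<and> fst ((x # w) ! i) \<noteq> fst ((x # w) ! Suc i))"]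
  show ?thesis using Cons by (auto simp: reduced_word_def)
qed

text \<open>Letters outside the basis \<open>J\<close> stand for the trivial Schreier generators.\<close>

definition lmul :: "'j set \<Rightarrow> bool \<Rightarrow> 'j \<Rightarrow> (bool \<times> 'j) list \<Rightarrow> (bool \<times> 'j) list" where
  "lmul J b j w = (if j \<notin> J then w else if w \<noteq> [] \<and> hd w = (\<not> b, j) then tl w else (b, j) # w)"

definition reduced_words :: "'j set \<Rightarrow> (bool \<times> 'j) list set" where
  "reduced_words J = {w. reduced_word w \<and> snd ` set w \<subseteq> J}"

lemma lmul_closed: "w \<in> reduced_words J \<Longrightarrow> lmul J b j w \<in> reduced_words J"
  by (cases w) (auto simp: lmul_def reduced_words_def reduced_word_Cons)

text \<open>If the first letter of \<open>w\<close> was cancelled, reducedness prevents the next one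
  from cancelling as well, so the inverse letter is put back.\<close>

lemma lmul_inverse [simp]: "w \<in> reduced_words J \<Longrightarrow> lmul J (\<not> b) j (lmul J b j w) = w"
  by (cases w rule: remdups_adj.cases) (auto simp: lmul_def reduced_words_def reduced_word_Cons)

lemma lmul_inverse' [simp]:
  assumes "w \<in> reduced_words J"
  shows "lmul J True j (lmul J False j w) = w" "lmul J False j (lmul J True j w) = w"
  using lmul_inverse[OF assms, of False j] lmul_inverse[OF assms, of True j] by simp_all

lemma lmul_outside [simp]: "j \<notin> J \<Longrightarrow> lmul J b j w = w"
  by (simp add: lmul_def)

text \<open>The stable letters of the loops \<open>U \<sigma>\<close> at the base vertex form, together with the identity, a
  transversal for the kernel of \<open>\<pi>\<close>.\<close>

locale virtually_free_graph = group_graph V P E src tgt \<phi> + K: group K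
  for V :: "'v set" and P :: "'v \<Rightarrow> 'q monoid" and E :: "'e set" and src tgt \<phi> and K :: "'k monoid" +
  fixes v\<^sub>0 :: 'v and \<pi> :: "nat \<Rightarrow> 'k" and U :: "'k \<Rightarrow> 'e"
  assumes v\<^sub>0 [simp]: "v\<^sub>0 \<in> V" and P_base: "carrier (P v\<^sub>0) = {\<one>\<^bsub>P v\<^sub>0\<^esub>}"
    and K_finite: "finite (carrier K)"
    and \<pi>_hom: "\<pi> \<in> hom \<Gamma> K"
    and \<pi>_inj: "v \<in> V \<Longrightarrow> inj_on (\<lambda>q. \<pi> (\<iota> v q)) (carrier (P v))"
    and U: "\<lbrakk>\<sigma> \<in> carrier K; \<sigma> \<noteq> \<one>\<^bsub>K\<^esub>\<rbrakk> \<Longrightarrow> U \<sigma> \<in> E \<and> src (U \<sigma>) = v\<^sub>0 \<and> tgt (U \<sigma>) = v\<^sub>0 \<and> \<pi> (\<tau> (U \<sigma>)) = \<sigma>"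
begin

sublocale \<pi>: group_hom \<Gamma> K \<pi>
  using \<pi>_hom by unfold_locales

lemma \<pi>\<iota>_closed [simp]: "\<lbrakk>v \<in> V; q \<in> carrier (P v)\<rbrakk> \<Longrightarrow> \<pi> (\<iota> v q) \<in> carrier K"
  by simp

lemma \<pi>_faithful: "\<lbrakk>v \<in> V; q \<in> carrier (P v); \<sigma> \<in> carrier K; \<pi> (\<iota> v q) \<otimes>\<^bsub>K\<^esub> \<sigma> = \<sigma>\<rbrakk> \<Longrightarrow> q = \<one>\<^bsub>P v\<^esub>"
proof -
  assume *: "v \<in> V" "q \<in> carrier (P v)" "\<sigma> \<in> carrier K" "\<pi> (\<iota> v q) \<otimes>\<^bsub>K\<^esub> \<sigma> = \<sigma>"
  then have "\<pi> (\<iota> v q) = \<one>\<^bsub>K\<^esub>" by (metis K.r_cancel_one \<pi>\<iota>_closed)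
  then have "\<pi> (\<iota> v q) = \<pi> (\<iota> v \<one>\<^bsub>P v\<^esub>)" using * by simp
  then show ?thesis by (rule inj_onD[OF \<pi>_inj[OF *(1)]]) (use * in simp_all)
qed

text \<open>Coordinates for the left translations of K by the images of all vertex groups. They are
  chosen once, because the generators of an edge refer to the coordinates at both of its
  ends.\<close>

definition \<kappa> where
  "\<kappa> = (SOME \<kappa>. \<forall>v\<in>V. \<forall>\<sigma>\<in>carrier K. \<kappa> v \<sigma> \<in> carrier (P v) \<and>
    (\<forall>q\<in>carrier (P v). \<kappa> v (\<pi> (\<iota> v q) \<otimes>\<^bsub>K\<^esub> \<sigma>) = q \<otimes>\<^bsub>P v\<^esub> \<kappa> v \<sigma>))"

lemma \<kappa>:
  assumes "v \<in> V" "\<sigma> \<in> carrier K"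
  shows \<kappa>_closed [simp]: "\<kappa> v \<sigma> \<in> carrier (P v)"
    and \<kappa>_mult [simp]: "q \<in> carrier (P v) \<Longrightarrow> \<kappa> v (\<pi> (\<iota> v q) \<otimes>\<^bsub>K\<^esub> \<sigma>) = q \<otimes>\<^bsub>P v\<^esub> \<kappa> v \<sigma>"
proof -
  have "\<exists>\<kappa>. \<forall>\<sigma>\<in>carrier K. \<kappa> \<sigma> \<in> carrier (P v) \<and>
    (\<forall>q\<in>carrier (P v). \<kappa> (\<pi> (\<iota> v q) \<otimes>\<^bsub>K\<^esub> \<sigma>) = q \<otimes>\<^bsub>P v\<^esub> \<kappa> \<sigma>)" if "v \<in> V" for v
    by (rule free_action_equivariant_map[of "P v" "carrier K" "\<lambda>q \<sigma>. \<pi> (\<iota> v q) \<otimes>\<^bsub>K\<^esub> \<sigma>" "\<one>\<^bsub>K\<^esub>"])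
      (use that \<pi>_faithful in \<open>auto simp: P_group \<iota>_mult K.m_assoc\<close>)
  then have "\<exists>\<kappa>. \<forall>v\<in>V. \<forall>\<sigma>\<in>carrier K. \<kappa> v \<sigma> \<in> carrier (P v) \<and>
    (\<forall>q\<in>carrier (P v). \<kappa> v (\<pi> (\<iota> v q) \<otimes>\<^bsub>K\<^esub> \<sigma>) = q \<otimes>\<^bsub>P v\<^esub> \<kappa> v \<sigma>)"
    by metis
  from someI_ex[OF this] assms
  show "\<kappa> v \<sigma> \<in> carrier (P v)"
    "q \<in> carrier (P v) \<Longrightarrow> \<kappa> v (\<pi> (\<iota> v q) \<otimes>\<^bsub>K\<^esub> \<sigma>) = q \<otimes>\<^bsub>P v\<^esub> \<kappa> v \<sigma>"
    unfolding \<kappa>_def by blast+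
qed

section \<open>Transversal and Schreier generators\<close>

text \<open>\<open>u\<close> lifts K to Gamma by the loops at the base vertex, \<open>b v\<close> is
  the lift made equivariant under \<open>P v\<close>. \<open>c v\<close> compares the two lifts,
  \<open>d e\<close> compares the equivariant lifts at the two ends of an edge. The Schreier
  generator of a vertex letter is a quotient of two \<open>c\<close>, that of a stable letter is a
  \<open>d\<close> between two \<open>c\<close>.\<close>

definition rep where "rep v \<sigma> = inv\<^bsub>K\<^esub> (\<pi> (\<iota> v (\<kappa> v \<sigma>))) \<otimes>\<^bsub>K\<^esub> \<sigma>"
definition u where "u \<sigma> = (if \<sigma> = \<one>\<^bsub>K\<^esub> then \<one>\<^bsub>\<Gamma>\<^esub> else \<tau> (U \<sigma>))"
definition b where "b v \<sigma> = \<iota> v (\<kappa> v \<sigma>) \<cdot> u (rep v \<sigma>)"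
definition c where "c v \<sigma> = inv\<^bsub>\<Gamma>\<^esub> (u \<sigma>) \<cdot> b v \<sigma>"
definition d where "d e \<sigma> = inv\<^bsub>\<Gamma>\<^esub> (b (tgt e) (\<pi> (\<tau> e) \<otimes>\<^bsub>K\<^esub> \<sigma>)) \<cdot> \<tau> e \<cdot> b (src e) \<sigma>"

text \<open>The indices that remain after removing repeated and trivial generators:
  \<open>c v \<sigma>\<close> is trivial when \<open>\<sigma>\<close> is a representative,
  \<open>d e \<sigma>\<close> depends only on the coset of \<open>\<sigma>\<close>, and
  \<open>d (U \<sigma>) \<one>\<close> is trivial because \<open>U \<sigma>\<close> is itself the
  transversal letter.\<close>

definition J :: "('v \<times> 'k + 'e \<times> 'k) set" where
  "J = Inl ` {(v, \<sigma>). v \<in> V \<and> \<sigma> \<in> carrier K \<and> \<kappa> v \<sigma> \<noteq> \<one>\<^bsub>P v\<^esub>} \<union>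
    Inr ` {(e, \<sigma>). e \<in> E \<and> \<sigma> \<in> carrier K \<and> \<kappa> (src e) \<sigma> = \<one>\<^bsub>P (src e)\<^esub> \<and>
      \<not> (\<sigma> = \<one>\<^bsub>K\<^esub> \<and> e \<in> U ` (carrier K - {\<one>\<^bsub>K\<^esub>}))}"

definition elt :: "'v \<times> 'k + 'e \<times> 'k \<Rightarrow> nat" where
  "elt = case_sum (\<lambda>(v, \<sigma>). c v \<sigma>) (\<lambda>(e, \<sigma>). d e \<sigma>)"

lemma u_closed [simp]: "\<sigma> \<in> carrier K \<Longrightarrow> u \<sigma> \<in> carrier \<Gamma>"
  using U by (simp add: u_def)

lemma \<pi>_u [simp]: "\<sigma> \<in> carrier K \<Longrightarrow> \<pi> (u \<sigma>) = \<sigma>"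
  using U by (simp add: u_def)

lemma u_one [simp]: "u \<one>\<^bsub>K\<^esub> = \<one>\<^bsub>\<Gamma>\<^esub>"
  by (simp add: u_def)

lemma rep_closed [simp]: "\<lbrakk>v \<in> V; \<sigma> \<in> carrier K\<rbrakk> \<Longrightarrow> rep v \<sigma> \<in> carrier K"
  by (simp add: rep_def)

lemma \<kappa>_rep [simp]:
  assumes "v \<in> V" "\<sigma> \<in> carrier K"
  shows "\<kappa> v (rep v \<sigma>) = \<one>\<^bsub>P v\<^esub>"
proof -
  interpret h: group_hom "P v" \<Gamma> "\<iota> v" using assms(1) by (rule \<iota>_group_hom)
  have "rep v \<sigma> = \<pi> (\<iota> v (inv\<^bsub>P v\<^esub> (\<kappa> v \<sigma>))) \<otimes>\<^bsub>K\<^esub> \<sigma>"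
    using assms by (simp add: rep_def)
  then have "\<kappa> v (rep v \<sigma>) = inv\<^bsub>P v\<^esub> (\<kappa> v \<sigma>) \<otimes>\<^bsub>P v\<^esub> \<kappa> v \<sigma>"
    using \<kappa>_mult[OF assms, of "inv\<^bsub>P v\<^esub> (\<kappa> v \<sigma>)"] assms by (simp only: h.inv_closed \<kappa>_closed P_closed)
  then show ?thesis using assms by simp
qed

lemma \<pi>\<kappa>_rep: "\<lbrakk>v \<in> V; \<sigma> \<in> carrier K\<rbrakk> \<Longrightarrow> \<pi> (\<iota> v (\<kappa> v \<sigma>)) \<otimes>\<^bsub>K\<^esub> rep v \<sigma> = \<sigma>"
  by (simp add: rep_def flip: K.m_assoc)

lemma rep_mult [simp]:
  assumes "v \<in> V" "\<sigma> \<in> carrier K" "q \<in> carrier (P v)"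
  shows "rep v (\<pi> (\<iota> v q) \<otimes>\<^bsub>K\<^esub> \<sigma>) = rep v \<sigma>"
  using assms by (simp add: rep_def \<iota>_mult K.inv_mult_group K.m_assoc
      flip: K.m_assoc[of "inv\<^bsub>K\<^esub> \<pi> (\<iota> v q)" "\<pi> (\<iota> v q)"])

lemma rep_id: "\<lbrakk>v \<in> V; \<sigma> \<in> carrier K; \<kappa> v \<sigma> = \<one>\<^bsub>P v\<^esub>\<rbrakk> \<Longrightarrow> rep v \<sigma> = \<sigma>"
  by (simp add: rep_def)

lemma b_closed [simp]: "\<lbrakk>v \<in> V; \<sigma> \<in> carrier K\<rbrakk> \<Longrightarrow> b v \<sigma> \<in> carrier \<Gamma>"
  by (simp add: b_def)

lemma \<pi>_b [simp]: "\<lbrakk>v \<in> V; \<sigma> \<in> carrier K\<rbrakk> \<Longrightarrow> \<pi> (b v \<sigma>) = \<sigma>"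
  by (simp add: b_def \<pi>\<kappa>_rep)

lemma b_mult: "\<lbrakk>v \<in> V; \<sigma> \<in> carrier K; q \<in> carrier (P v)\<rbrakk> \<Longrightarrow>
    b v (\<pi> (\<iota> v q) \<otimes>\<^bsub>K\<^esub> \<sigma>) = \<iota> v q \<cdot> b v \<sigma>"
  by (simp add: b_def \<iota>_mult \<Gamma>.m_assoc)

lemma c_closed [simp]: "\<lbrakk>v \<in> V; \<sigma> \<in> carrier K\<rbrakk> \<Longrightarrow> c v \<sigma> \<in> carrier \<Gamma>"
  by (simp add: c_def)

lemma d_closed [simp]: "\<lbrakk>e \<in> E; \<sigma> \<in> carrier K\<rbrakk> \<Longrightarrow> d e \<sigma> \<in> carrier \<Gamma>"
  by (simp add: d_def)

lemma \<pi>_c [simp]: "\<lbrakk>v \<in> V; \<sigma> \<in> carrier K\<rbrakk> \<Longrightarrow> \<pi> (c v \<sigma>) = \<one>\<^bsub>K\<^esub>"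
  by (simp add: c_def)

lemma \<pi>_d [simp]: "\<lbrakk>e \<in> E; \<sigma> \<in> carrier K\<rbrakk> \<Longrightarrow> \<pi> (d e \<sigma>) = \<one>\<^bsub>K\<^esub>"
  by (simp add: d_def K.m_assoc)

lemma \<kappa>_base [simp]: "\<sigma> \<in> carrier K \<Longrightarrow> \<kappa> v\<^sub>0 \<sigma> = \<one>\<^bsub>P v\<^sub>0\<^esub>"
  using \<kappa>_closed[of v\<^sub>0 \<sigma>] P_base by simp

lemma b_base [simp]: "\<sigma> \<in> carrier K \<Longrightarrow> b v\<^sub>0 \<sigma> = u \<sigma>"
  by (simp add: b_def rep_def)

lemma c_trivial: "\<lbrakk>v \<in> V; \<sigma> \<in> carrier K; \<kappa> v \<sigma> = \<one>\<^bsub>P v\<^esub>\<rbrakk> \<Longrightarrow> c v \<sigma> = \<one>\<^bsub>\<Gamma>\<^esub>"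
  by (simp add: c_def b_def rep_def)

lemma d_trivial: "\<lbrakk>\<sigma> \<in> carrier K; \<sigma> \<noteq> \<one>\<^bsub>K\<^esub>\<rbrakk> \<Longrightarrow> d (U \<sigma>) \<one>\<^bsub>K\<^esub> = \<one>\<^bsub>\<Gamma>\<^esub>"
  using U[of \<sigma>] by (simp add: d_def) (simp add: u_def)

lemma \<pi>_conj: "\<lbrakk>e \<in> E; a \<in> carrier (P (src e)); \<sigma> \<in> carrier K\<rbrakk> \<Longrightarrow>
    \<pi> (\<tau> e) \<otimes>\<^bsub>K\<^esub> (\<pi> (\<iota> (src e) a) \<otimes>\<^bsub>K\<^esub> \<sigma>) = \<pi> (\<iota> (tgt e) (\<phi> e a)) \<otimes>\<^bsub>K\<^esub> (\<pi> (\<tau> e) \<otimes>\<^bsub>K\<^esub> \<sigma>)"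
  using arg_cong[OF \<tau>_conj[of e a], of \<pi>] by (simp flip: K.m_assoc)

text \<open>Translating \<open>\<sigma>\<close> by an edge group element multiplies the lifts at the
  two ends by its two images, and the conjugation relation cancels these.\<close>

lemma d_rep:
  assumes "e \<in> E" "\<sigma> \<in> carrier K"
  shows "d e \<sigma> = d e (rep (src e) \<sigma>)"
proof -
  have "d e (\<pi> (\<iota> (src e) a) \<otimes>\<^bsub>K\<^esub> \<rho>) = d e \<rho>" if a: "a \<in> carrier (P (src e))" and \<rho>: "\<rho> \<in> carrier K" for a \<rho>
  proof -
    let ?q = "\<iota> (tgt e) (\<phi> e a)" and ?b = "b (tgt e) (\<pi> (\<tau> e) \<otimes>\<^bsub>K\<^esub> \<rho>)"
    have cl: "?q \<in> carrier \<Gamma>" "?b \<in> carrier \<Gamma>" "\<tau> e \<in> carrier \<Gamma>" "\<iota> (src e) a \<in> carrier \<Gamma>" "b (src e) \<rho> \<in> carrier \<Gamma>"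
      using assms(1) a \<rho> by simp_all
    have "d e (\<pi> (\<iota> (src e) a) \<otimes>\<^bsub>K\<^esub> \<rho>) =
        inv\<^bsub>\<Gamma>\<^esub> (?q \<cdot> ?b) \<cdot> \<tau> e \<cdot> (\<iota> (src e) a \<cdot> b (src e) \<rho>)"
      unfolding d_def using assms(1) a \<rho> by (simp add: \<pi>_conj b_mult del: \<pi>.hom_mult)
    also have "\<dots> = inv\<^bsub>\<Gamma>\<^esub> ?b \<cdot> inv\<^bsub>\<Gamma>\<^esub> ?q \<cdot> (\<tau> e \<cdot> \<iota> (src e) a) \<cdot> b (src e) \<rho>"
      using cl by (simp add: \<Gamma>.inv_mult_group \<Gamma>.m_assoc)
    also have "\<tau> e \<cdot> \<iota> (src e) a = ?q \<cdot> \<tau> e" using \<tau>_conj assms(1) a by simp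
    also have "inv\<^bsub>\<Gamma>\<^esub> ?b \<cdot> inv\<^bsub>\<Gamma>\<^esub> ?q \<cdot> (?q \<cdot> \<tau> e) \<cdot> b (src e) \<rho> = d e \<rho>"
      using cl by (simp add: d_def \<Gamma>.m_assoc flip: \<Gamma>.m_assoc[of "inv\<^bsub>\<Gamma>\<^esub> ?q" ?q])
    finally show ?thesis .
  qed
  from this[of "\<kappa> (src e) \<sigma>" "rep (src e) \<sigma>"] show ?thesis using assms by (simp add: \<pi>\<kappa>_rep)
qed

section \<open>The kernel and its generators\<close>

definition N where "N = kernel \<Gamma> K \<pi>"

lemma N_iff: "g \<in> N \<longleftrightarrow> g \<in> carrier \<Gamma> \<and> \<pi> g = \<one>\<^bsub>K\<^esub>"
  by (simp add: N_def kernel_def)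

lemma N_normal: "N \<lhd> \<Gamma>"
  unfolding N_def by (rule \<pi>.normal_kernel)

lemma N_finite_index: "finite (rcosets\<^bsub>\<Gamma>\<^esub> N)"
proof -
  interpret n: normal N \<Gamma> by (rule N_normal)
  have "rcosets\<^bsub>\<Gamma>\<^esub> N \<subseteq> (\<lambda>\<sigma>. N #>\<^bsub>\<Gamma>\<^esub> u \<sigma>) ` carrier K"
  proof
    fix C assume "C \<in> rcosets\<^bsub>\<Gamma>\<^esub> N"
    then obtain g where g: "g \<in> carrier \<Gamma>" "C = N #>\<^bsub>\<Gamma>\<^esub> g" by (auto simp: RCOSETS_def)
    have "\<pi> (u (\<pi> g)) = \<pi> g" "u (\<pi> g) \<in> carrier \<Gamma>" using g(1) by (simp_all del: \<pi>.hom_mult)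
    then have "g \<cdot> inv\<^bsub>\<Gamma>\<^esub> (u (\<pi> g)) \<in> N" using g(1) unfolding N_iff by simp
    moreover have "g \<cdot> inv\<^bsub>\<Gamma>\<^esub> (u (\<pi> g)) \<cdot> u (\<pi> g) = g" using g by (simp add: \<Gamma>.m_assoc)
    ultimately have "g \<in> N #>\<^bsub>\<Gamma>\<^esub> u (\<pi> g)" by (force simp: r_coset_def)
    then have "C = N #>\<^bsub>\<Gamma>\<^esub> u (\<pi> g)"
      using g \<Gamma>.repr_independence[of g N "u (\<pi> g)"] n.subgroup_axioms by simp
    then show "C \<in> (\<lambda>\<sigma>. N #>\<^bsub>\<Gamma>\<^esub> u \<sigma>) ` carrier K" using g by auto
  qed
  then show ?thesis using K_finite finite_surj by blast
qed

lemma elt_closed: "j \<in> J \<Longrightarrow> elt j \<in> N"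
  by (auto simp: J_def elt_def N_iff)

abbreviation "S \<equiv> elt ` J"

lemma S_subset: "S \<subseteq> carrier \<Gamma>"
  using elt_closed by (auto simp: N_iff)

lemma c_generated: "\<lbrakk>v \<in> V; \<sigma> \<in> carrier K\<rbrakk> \<Longrightarrow> c v \<sigma> \<in> generate \<Gamma> S"
proof (cases "\<kappa> v \<sigma> = \<one>\<^bsub>P v\<^esub>")
  case True
  moreover assume "v \<in> V" "\<sigma> \<in> carrier K"
  ultimately show ?thesis by (simp add: c_trivial generate.one)
next
  case False
  moreover assume "v \<in> V" "\<sigma> \<in> carrier K"
  ultimately have "Inl (v, \<sigma>) \<in> J" by (auto simp: J_def)
  then have "elt (Inl (v, \<sigma>)) \<in> generate \<Gamma> S" by (intro generate.incl imageI)
  then show ?thesis by (simp add: elt_def)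
qed

lemma d_generated:
  assumes "e \<in> E" "\<sigma> \<in> carrier K"
  shows "d e \<sigma> \<in> generate \<Gamma> S"
proof (cases "rep (src e) \<sigma> = \<one>\<^bsub>K\<^esub> \<and> e \<in> U ` (carrier K - {\<one>\<^bsub>K\<^esub>})")
  case True
  then obtain \<rho> where "\<rho> \<in> carrier K" "\<rho> \<noteq> \<one>\<^bsub>K\<^esub>" "e = U \<rho>" "rep (src e) \<sigma> = \<one>\<^bsub>K\<^esub>" by blast
  then have "d e (rep (src e) \<sigma>) = \<one>\<^bsub>\<Gamma>\<^esub>" using d_trivial[of \<rho>] by simp
  then show ?thesis using d_rep[OF assms] by (simp add: generate.one)
next
  case False
  then have "Inr (e, rep (src e) \<sigma>) \<in> J" using assms by (auto simp: J_def)
  then have "elt (Inr (e, rep (src e) \<sigma>)) \<in> generate \<Gamma> S" by (intro generate.incl imageI)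
  then show ?thesis using d_rep[OF assms] by (simp add: elt_def)
qed

text \<open>The Reidemeister-Schreier argument: \<open>?a\<close> satisfies a cocycle identity over
  the action on K, so single letters suffice. On the kernel, its value at the identity of K is the
  element itself.\<close>

lemma generate_S: "generate \<Gamma> S = N"
proof
  interpret n: normal N \<Gamma> by (rule N_normal)
  show "generate \<Gamma> S \<subseteq> N"
    using elt_closed by (intro \<Gamma>.generate_subgroup_incl n.subgroup_axioms) auto
  interpret g: subgroup "generate \<Gamma> S" \<Gamma>
    using S_subset by (rule \<Gamma>.generate_is_subgroup)
  have cancel: "g \<cdot> (inv\<^bsub>\<Gamma>\<^esub> g \<cdot> h) = h" if "g \<in> carrier \<Gamma>" "h \<in> carrier \<Gamma>" for g h
    using that by (simp flip: \<Gamma>.m_assoc)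
  let ?a = "\<lambda>g \<sigma>. inv\<^bsub>\<Gamma>\<^esub> (u (\<pi> g \<otimes>\<^bsub>K\<^esub> \<sigma>)) \<cdot> g \<cdot> u \<sigma>"
  have step: "?a (x \<cdot> g) \<sigma> = ?a x (\<pi> g \<otimes>\<^bsub>K\<^esub> \<sigma>) \<cdot> ?a g \<sigma>"
    if "x \<in> carrier \<Gamma>" "g \<in> carrier \<Gamma>" "\<sigma> \<in> carrier K" for x g \<sigma>
    using that by (simp add: K.m_assoc \<Gamma>.m_assoc
        flip: \<Gamma>.m_assoc[of "u (\<pi> g \<otimes>\<^bsub>K\<^esub> \<sigma>)" "inv\<^bsub>\<Gamma>\<^esub> u (\<pi> g \<otimes>\<^bsub>K\<^esub> \<sigma>)"])
  have vtx: "?a (\<iota> v q) \<sigma> \<in> generate \<Gamma> S" if "v \<in> V" "q \<in> carrier (P v)" "\<sigma> \<in> carrier K" for v q \<sigma>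
  proof -
    let ?\<sigma>' = "\<pi> (\<iota> v q) \<otimes>\<^bsub>K\<^esub> \<sigma>"
    \<comment> \<open>Equivariance of \<open>b\<close> absorbs the vertex letter, so only the
      comparisons with \<open>u\<close> at the two points remain.\<close>
    have "?a (\<iota> v q) \<sigma> = c v ?\<sigma>' \<cdot> inv\<^bsub>\<Gamma>\<^esub> (c v \<sigma>)"
      using that by (simp add: c_def b_mult \<Gamma>.inv_mult_group \<Gamma>.m_assoc cancel)
    then show ?thesis using that c_generated by simp
  qed
  have edge: "?a (\<tau> e) \<sigma> \<in> generate \<Gamma> S" if "e \<in> E" "\<sigma> \<in> carrier K" for e \<sigma>
  proof -
    let ?\<sigma>' = "\<pi> (\<tau> e) \<otimes>\<^bsub>K\<^esub> \<sigma>"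
    have "?a (\<tau> e) \<sigma> = c (tgt e) ?\<sigma>' \<cdot> d e \<sigma> \<cdot> inv\<^bsub>\<Gamma>\<^esub> (c (src e) \<sigma>)"
      using that by (simp add: c_def d_def \<Gamma>.inv_mult_group \<Gamma>.m_assoc cancel)
    then show ?thesis using that c_generated d_generated by simp
  qed
  have edge_inv: "?a (inv\<^bsub>\<Gamma>\<^esub> (\<tau> e)) \<sigma> \<in> generate \<Gamma> S" if "e \<in> E" "\<sigma> \<in> carrier K" for e \<sigma>
  proof -
    let ?\<sigma>' = "inv\<^bsub>K\<^esub> (\<pi> (\<tau> e)) \<otimes>\<^bsub>K\<^esub> \<sigma>"
    have "\<pi> (\<tau> e) \<otimes>\<^bsub>K\<^esub> ?\<sigma>' = \<sigma>" using that by (simp flip: K.m_assoc)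
    then have "?a (inv\<^bsub>\<Gamma>\<^esub> (\<tau> e)) \<sigma> = inv\<^bsub>\<Gamma>\<^esub> (?a (\<tau> e) ?\<sigma>')"
      using that by (simp add: \<Gamma>.inv_mult_group \<Gamma>.m_assoc)
    then show ?thesis using edge[of e ?\<sigma>'] that by simp
  qed
  have mult: "\<forall>\<sigma>\<in>carrier K. ?a (x \<cdot> g) \<sigma> \<in> generate \<Gamma> S"
    if "x \<in> carrier \<Gamma>" "g \<in> carrier \<Gamma>" "\<And>\<sigma>. \<sigma> \<in> carrier K \<Longrightarrow> ?a x \<sigma> \<in> generate \<Gamma> S"
      "\<forall>\<sigma>\<in>carrier K. ?a g \<sigma> \<in> generate \<Gamma> S" for x g
  proof
    fix \<sigma> assume \<sigma>: "\<sigma> \<in> carrier K"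
    have "?a x (\<pi> g \<otimes>\<^bsub>K\<^esub> \<sigma>) \<cdot> ?a g \<sigma> \<in> generate \<Gamma> S"
      by (rule g.m_closed[OF that(3) that(4)[rule_format]]) (use that \<sigma> in simp_all)
    then show "?a (x \<cdot> g) \<sigma> \<in> generate \<Gamma> S"
      unfolding step[OF that(1,2) \<sigma>] .
  qed
  have all: "\<forall>\<sigma>\<in>carrier K. ?a g \<sigma> \<in> generate \<Gamma> S" if "g \<in> carrier \<Gamma>" for g
    using that
  proof (induction rule: \<Gamma>_induct)
    case one
    then show ?case by (auto simp: generate.one)
  qed (rule mult; (assumption | rule vtx edge edge_inv | simp)+)+
  show "N \<subseteq> generate \<Gamma> S"
  proof
    fix g assume "g \<in> N"
    then show "g \<in> generate \<Gamma> S" using all[of g] by (force simp: N_iff)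
  qed
qed

text \<open>A generator \<open>x\<close> acts over \<open>\<sigma>\<close> by the word expressing \<open>inv (u (\<pi> x \<sigma>)) x (u \<sigma>)\<close> in the basis,
  so that the basis itself acts by left multiplication on the reduced words over the identity.\<close>

abbreviation "RW \<equiv> reduced_words J"
definition mulC where "mulC s v \<sigma> = lmul J s (Inl (v, \<sigma>))"
definition mulD where "mulD s e \<sigma> = lmul J s (Inr (e, rep (src e) \<sigma>))"

lemma mul_closed [simp]: "w \<in> RW \<Longrightarrow> mulC s v \<sigma> w \<in> RW" "w \<in> RW \<Longrightarrow> mulD s e \<sigma> w \<in> RW"
  by (simp_all add: mulC_def mulD_def lmul_closed)

lemma mul_inverse [simp]:
  assumes "w \<in> RW"
  shows "mulC True v \<sigma> (mulC False v \<sigma> w) = w" "mulC False v \<sigma> (mulC True v \<sigma> w) = w"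
    "mulD True e \<sigma> (mulD False e \<sigma> w) = w" "mulD False e \<sigma> (mulD True e \<sigma> w) = w"
  using assms by (simp_all add: mulC_def mulD_def)

lemma mulC_trivial: "\<kappa> v \<sigma> = \<one>\<^bsub>P v\<^esub> \<Longrightarrow> mulC s v \<sigma> w = w"
  unfolding mulC_def by (rule lmul_outside) (auto simp: J_def)

lemma mulD_trivial: "\<lbrakk>\<sigma> \<in> carrier K; \<sigma> \<noteq> \<one>\<^bsub>K\<^esub>\<rbrakk> \<Longrightarrow> mulD s (U \<sigma>) \<one>\<^bsub>K\<^esub> w = w"
proof -
  assume *: "\<sigma> \<in> carrier K" "\<sigma> \<noteq> \<one>\<^bsub>K\<^esub>"
  then have "rep (src (U \<sigma>)) \<one>\<^bsub>K\<^esub> = \<one>\<^bsub>K\<^esub>"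
    using U[of \<sigma>] by (simp add: rep_def)
  then show ?thesis unfolding mulD_def using * by (intro lmul_outside) (auto simp: J_def)
qed

fun word_action :: "('v, 'q, 'e) letter \<Rightarrow> 'k \<times> (bool \<times> ('v \<times> 'k + 'e \<times> 'k)) list \<Rightarrow> 'k \<times> (bool \<times> ('v \<times> 'k + 'e \<times> 'k)) list" where
  "word_action (Vtx v q) (\<sigma>, w) = (let \<sigma>' = \<pi> (\<iota> v q) \<otimes>\<^bsub>K\<^esub> \<sigma> in
    (\<sigma>', mulC True v \<sigma>' (mulC False v \<sigma> w)))"
| "word_action (Edge e) (\<sigma>, w) = (let \<sigma>' = \<pi> (\<tau> e) \<otimes>\<^bsub>K\<^esub> \<sigma> in
    (\<sigma>', mulC True (tgt e) \<sigma>' (mulD True e \<sigma> (mulC False (src e) \<sigma> w))))"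
| "word_action (EdgeInv e) (\<sigma>, w) = (let \<sigma>' = inv\<^bsub>K\<^esub> (\<pi> (\<tau> e)) \<otimes>\<^bsub>K\<^esub> \<sigma> in
    (\<sigma>', mulC True (src e) \<sigma>' (mulD False e \<sigma>' (mulC False (tgt e) \<sigma> w))))"

text \<open>Adjacent factors \<open>mulC\<close> with opposite signs cancel, which settles the
  relations inside vertex groups. The conjugation relation holds because \<open>mulD\<close> sees
  only the coset of \<open>\<sigma>\<close>.\<close>

lemma word_action_extends: "\<exists>ext. extends_action (carrier K \<times> RW) word_action ext"
proof (rule action_extends, goal_cases)
  case (1 x y)
  then show ?case by (cases x) (auto simp: Let_def)
next
  case (2 v q r y)
  then show ?case by (auto simp: Let_def \<iota>_mult K.m_assoc)
next
  case (3 v y)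
  then show ?case by (auto simp: Let_def)
next
  case (4 e y)
  then show ?case by (auto simp: Let_def simp flip: K.m_assoc)
next
  case (5 e y)
  then show ?case by (auto simp: Let_def simp flip: K.m_assoc)
next
  case (6 e a y)
  obtain \<sigma> w where y: "y = (\<sigma>, w)" "\<sigma> \<in> carrier K" "w \<in> RW" using 6 by auto
  have "mulD s e (\<pi> (\<iota> (src e) a) \<otimes>\<^bsub>K\<^esub> \<sigma>) = mulD s e \<sigma>" for s
    using 6 y by (simp add: mulD_def)
  then show ?case using 6 y by (simp add: Let_def \<pi>_conj del: \<pi>.hom_mult)
qed

lemma N_free: "free_subgroup \<Gamma> N"
proof -
  obtain ext where "extends_action (carrier K \<times> RW) word_action ext"
    using word_action_extends by blast
  note ext1 = extends_actionD(1)[OF this] and ext_mult = extends_actionD(3)[OF this]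
    and ext_letter = extends_actionD(4)[OF this]
  have ext_inv: "ext (inv\<^bsub>\<Gamma>\<^esub> g) (ext g y) = y" if "g \<in> carrier \<Gamma>" "y \<in> carrier K \<times> RW" for g y
    using that ext_mult[of y "inv\<^bsub>\<Gamma>\<^esub> g" g] ext1 by simp
  \<comment> \<open>A transversal letter carries the fibre over the identity to the fibre over
    \<open>\<sigma>\<close> with the word unchanged, since its own letters lie outside
    \<open>J\<close>.\<close>
  have u: "ext (u \<sigma>) (\<one>\<^bsub>K\<^esub>, w) = (\<sigma>, w)" if "\<sigma> \<in> carrier K" "w \<in> RW" for \<sigma> w
  proof (cases "\<sigma> = \<one>\<^bsub>K\<^esub>")
    case True
    then show ?thesis using that ext1 by simp
  next
    case False
    then show ?thesis using that U[of \<sigma>] ext_letter[of "(\<one>\<^bsub>K\<^esub>, w)" "Edge (U \<sigma>)"]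
      by (simp add: u_def mulC_trivial mulD_trivial flip: \<tau>_def)
  qed
  have b: "ext (b v \<sigma>) (\<one>\<^bsub>K\<^esub>, w) = (\<sigma>, mulC True v \<sigma> w)" if "v \<in> V" "\<sigma> \<in> carrier K" "w \<in> RW" for v \<sigma> w
    using that u[of "rep v \<sigma>" w] ext_mult[of "(\<one>\<^bsub>K\<^esub>, w)" "\<iota> v (\<kappa> v \<sigma>)" "u (rep v \<sigma>)"]
      ext_letter[of "(rep v \<sigma>, w)" "Vtx v (\<kappa> v \<sigma>)"]
    by (simp add: b_def Let_def \<pi>\<kappa>_rep mulC_trivial flip: \<iota>_def)
  have c: "ext (c v \<sigma>) (\<one>\<^bsub>K\<^esub>, w) = (\<one>\<^bsub>K\<^esub>, mulC True v \<sigma> w)" if "v \<in> V" "\<sigma> \<in> carrier K" "w \<in> RW" for v \<sigma> w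
  proof -
    have "ext (c v \<sigma>) (\<one>\<^bsub>K\<^esub>, w) = ext (inv\<^bsub>\<Gamma>\<^esub> (u \<sigma>)) (ext (u \<sigma>) (\<one>\<^bsub>K\<^esub>, mulC True v \<sigma> w))"
      using that by (simp add: c_def ext_mult b u)
    then show ?thesis using that by (simp add: ext_inv)
  qed
  have d: "ext (d e \<sigma>) (\<one>\<^bsub>K\<^esub>, w) = (\<one>\<^bsub>K\<^esub>, mulD True e \<sigma> w)" if "e \<in> E" "\<sigma> \<in> carrier K" "w \<in> RW" for e \<sigma> w
  proof -
    let ?bt = "b (tgt e) (\<pi> (\<tau> e) \<otimes>\<^bsub>K\<^esub> \<sigma>)"
    have "ext (\<tau> e) (\<sigma>, mulC True (src e) \<sigma> w) = ext ?bt (\<one>\<^bsub>K\<^esub>, mulD True e \<sigma> w)"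
      using that ext_letter[of "(\<sigma>, mulC True (src e) \<sigma> w)" "Edge e"] by (simp add: Let_def b flip: \<tau>_def)
    then have "ext (d e \<sigma>) (\<one>\<^bsub>K\<^esub>, w) = ext (inv\<^bsub>\<Gamma>\<^esub> ?bt) (ext ?bt (\<one>\<^bsub>K\<^esub>, mulD True e \<sigma> w))"
      using that by (simp add: d_def ext_mult b \<Gamma>.m_assoc)
    then show ?thesis using that by (simp add: ext_inv)
  qed
  \<comment> \<open>On the fibre over the identity the basis acts like the left regular
    representation of a free group.\<close>
  have elt: "ext (elt j) (\<one>\<^bsub>K\<^esub>, w) = (\<one>\<^bsub>K\<^esub>, lmul J True j w)" if "j \<in> J" "w \<in> RW" for j w
  proof (cases j)
    case (Inl p)
    then show ?thesis using that c by (auto simp: elt_def mulC_def J_def)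
  next
    case (Inr p)
    then show ?thesis using that d by (auto simp: elt_def mulD_def J_def rep_id)
  qed
  have elt_inv: "ext (inv\<^bsub>\<Gamma>\<^esub> (elt j)) (\<one>\<^bsub>K\<^esub>, w) = (\<one>\<^bsub>K\<^esub>, lmul J False j w)" if "j \<in> J" "w \<in> RW" for j w
    using that ext_inv[of "elt j" "(\<one>\<^bsub>K\<^esub>, lmul J False j w)"] elt[of j "lmul J False j w"] elt_closed
    by (simp add: lmul_closed N_iff)
  have Nil: "[] \<in> RW" by (simp add: reduced_words_def)
  \<comment> \<open>Freeness concerns words in group elements, \<open>RW\<close> consists of words
    in indices; injectivity lets reducedness pass from the former to the latter.\<close>
  have inj: "inj_on elt J"
  proof (rule inj_onI)
    fix i j assume "i \<in> J" "j \<in> J" "elt i = elt j"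
    then have "lmul J True i [] = lmul J True j []" using elt[OF _ Nil] by (metis prod.inject)
    then show "i = j" using \<open>i \<in> J\<close> \<open>j \<in> J\<close> by (simp add: lmul_def)
  qed
  define f :: "bool \<times> nat \<Rightarrow> bool \<times> ('v \<times> 'k + 'e \<times> 'k)" where "f = map_prod id (inv_into J elt)"
  have eval: "eval_word \<Gamma> w \<in> carrier \<Gamma> \<and> map f w \<in> RW \<and>
      ext (eval_word \<Gamma> w) (\<one>\<^bsub>K\<^esub>, []) = (\<one>\<^bsub>K\<^esub>, map f w)"
    if "set (map snd w) \<subseteq> S" "reduced_word w" for w
    using that
  proof (induction w)
    case Nil
    then show ?case using \<open>[] \<in> RW\<close> ext1 by (simp add: eval_word_def)
  next
    case (Cons x w)
    obtain s g where x: "x = (s, g)" by (cases x)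
    then obtain j where j: "j \<in> J" "g = elt j" "inv_into J elt g = j" using Cons.prems inj by auto
    have "set (map snd w) \<subseteq> S" "reduced_word w" using Cons.prems by (auto simp: reduced_word_Cons)
    note IH = Cons.IH[OF this, THEN conjunct1] Cons.IH[OF this, THEN conjunct2, THEN conjunct1]
      Cons.IH[OF this, THEN conjunct2, THEN conjunct2]
    have g: "g \<in> carrier \<Gamma>" using j elt_closed by (simp add: N_iff)
    have eval: "eval_word \<Gamma> (x # w) = (if s then g else inv\<^bsub>\<Gamma>\<^esub> g) \<cdot> eval_word \<Gamma> w"
      by (simp add: eval_word_def x)
    \<comment> \<open>A reduced word never triggers a cancellation in \<open>lmul\<close>, so acting
      on the empty word spells out the word itself.\<close>
    have hd: "\<not> (w \<noteq> [] \<and> hd (map f w) = (\<not> s, j))"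
    proof
      assume "w \<noteq> [] \<and> hd (map f w) = (\<not> s, j)"
      moreover from this obtain s' g' w' where w: "w = (s', g') # w'" by (cases w) auto
      ultimately have "s' = (\<not> s)" "inv_into J elt g' = j" "g' \<in> S" using Cons.prems by (auto simp: f_def)
      then have "g' = g" using j by (metis f_inv_into_f)
      then show False using Cons.prems(2) \<open>s' = (\<not> s)\<close> by (simp add: x w reduced_word_Cons)
    qed
    then have "lmul J s j (map f w) = map f (x # w)"
      using j x by (auto simp: lmul_def f_def)
    moreover have "ext (eval_word \<Gamma> (x # w)) (\<one>\<^bsub>K\<^esub>, []) = (\<one>\<^bsub>K\<^esub>, lmul J s j (map f w))"
      using IH g j Nil elt[of j "map f w"] elt_inv[of j "map f w"] by (simp add: eval ext_mult)
    moreover have "lmul J s j (map f w) \<in> RW" using IH by (simp add: lmul_closed)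
    ultimately show ?case using IH g by (simp add: eval)
  qed
  have "eval_word \<Gamma> w \<noteq> \<one>\<^bsub>\<Gamma>\<^esub>" if "w \<noteq> []" "set (map snd w) \<subseteq> S" "reduced_word w" for w
  proof
    assume "eval_word \<Gamma> w = \<one>\<^bsub>\<Gamma>\<^esub>"
    then show False using eval[OF that(2,3)] ext1[of "(\<one>\<^bsub>K\<^esub>, [])"] Nil that(1) by simp
  qed
  then show ?thesis
    unfolding free_subgroup_def using generate_S elt_closed by (intro exI[of _ S]) auto
qed

end

section \<open>Nilradicals, free actions and the trivial group\<close>

text \<open>The isomorphism modulo nilradicals is \<open>A \<mapsto> \<rho> ` A\<close>; since a square-zero kernel makes \<open>nilrad R\<close>
  the full preimage of \<open>nilrad S\<close>, it is not needed that nilradicals are ideals.\<close>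

lemma nilradical_quotient_iso:
  assumes "ring R"
    and closed: "\<And>x. x \<in> carrier R \<Longrightarrow> \<rho> x \<in> carrier S"
    and mult: "\<And>x y. \<lbrakk>x \<in> carrier R; y \<in> carrier R\<rbrakk> \<Longrightarrow> \<rho> (x \<otimes>\<^bsub>R\<^esub> y) = \<rho> x \<otimes>\<^bsub>S\<^esub> \<rho> y"
    and add: "\<And>x y. \<lbrakk>x \<in> carrier R; y \<in> carrier R\<rbrakk> \<Longrightarrow> \<rho> (x \<oplus>\<^bsub>R\<^esub> y) = \<rho> x \<oplus>\<^bsub>S\<^esub> \<rho> y"
    and one: "\<rho> \<one>\<^bsub>R\<^esub> = \<one>\<^bsub>S\<^esub>" and zero: "\<rho> \<zero>\<^bsub>R\<^esub> = \<zero>\<^bsub>S\<^esub>"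
    and surj: "\<rho> ` carrier R = carrier S"
    and ker: "\<And>x y. \<lbrakk>x \<in> carrier R; y \<in> carrier R; \<rho> x = \<zero>\<^bsub>S\<^esub>; \<rho> y = \<zero>\<^bsub>S\<^esub>\<rbrakk> \<Longrightarrow> x \<otimes>\<^bsub>R\<^esub> y = \<zero>\<^bsub>R\<^esub>"
  shows "\<exists>\<psi>. \<psi> \<in> ring_iso (R Quot nilrad R) (S Quot nilrad S) \<and>
    (\<forall>x\<in>carrier R. \<psi> (nilrad R +>\<^bsub>R\<^esub> x) = nilrad S +>\<^bsub>S\<^esub> \<rho> x)"
proof -
  interpret R: ring R by fact
  have pow: "\<rho> (x [^]\<^bsub>R\<^esub> n) = \<rho> x [^]\<^bsub>S\<^esub> n" if "x \<in> carrier R" for x and n :: nat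
    by (induction n) (use that in \<open>simp_all add: nat_pow_def one mult\<close>, simp add: mult flip: nat_pow_def)
  have nil: "x \<in> nilrad R \<longleftrightarrow> x \<in> carrier R \<and> \<rho> x \<in> nilrad S" for x
  proof
    assume "x \<in> nilrad R"
    then obtain n :: nat where x: "x \<in> carrier R" "x [^]\<^bsub>R\<^esub> n = \<zero>\<^bsub>R\<^esub>" by (auto simp: nilrad_def)
    then have "\<rho> x [^]\<^bsub>S\<^esub> n = \<zero>\<^bsub>S\<^esub>" using pow zero by metis
    then show "x \<in> carrier R \<and> \<rho> x \<in> nilrad S" using x closed by (auto simp: nilrad_def)
  next
    assume "x \<in> carrier R \<and> \<rho> x \<in> nilrad S"
    then obtain n :: nat where x: "x \<in> carrier R" "\<rho> x [^]\<^bsub>S\<^esub> n = \<zero>\<^bsub>S\<^esub>" by (auto simp: nilrad_def)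
    \<comment> \<open>The power lies in the kernel of \<open>\<rho>\<close>, whose elements have
      product zero. Hence \<open>x\<close> is nilpotent, with twice the exponent.\<close>
    then have "x [^]\<^bsub>R\<^esub> n \<otimes>\<^bsub>R\<^esub> x [^]\<^bsub>R\<^esub> n = \<zero>\<^bsub>R\<^esub>" using pow by (intro ker) auto
    then have "x [^]\<^bsub>R\<^esub> (n + n) = \<zero>\<^bsub>R\<^esub>" using x by (simp add: R.nat_pow_mult)
    then show "x \<in> nilrad R" using x by (auto simp: nilrad_def)
  qed
  have coset: "\<rho> ` (nilrad R +>\<^bsub>R\<^esub> x) = nilrad S +>\<^bsub>S\<^esub> \<rho> x" if x: "x \<in> carrier R" for x
  proof safe
    fix y assume "y \<in> nilrad R +>\<^bsub>R\<^esub> x"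
    then show "\<rho> y \<in> nilrad S +>\<^bsub>S\<^esub> \<rho> x" using nil x add by (auto simp: a_r_coset_def')
  next
    fix y assume "y \<in> nilrad S +>\<^bsub>S\<^esub> \<rho> x"
    then obtain n where n: "n \<in> nilrad S" "y = n \<oplus>\<^bsub>S\<^esub> \<rho> x" by (auto simp: a_r_coset_def')
    then have "n \<in> \<rho> ` carrier R" using surj by (auto simp: nilrad_def)
    then obtain m where "m \<in> carrier R" "n = \<rho> m" by blast
    then have "m \<oplus>\<^bsub>R\<^esub> x \<in> nilrad R +>\<^bsub>R\<^esub> x" "y = \<rho> (m \<oplus>\<^bsub>R\<^esub> x)"
      using n nil x add by (auto simp: a_r_coset_def')
    then show "y \<in> \<rho> ` (nilrad R +>\<^bsub>R\<^esub> x)" by blast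
  qed
  have sub: "nilrad R +>\<^bsub>R\<^esub> x \<subseteq> carrier R" if "x \<in> carrier R" for x
    using that nil by (auto simp: a_r_coset_def')
  have recover: "y \<in> nilrad R +>\<^bsub>R\<^esub> x"
    if x: "x \<in> carrier R" and y: "y \<in> carrier R" and \<rho>y: "\<rho> y \<in> nilrad S +>\<^bsub>S\<^esub> \<rho> x" for x y
  proof -
    obtain m where m: "m \<in> nilrad R" "\<rho> y = \<rho> (m \<oplus>\<^bsub>R\<^esub> x)"
      using \<rho>y unfolding coset[OF x, symmetric] by (auto simp: a_r_coset_def')
    have mR: "m \<in> carrier R" using m nil by blast
    \<comment> \<open>\<open>k\<close> lies in the kernel, so \<open>k\<close> plus \<open>m\<close>
      has the same nilpotent image as \<open>m\<close> and is again nilpotent; it is the shift that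
      carries \<open>x\<close> to \<open>y\<close>.\<close>
    define k where "k = y \<ominus>\<^bsub>R\<^esub> (m \<oplus>\<^bsub>R\<^esub> x)"
    have k: "k \<in> carrier R" using mR x y by (simp add: k_def)
    have "\<rho> k = \<rho> (m \<oplus>\<^bsub>R\<^esub> x) \<oplus>\<^bsub>S\<^esub> \<rho> (\<ominus>\<^bsub>R\<^esub> (m \<oplus>\<^bsub>R\<^esub> x))"
      using mR x y m(2) by (simp add: k_def R.minus_eq add)
    also have "\<dots> = \<rho> ((m \<oplus>\<^bsub>R\<^esub> x) \<oplus>\<^bsub>R\<^esub> \<ominus>\<^bsub>R\<^esub> (m \<oplus>\<^bsub>R\<^esub> x))"
      using mR x by (intro add[symmetric]) auto
    also have "\<dots> = \<rho> \<zero>\<^bsub>R\<^esub>" using mR x by (simp add: R.r_neg del: R.minus_add)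
    finally have "\<rho> (k \<oplus>\<^bsub>R\<^esub> m) = \<rho> (\<zero>\<^bsub>R\<^esub> \<oplus>\<^bsub>R\<^esub> m)" using k mR by (simp only: add R.zero_closed)
    then have "k \<oplus>\<^bsub>R\<^esub> m \<in> nilrad R" using m(1) nil k mR by simp
    moreover have "y = (k \<oplus>\<^bsub>R\<^esub> m) \<oplus>\<^bsub>R\<^esub> x"
    proof -
      have "(k \<oplus>\<^bsub>R\<^esub> m) \<oplus>\<^bsub>R\<^esub> x = y \<oplus>\<^bsub>R\<^esub> (\<ominus>\<^bsub>R\<^esub> (m \<oplus>\<^bsub>R\<^esub> x) \<oplus>\<^bsub>R\<^esub> (m \<oplus>\<^bsub>R\<^esub> x))"
        using mR x y by (simp add: k_def R.minus_eq R.a_assoc del: R.minus_add)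
      then show ?thesis using mR x y by (simp add: R.l_neg del: R.minus_add)
    qed
    ultimately show ?thesis by (auto simp: a_r_coset_def')
  qed
  let ?\<psi> = "\<lambda>A. \<rho> ` A"
  have carR: "carrier (R Quot nilrad R) = {nilrad R +>\<^bsub>R\<^esub> x |x. x \<in> carrier R}"
    and carS: "carrier (S Quot nilrad S) = {nilrad S +>\<^bsub>S\<^esub> x |x. x \<in> carrier S}"
    by (auto simp: FactRing_def A_RCOSETS_def')
  have "?\<psi> \<in> ring_hom (R Quot nilrad R) (S Quot nilrad S)"
  proof (rule ring_hom_memI)
    fix A assume "A \<in> carrier (R Quot nilrad R)"
    then obtain x where "x \<in> carrier R" "A = nilrad R +>\<^bsub>R\<^esub> x" unfolding carR by blast
    then have "\<rho> ` A = nilrad S +>\<^bsub>S\<^esub> \<rho> x" "\<rho> x \<in> carrier S" using coset closed by simp_all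
    then show "\<rho> ` A \<in> carrier (S Quot nilrad S)" unfolding carS by blast
  next
    fix A C assume "A \<in> carrier (R Quot nilrad R)" "C \<in> carrier (R Quot nilrad R)"
    then have AC: "A \<subseteq> carrier R" "C \<subseteq> carrier R" unfolding carR using sub by auto
    have "\<rho> ` (\<Union>a\<in>A. \<Union>c\<in>C. nilrad R +>\<^bsub>R\<^esub> (a \<otimes>\<^bsub>R\<^esub> c)) = (\<Union>a\<in>A. \<Union>c\<in>C. nilrad S +>\<^bsub>S\<^esub> (\<rho> a \<otimes>\<^bsub>S\<^esub> \<rho> c))"
      unfolding image_UN using AC coset mult
      by (intro SUP_cong[OF HOL.refl]) (auto simp: subset_iff)
    then show "\<rho> ` (A \<otimes>\<^bsub>R Quot nilrad R\<^esub> C) = \<rho> ` A \<otimes>\<^bsub>S Quot nilrad S\<^esub> \<rho> ` C"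
      by (simp add: FactRing_def rcoset_mult_def)
    have "\<rho> ` (\<Union>a\<in>A. \<Union>c\<in>C. {a \<oplus>\<^bsub>R\<^esub> c}) = (\<Union>a\<in>A. \<Union>c\<in>C. {\<rho> a \<oplus>\<^bsub>S\<^esub> \<rho> c})"
      unfolding image_UN using AC add
      by (intro SUP_cong[OF HOL.refl]) (auto simp: subset_iff)
    then show "\<rho> ` (A \<oplus>\<^bsub>R Quot nilrad R\<^esub> C) = \<rho> ` A \<oplus>\<^bsub>S Quot nilrad S\<^esub> \<rho> ` C"
      by (simp add: FactRing_def set_add_def')
  qed (use coset[of "\<one>\<^bsub>R\<^esub>"] one in \<open>simp add: FactRing_def\<close>)
  moreover have "bij_betw ?\<psi> (carrier (R Quot nilrad R)) (carrier (S Quot nilrad S))"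
  proof (rule bij_betw_imageI)
    show "inj_on ?\<psi> (carrier (R Quot nilrad R))"
    proof (rule inj_onI)
      fix A C assume "A \<in> carrier (R Quot nilrad R)" "C \<in> carrier (R Quot nilrad R)" and eq: "\<rho> ` A = \<rho> ` C"
      then obtain x y where xy: "x \<in> carrier R" "A = nilrad R +>\<^bsub>R\<^esub> x" "y \<in> carrier R" "C = nilrad R +>\<^bsub>R\<^esub> y"
        unfolding carR by auto
      show "A = C"
      proof safe
        fix a assume "a \<in> A"
        then have "a \<in> carrier R" "\<rho> a \<in> \<rho> ` C" using sub xy eq by auto
        then show "a \<in> C" using recover xy coset by simp
      next
        fix a assume "a \<in> C"
        then have "a \<in> carrier R" "\<rho> a \<in> \<rho> ` A" using sub xy eq by auto
        then show "a \<in> A" using recover xy coset by simp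
      qed
    qed
    show "?\<psi> ` carrier (R Quot nilrad R) = carrier (S Quot nilrad S)"
    proof safe
      fix A assume "A \<in> carrier (R Quot nilrad R)"
      then obtain x where "x \<in> carrier R" "A = nilrad R +>\<^bsub>R\<^esub> x" unfolding carR by blast
      then have "\<rho> ` A = nilrad S +>\<^bsub>S\<^esub> \<rho> x" "\<rho> x \<in> carrier S" using coset closed by simp_all
      then show "\<rho> ` A \<in> carrier (S Quot nilrad S)" unfolding carS by blast
    next
      fix B assume "B \<in> carrier (S Quot nilrad S)"
      then obtain x where "x \<in> carrier S" "B = nilrad S +>\<^bsub>S\<^esub> x" unfolding carS by blast
      moreover from this have "x \<in> \<rho> ` carrier R" using surj by simp
      ultimately obtain y where y: "y \<in> carrier R" "B = nilrad S +>\<^bsub>S\<^esub> \<rho> y" by blast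
      then have "B = \<rho> ` (nilrad R +>\<^bsub>R\<^esub> y)" using coset by simp
      then show "B \<in> ?\<psi> ` carrier (R Quot nilrad R)" unfolding carR using y by blast
    qed
  qed
  ultimately show ?thesis using coset unfolding ring_iso_def by blast
qed

section \<open>Restriction as a ring homomorphism\<close>

context fp_hom
begin

lemma res_cls_eq: "\<lbrakk>z \<in> G.Z; f \<in> P.Z; ceq p P (\<lambda>xs. z (map \<phi> xs)) f\<rbrakk> \<Longrightarrow> res p P \<phi> (G.cls z) = P.cls f"
proof -
  assume *: "z \<in> G.Z" "f \<in> P.Z" "ceq p P (\<lambda>xs. z (map \<phi> xs)) f"
  have "ceq p P (pullback P \<phi> z) (\<lambda>xs. f xs + P.d (\<lambda>_. 0) xs)"
    using ceq_trans[OF pullback_ceq *(3)] by simp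
  then have "P.cls (pullback P \<phi> z) = P.cls f" using * by (intro P.cls_eqI pullback_cocycle)
  then show ?thesis using * by (simp add: res_cls)
qed

lemma res_closed: "x \<in> carrier G.H \<Longrightarrow> res p P \<phi> x \<in> carrier P.H"
  by (auto simp: G.carrier_H res_cls intro!: P.cls_in_H pullback_cocycle)

lemma res_add:
  assumes "x \<in> carrier G.H" "y \<in> carrier G.H"
  shows "res p P \<phi> (x \<oplus>\<^bsub>G.H\<^esub> y) = res p P \<phi> x \<oplus>\<^bsub>P.H\<^esub> res p P \<phi> y"
proof -
  obtain f g where fg: "f \<in> G.Z" "g \<in> G.Z" "x = G.cls f" "y = G.cls g" using assms by (auto simp: G.carrier_H)
  have "res p P \<phi> (x \<oplus>\<^bsub>G.H\<^esub> y) = P.cls (\<lambda>xs. (pullback P \<phi> f xs + pullback P \<phi> g xs) mod int p)"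
    unfolding fg(3,4) G.cls_add[OF fg(1,2)] using fg
    by (intro res_cls_eq G.add_cocycle P.add_cocycle pullback_cocycle) (auto simp: ceq_def pullback_def)
  then show ?thesis using fg by (simp add: res_cls P.cls_add pullback_cocycle)
qed

lemma res_mult:
  assumes "x \<in> carrier G.H" "y \<in> carrier G.H"
  shows "res p P \<phi> (x \<otimes>\<^bsub>G.H\<^esub> y) = res p P \<phi> x \<otimes>\<^bsub>P.H\<^esub> res p P \<phi> y"
proof -
  obtain f g where fg: "f \<in> G.Z" "g \<in> G.Z" "x = G.cls f" "y = G.cls g" using assms by (auto simp: G.carrier_H)
  have "ceq p P (\<lambda>xs. cup p f g (map \<phi> xs)) (cp (\<lambda>xs. f (map \<phi> xs)) (\<lambda>xs. g (map \<phi> xs)))"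
    by (simp add: ceq_def cup_eq cp_map mod_dvd_diff)
  also have "ceq p P \<dots> (cp (pullback P \<phi> f) (pullback P \<phi> g))"
    by (intro ceq_cp ceq_sym[OF pullback_ceq])
  also have "ceq p P \<dots> (cup p (pullback P \<phi> f) (pullback P \<phi> g))" by (rule ceq_sym[OF ceq_cup])
  finally have "res p P \<phi> (x \<otimes>\<^bsub>G.H\<^esub> y) = P.cls (cup p (pullback P \<phi> f) (pullback P \<phi> g))"
    unfolding fg(3,4) G.cls_mult[OF fg(1,2)] using fg
    by (intro res_cls_eq G.cup_cocycle P.cup_cocycle pullback_cocycle)
  then show ?thesis using fg by (simp add: res_cls P.cls_mult pullback_cocycle)
qed

lemma res_one: "res p P \<phi> \<one>\<^bsub>G.H\<^esub> = \<one>\<^bsub>P.H\<^esub>"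
  unfolding G.one_H P.one_H by (intro res_cls_eq G.one_cocycle P.one_cocycle) (simp add: ceq_def)

lemma res_zero: "res p P \<phi> \<zero>\<^bsub>G.H\<^esub> = \<zero>\<^bsub>P.H\<^esub>"
  unfolding G.zero_H P.zero_H by (intro res_cls_eq G.zero_cocycle P.zero_cocycle) simp

lemma res_eq_iff:
  assumes "z \<in> G.Z" "f \<in> P.Z"
  shows "res p P \<phi> (G.cls z) = P.cls f \<longleftrightarrow> (\<exists>h. ceq p P (\<lambda>xs. z (map \<phi> xs)) (\<lambda>xs. f xs + P.d h xs))"
proof -
  have "ceq p P (pullback P \<phi> z) g \<longleftrightarrow> ceq p P (\<lambda>xs. z (map \<phi> xs)) g" for g
    using pullback_ceq[of z] by (meson ceq_sym ceq_trans)
  then show ?thesis using assms by (simp add: res_cls P.cls_eq_iff pullback_cocycle)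
qed

end

text \<open>The coordinates identify Y with Q times a set of representatives, for either action.
  Counting shows that the two sets of representatives have the same size, and any bijection between
  them extends equivariantly.\<close>

lemma free_actions_isomorphic:
  assumes "group Q" "finite Y"
    and a_closed: "\<And>q y. \<lbrakk>q \<in> carrier Q; y \<in> Y\<rbrakk> \<Longrightarrow> a q y \<in> Y"
    and a_mult: "\<And>q r y. \<lbrakk>q \<in> carrier Q; r \<in> carrier Q; y \<in> Y\<rbrakk> \<Longrightarrow> a (q \<otimes>\<^bsub>Q\<^esub> r) y = a q (a r y)"
    and a_one: "\<And>y. y \<in> Y \<Longrightarrow> a \<one>\<^bsub>Q\<^esub> y = y"
    and a_free: "\<And>q y. \<lbrakk>q \<in> carrier Q; y \<in> Y; a q y = y\<rbrakk> \<Longrightarrow> q = \<one>\<^bsub>Q\<^esub>"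
    and a'_closed: "\<And>q y. \<lbrakk>q \<in> carrier Q; y \<in> Y\<rbrakk> \<Longrightarrow> a' q y \<in> Y"
    and a'_mult: "\<And>q r y. \<lbrakk>q \<in> carrier Q; r \<in> carrier Q; y \<in> Y\<rbrakk> \<Longrightarrow> a' (q \<otimes>\<^bsub>Q\<^esub> r) y = a' q (a' r y)"
    and a'_one: "\<And>y. y \<in> Y \<Longrightarrow> a' \<one>\<^bsub>Q\<^esub> y = y"
    and a'_free: "\<And>q y. \<lbrakk>q \<in> carrier Q; y \<in> Y; a' q y = y\<rbrakk> \<Longrightarrow> q = \<one>\<^bsub>Q\<^esub>"
  shows "\<exists>k. bij_betw k Y Y \<and> (\<forall>q\<in>carrier Q. \<forall>x\<in>Y. k (a q x) = a' q (k x))"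
proof (cases "Y = {}")
  case False
  then obtain x\<^sub>0 where x\<^sub>0: "x\<^sub>0 \<in> Y" by blast
  interpret Q: group Q by fact
  obtain \<kappa> where \<kappa>: "\<And>y. y \<in> Y \<Longrightarrow> \<kappa> y \<in> carrier Q"
      "\<And>q y. \<lbrakk>q \<in> carrier Q; y \<in> Y\<rbrakk> \<Longrightarrow> \<kappa> (a q y) = q \<otimes>\<^bsub>Q\<^esub> \<kappa> y" "\<kappa> x\<^sub>0 = \<one>\<^bsub>Q\<^esub>"
    by (rule free_action_equivariant_map[of Q Y a x\<^sub>0])
      (assumption | rule assms(1) a_closed a_mult a_one a_free x\<^sub>0 | blast)+
  obtain \<kappa>' where \<kappa>': "\<And>y. y \<in> Y \<Longrightarrow> \<kappa>' y \<in> carrier Q"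
      "\<And>q y. \<lbrakk>q \<in> carrier Q; y \<in> Y\<rbrakk> \<Longrightarrow> \<kappa>' (a' q y) = q \<otimes>\<^bsub>Q\<^esub> \<kappa>' y" "\<kappa>' x\<^sub>0 = \<one>\<^bsub>Q\<^esub>"
    by (rule free_action_equivariant_map[of Q Y a' x\<^sub>0])
      (assumption | rule assms(1) a'_closed a'_mult a'_one a'_free x\<^sub>0 | blast)+
  define T where "T = {x \<in> Y. \<kappa> x = \<one>\<^bsub>Q\<^esub>}"
  define T' where "T' = {x \<in> Y. \<kappa>' x = \<one>\<^bsub>Q\<^esub>}"
  have card_X: "card Y = card (carrier Q) * card {x \<in> Y. \<mu> x = \<one>\<^bsub>Q\<^esub>}"
    if \<mu>: "\<And>y. y \<in> Y \<Longrightarrow> \<mu> y \<in> carrier Q" "\<And>q y. \<lbrakk>q \<in> carrier Q; y \<in> Y\<rbrakk> \<Longrightarrow> \<mu> (b q y) = q \<otimes>\<^bsub>Q\<^esub> \<mu> y"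
      and b: "\<And>q y. \<lbrakk>q \<in> carrier Q; y \<in> Y\<rbrakk> \<Longrightarrow> b q y \<in> Y"
        "\<And>q r y. \<lbrakk>q \<in> carrier Q; r \<in> carrier Q; y \<in> Y\<rbrakk> \<Longrightarrow> b (q \<otimes>\<^bsub>Q\<^esub> r) y = b q (b r y)"
        "\<And>y. y \<in> Y \<Longrightarrow> b \<one>\<^bsub>Q\<^esub> y = y" for \<mu> b
  proof -
    have "bij_betw (\<lambda>(q, x). b q x) (carrier Q \<times> {x \<in> Y. \<mu> x = \<one>\<^bsub>Q\<^esub>}) Y"
    proof (rule bij_betw_byWitness[where f' = "\<lambda>x. (\<mu> x, b (inv\<^bsub>Q\<^esub> (\<mu> x)) x)"])
      show "\<forall>z\<in>carrier Q \<times> {x \<in> Y. \<mu> x = \<one>\<^bsub>Q\<^esub>}.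
          (\<lambda>x. (\<mu> x, b (inv\<^bsub>Q\<^esub> (\<mu> x)) x)) (case z of (q, x) \<Rightarrow> b q x) = z"
        using \<mu> b(3) by (auto simp flip: b(2))
      show "\<forall>x\<in>Y. (case (\<mu> x, b (inv\<^bsub>Q\<^esub> (\<mu> x)) x) of (q, x) \<Rightarrow> b q x) = x"
        using \<mu> b(3) by (auto simp flip: b(2))
    qed (use \<mu> b(1) in auto)
    from bij_betw_same_card[OF this] show ?thesis by (simp only: card_cartesian_product)
  qed
  have card_T: "card Y = card (carrier Q) * card T"
    unfolding T_def by (rule card_X[where b = a]) (assumption | rule \<kappa> a_closed a_mult a_one)+
  have "card Y = card (carrier Q) * card T'"
    unfolding T'_def by (rule card_X[where b = a']) (assumption | rule \<kappa>' a'_closed a'_mult a'_one)+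
  then have "card (carrier Q) * card T = card (carrier Q) * card T'" using card_T by simp
  moreover have "card Y \<noteq> 0" using False assms(2) by simp
  then have "card (carrier Q) \<noteq> 0" using card_T by auto
  ultimately have "card T = card T'" by simp
  moreover have "finite T" "finite T'" using assms(2) by (auto simp: T_def T'_def)
  ultimately obtain h where h: "bij_betw h T T'" using finite_same_card_bij by blast
  define t where "t x = a (inv\<^bsub>Q\<^esub> (\<kappa> x)) x" for x
  have t: "t x \<in> T" if "x \<in> Y" for x using that \<kappa> a_closed by (auto simp: T_def t_def)
  have ht: "h (t x) \<in> Y" "\<kappa>' (h (t x)) = \<one>\<^bsub>Q\<^esub>" if "x \<in> Y" for x
    using bij_betwE[OF h] t[OF that] by (auto simp: T'_def)
  have at: "a (\<kappa> x) (t x) = x" if "x \<in> Y" for x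
    using that \<kappa> a_one by (simp add: t_def flip: a_mult)
  \<comment> \<open>The coordinate in Q is kept, the representative is moved by
    \<open>h\<close>.\<close>
  define k where "k x = a' (\<kappa> x) (h (t x))" for x
  have \<kappa>'k: "\<kappa>' (k x) = \<kappa> x" if "x \<in> Y" for x using that ht \<kappa> \<kappa>' by (simp add: k_def)
  have "inj_on k Y"
  proof (rule inj_onI)
    fix x y assume xy: "x \<in> Y" "y \<in> Y" "k x = k y"
    then have eq: "\<kappa> x = \<kappa> y" using \<kappa>'k by metis
    have "h (t z) = a' (inv\<^bsub>Q\<^esub> (\<kappa> z)) (k z)" if "z \<in> Y" for z
      using that \<kappa> ht a'_one by (simp add: k_def flip: a'_mult)
    then have "h (t x) = h (t y)" using xy eq by simp
    then have "t x = t y" using h t xy by (meson bij_betw_imp_inj_on inj_onD)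
    then show "x = y" using at xy eq by metis
  qed
  moreover have "k ` Y \<subseteq> Y" using ht \<kappa> a'_closed by (auto simp: k_def)
  ultimately have "bij_betw k Y Y" using assms(2) by (simp add: bij_betw_def endo_inj_surj)
  moreover have "k (a q x) = a' q (k x)" if "q \<in> carrier Q" "x \<in> Y" for q x
  proof -
    have "t (a q x) = t x"
      using that \<kappa> by (simp add: t_def a_closed Q.inv_mult_group Q.m_assoc flip: a_mult)
    then show ?thesis using that \<kappa> ht by (simp add: k_def a'_mult)
  qed
  ultimately show ?thesis by blast
qed (auto simp: bij_betw_def)

text \<open>In the bar complex of a trivial group the differential is alternately zero and the
  identity. A cocycle therefore vanishes modulo \<open>p\<close> in odd degrees and is a coboundary
  in positive even degrees. This compares the cocycle of an object with the degree-0 cocycle at the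
  base vertex.\<close>

lemma trivial_group_cohomology:
  assumes "group T" "carrier T = {e}" and cocycle: "ceq p T (cob T f) (\<lambda>_. 0)"
  shows "\<exists>y. ceq p T f (\<lambda>xs. (if xs = [] then f [] else 0) + cob T y xs)"
proof -
  interpret T: group T by fact
  have e: "e \<otimes>\<^bsub>T\<^esub> e = e" using assms(2) T.m_closed[of e e] by simp
  have bar: "bar T g (replicate (Suc n) e) = (if even n then - g (replicate n e) else 0)" for g n
    by (induction n arbitrary: g) (auto simp: e)
  have cob: "cob T g (replicate (Suc n) e) = (if even n then 0 else g (replicate n e))" for g n
    using bar[of g n] by (auto simp: cob_Cons simp del: bar.simps)
  \<comment> \<open>Odd degrees are those on which the differential is the identity.\<close>
  let ?y = "\<lambda>xs. if odd (length xs) then f (e # xs) else 0"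
  have "int p dvd f xs - ((if xs = [] then f [] else 0) + cob T ?y xs)" if xs: "set xs \<subseteq> carrier T" for xs
  proof (cases "length xs")
    case (Suc n)
    have rep: "xs = replicate (Suc n) e" using xs Suc assms(2) by (intro replicate_eqI) auto
    show ?thesis
    proof (cases "even n")
      case True
      have "int p dvd cob T f (e # xs) - 0"
        using cocycle xs assms(2) unfolding ceq_def by (metis insert_subset list.simps(15) singletonI)
      moreover have "cob T f (e # xs) = f xs" using cob[of f "Suc n"] True by (simp add: rep)
      ultimately show ?thesis using True cob[of ?y n] rep by simp
    next
      case False
      then show ?thesis using cob[of ?y n] rep by simp
    qed
  qed simp
  then show ?thesis by (intro exI[of _ ?y]) (simp add: ceq_def)
qed

section \<open>Realising the limit\<close>

locale finite_group_category =
  fixes p :: nat and Obj :: "'i set" and G :: "'i \<Rightarrow> 'a monoid" and Mor :: "'i \<Rightarrow> 'i \<Rightarrow> ('a \<Rightarrow> 'a) set"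
  assumes prime: "Factorial_Ring.prime p"
    and category: "finite_inj_group_category Obj G Mor"
    and connected: "connected_category Obj Mor"
begin

lemma finite_Obj: "finite Obj"
  and G_group: "i \<in> Obj \<Longrightarrow> group (G i)"
  and G_finite: "i \<in> Obj \<Longrightarrow> finite (carrier (G i))"
  and Mor_finite: "\<lbrakk>i \<in> Obj; j \<in> Obj\<rbrakk> \<Longrightarrow> finite (Mor i j)"
  and Mor_hom: "\<lbrakk>i \<in> Obj; j \<in> Obj; f \<in> Mor i j\<rbrakk> \<Longrightarrow> f \<in> hom (G i) (G j)"
  and Mor_inj: "\<lbrakk>i \<in> Obj; j \<in> Obj; f \<in> Mor i j\<rbrakk> \<Longrightarrow> inj_on f (carrier (G i))"
  using category unfolding finite_inj_group_category_def by blast+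

lemma p_gt_1: "1 < p"
  using prime by (rule prime_gt_1_nat)

text \<open>The base vertex belongs to no object; its degree-0 value and the vanishing of classes
  there are borrowed from this one.\<close>

definition i\<^sub>0 where "i\<^sub>0 = (SOME i. i \<in> Obj)"

lemma i\<^sub>0 [simp]: "i\<^sub>0 \<in> Obj"
  using connected unfolding i\<^sub>0_def connected_category_def by (meson ex_in_conv someI_ex)

section \<open>The symmetric group of the product\<close>

definition Y where "Y = (\<Pi>\<^sub>E i\<in>Obj. carrier (G i))"
definition K where "K = BijGroup Y"
definition act where "act i q x = x(i := q \<otimes>\<^bsub>G i\<^esub> x i)"
definition translation where "translation i q = restrict (act i q) Y"

lemma Y_finite: "finite Y"
  unfolding Y_def using finite_Obj G_finite by (intro finite_PiE) auto

lemma Y_nonempty: "Y \<noteq> {}"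
  unfolding Y_def PiE_eq_empty_iff using G_group group.is_monoid monoid.one_closed by blast

lemma Y_component: "\<lbrakk>x \<in> Y; i \<in> Obj\<rbrakk> \<Longrightarrow> x i \<in> carrier (G i)"
  by (auto simp: Y_def)

lemma act_closed: "\<lbrakk>i \<in> Obj; q \<in> carrier (G i); x \<in> Y\<rbrakk> \<Longrightarrow> act i q x \<in> Y"
  using G_group[of i] by (auto simp: act_def Y_def PiE_iff extensional_def group.is_monoid monoid.m_closed)

lemma act_mult: "\<lbrakk>i \<in> Obj; q \<in> carrier (G i); r \<in> carrier (G i); x \<in> Y\<rbrakk> \<Longrightarrow>
    act i (q \<otimes>\<^bsub>G i\<^esub> r) x = act i q (act i r x)"
  using G_group[of i] Y_component[of x i] by (simp add: act_def group.is_monoid monoid.m_assoc)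

lemma act_one: "\<lbrakk>i \<in> Obj; x \<in> Y\<rbrakk> \<Longrightarrow> act i \<one>\<^bsub>G i\<^esub> x = x"
  using G_group[of i] Y_component[of x i] by (simp add: act_def group.is_monoid monoid.l_one)

lemma act_free: "\<lbrakk>i \<in> Obj; q \<in> carrier (G i); x \<in> Y; act i q x = x\<rbrakk> \<Longrightarrow> q = \<one>\<^bsub>G i\<^esub>"
proof -
  assume *: "i \<in> Obj" "q \<in> carrier (G i)" "x \<in> Y" "act i q x = x"
  interpret group "G i" using * G_group by blast
  have "q \<otimes>\<^bsub>G i\<^esub> x i = x i" using fun_cong[OF *(4), of i] by (simp add: act_def)
  then show ?thesis using * Y_component[of x i] by (metis r_cancel_one)
qed

lemma K_group: "group K"
  by (simp add: K_def group_BijGroup)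

lemma K_finite: "finite (carrier K)"
proof -
  have "Bij Y \<subseteq> (\<Pi>\<^sub>E x\<in>Y. Y)"
    by (auto simp: PiE_def Bij_imp_extensional dest: Bij_imp_funcset)
  then show ?thesis
    using Y_finite finite_PiE[of Y "\<lambda>_. Y"] by (simp add: K_def BijGroup_def finite_subset)
qed

lemma K_mult: "\<lbrakk>f \<in> carrier K; g \<in> carrier K\<rbrakk> \<Longrightarrow> f \<otimes>\<^bsub>K\<^esub> g = compose Y f g"
  by (simp add: K_def BijGroup_def)

lemma translation_closed [simp]:
  assumes "i \<in> Obj" "q \<in> carrier (G i)"
  shows "translation i q \<in> carrier K"
proof -
  interpret group "G i" using assms G_group by blast
  have "bij_betw (act i q) Y Y"
  proof (rule bij_betw_byWitness[where f' = "act i (inv\<^bsub>G i\<^esub> q)"])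
    show "\<forall>x\<in>Y. act i (inv\<^bsub>G i\<^esub> q) (act i q x) = x" "\<forall>x\<in>Y. act i q (act i (inv\<^bsub>G i\<^esub> q) x) = x"
      using assms by (simp_all add: act_one flip: act_mult)
  qed (use assms act_closed in auto)
  then show ?thesis
    by (simp add: K_def BijGroup_def Bij_def translation_def cong: bij_betw_cong)
qed

lemma translation_hom:
  assumes "i \<in> Obj"
  shows "translation i \<in> hom (G i) K"
proof (rule homI)
  fix q r assume *: "q \<in> carrier (G i)" "r \<in> carrier (G i)"
  have "translation i (q \<otimes>\<^bsub>G i\<^esub> r) = compose Y (translation i q) (translation i r)"
    using * assms by (auto simp: translation_def compose_def fun_eq_iff act_mult act_closed)
  then show "translation i (q \<otimes>\<^bsub>G i\<^esub> r) = translation i q \<otimes>\<^bsub>K\<^esub> translation i r"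
    using * assms by (simp add: K_mult)
qed (use assms in simp)

lemma translation_inj: "i \<in> Obj \<Longrightarrow> inj_on (translation i) (carrier (G i))"
proof (rule inj_onI)
  fix q r assume *: "i \<in> Obj" "q \<in> carrier (G i)" "r \<in> carrier (G i)" "translation i q = translation i r"
  interpret group "G i" using * G_group by blast
  obtain x where x: "x \<in> Y" using Y_nonempty by blast
  have "act i q x i = act i r x i" using fun_cong[OF *(4), of x] x by (simp add: translation_def)
  then show "q = r" using * x Y_component[of x i] by (simp add: act_def)
qed

text \<open>The source acts on Y by its own translations and, through \<open>f\<close>, by those of
  the target. Injectivity of \<open>f\<close> makes the second action free as well, and a conjugator
  is an isomorphism between the two.\<close>

lemma conjugator_exists:
  assumes "i \<in> Obj" "j \<in> Obj" "f \<in> Mor i j"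
  shows "\<exists>k\<in>carrier K. \<forall>q\<in>carrier (G i). k \<otimes>\<^bsub>K\<^esub> translation i q = translation j (f q) \<otimes>\<^bsub>K\<^esub> k"
proof -
  have fh: "f \<in> hom (G i) (G j)" and finj: "inj_on f (carrier (G i))"
    using assms Mor_hom Mor_inj by blast+
  interpret f: group_hom "G i" "G j" f
    using assms fh G_group by (simp add: group_hom_def group_hom_axioms_def)
  have "\<exists>k. bij_betw k Y Y \<and> (\<forall>q\<in>carrier (G i). \<forall>x\<in>Y. k (act i q x) = act j (f q) (k x))"
  proof (rule free_actions_isomorphic)
    fix q x assume *: "q \<in> carrier (G i)" "x \<in> Y" "act j (f q) x = x"
    then have "f q = \<one>\<^bsub>G j\<^esub>" using act_free[of j "f q" x] assms by simp
    then have "f q = f \<one>\<^bsub>G i\<^esub>" by simp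
    then show "q = \<one>\<^bsub>G i\<^esub>" using * finj by (meson inj_onD f.G.one_closed)
  qed (use assms act_closed act_mult act_one act_free Y_finite f.G.group_axioms in simp_all)
  then obtain k where k: "bij_betw k Y Y" "\<And>q x. \<lbrakk>q \<in> carrier (G i); x \<in> Y\<rbrakk> \<Longrightarrow> k (act i q x) = act j (f q) (k x)"
    by blast
  have kK: "restrict k Y \<in> carrier K"
    using k(1) by (simp add: K_def BijGroup_def Bij_def cong: bij_betw_cong)
  moreover have "restrict k Y \<otimes>\<^bsub>K\<^esub> translation i q = translation j (f q) \<otimes>\<^bsub>K\<^esub> restrict k Y"
    if q: "q \<in> carrier (G i)" for q
  proof -
    have "compose Y (restrict k Y) (translation i q) = compose Y (translation j (f q)) (restrict k Y)"
      using q assms(1) bij_betwE[OF k(1)] k(2)[OF q] by (intro ext) (auto simp: compose_def translation_def act_closed)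
    moreover have "translation i q \<in> carrier K" "translation j (f q) \<in> carrier K"
      using q assms by simp_all
    ultimately show ?thesis using kK by (simp add: K_mult)
  qed
  ultimately show ?thesis by blast
qed

definition conjugator where
  "conjugator i j f = (SOME k. k \<in> carrier K \<and>
    (\<forall>q\<in>carrier (G i). k \<otimes>\<^bsub>K\<^esub> translation i q = translation j (f q) \<otimes>\<^bsub>K\<^esub> k))"

lemma conjugator:
  assumes "i \<in> Obj" "j \<in> Obj" "f \<in> Mor i j"
  shows "conjugator i j f \<in> carrier K"
    "q \<in> carrier (G i) \<Longrightarrow> conjugator i j f \<otimes>\<^bsub>K\<^esub> translation i q = translation j (f q) \<otimes>\<^bsub>K\<^esub> conjugator i j f"
proof -
  have "\<exists>k. k \<in> carrier K \<and> (\<forall>q\<in>carrier (G i). k \<otimes>\<^bsub>K\<^esub> translation i q = translation j (f q) \<otimes>\<^bsub>K\<^esub> k)"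
    using conjugator_exists[OF assms] by blast
  from someI_ex[OF this, folded conjugator_def]
  show "conjugator i j f \<in> carrier K"
    "q \<in> carrier (G i) \<Longrightarrow> conjugator i j f \<otimes>\<^bsub>K\<^esub> translation i q = translation j (f q) \<otimes>\<^bsub>K\<^esub> conjugator i j f"
    by blast+
qed

text \<open>The vertex \<open>None\<close> is the base vertex, and the edges \<open>Inr \<sigma>\<close> are loops there.\<close>

definition T :: "'a monoid" where "T = \<lparr>carrier = {undefined}, monoid.mult = (\<lambda>_ _. undefined), one = undefined\<rparr>"

lemma T_group: "group T"
  by (rule groupI) (auto simp: T_def)

definition V where "V = insert None (Some ` Obj)"
definition P where "P = case_option T G"
definition E where
  "E = Inl ` {(i, j, f). i \<in> Obj \<and> j \<in> Obj \<and> f \<in> Mor i j} \<union> Inr ` (carrier K - {\<one>\<^bsub>K\<^esub>})"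
definition src :: "('i \<times> 'i \<times> ('a \<Rightarrow> 'a)) + (('i \<Rightarrow> 'a) \<Rightarrow> ('i \<Rightarrow> 'a)) \<Rightarrow> 'i option" where
  "src = case_sum (\<lambda>(i, j, f). Some i) (\<lambda>_. None)"
definition tgt :: "('i \<times> 'i \<times> ('a \<Rightarrow> 'a)) + (('i \<Rightarrow> 'a) \<Rightarrow> ('i \<Rightarrow> 'a)) \<Rightarrow> 'i option" where
  "tgt = case_sum (\<lambda>(i, j, f). Some j) (\<lambda>_. None)"
definition \<phi> :: "('i \<times> 'i \<times> ('a \<Rightarrow> 'a)) + (('i \<Rightarrow> 'a) \<Rightarrow> ('i \<Rightarrow> 'a)) \<Rightarrow> 'a \<Rightarrow> 'a" where
  "\<phi> = case_sum (\<lambda>(i, j, f). f) (\<lambda>_ _. undefined)"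

lemma P_simps [simp]: "P None = T" "P (Some i) = G i"
  by (simp_all add: P_def)

lemma T_simps [simp]: "carrier T = {undefined}" "\<one>\<^bsub>T\<^esub> = undefined" "x \<otimes>\<^bsub>T\<^esub> y = undefined"
  by (simp_all add: T_def)

lemma edge_cases [consumes 1, case_names mor loop]:
  assumes "e \<in> E"
  obtains i j f where "e = Inl (i, j, f)" "i \<in> Obj" "j \<in> Obj" "f \<in> Mor i j"
  | \<sigma> where "e = Inr \<sigma>" "\<sigma> \<in> carrier K" "\<sigma> \<noteq> \<one>\<^bsub>K\<^esub>"
  using assms by (auto simp: E_def)

lemma edge_simps [simp]:
  "src (Inl (i, j, f)) = Some i" "tgt (Inl (i, j, f)) = Some j" "\<phi> (Inl (i, j, f)) = f"
  "src (Inr \<sigma>) = None" "tgt (Inr \<sigma>) = None" "\<phi> (Inr \<sigma>) = (\<lambda>_. undefined)"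
  by (simp_all add: src_def tgt_def \<phi>_def)

lemma P_group: "v \<in> V \<Longrightarrow> group (P v)"
  by (auto simp: V_def T_group G_group)

sublocale group_graph V P E src tgt \<phi>
proof (rule group_graph.intro)
  show "finite V" by (simp add: V_def finite_Obj)
  have "finite (SIGMA i:Obj. SIGMA j:Obj. Mor i j)"
    using finite_Obj Mor_finite by (intro finite_SigmaI) auto
  moreover have "{(i, j, f). i \<in> Obj \<and> j \<in> Obj \<and> f \<in> Mor i j} = (SIGMA i:Obj. SIGMA j:Obj. Mor i j)"
    by auto
  ultimately show "finite E" using K_finite by (simp add: E_def)
  show "finite (carrier (P v))" if "v \<in> V" for v using that by (auto simp: V_def G_finite)
next
  fix e assume e: "e \<in> E"
  then show "src e \<in> V" "tgt e \<in> V" by (cases rule: edge_cases; simp add: V_def)+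
  show "\<phi> e \<in> hom (P (src e)) (P (tgt e))"
    using e by (cases rule: edge_cases) (auto simp: Mor_hom, simp add: hom_def)
qed (rule P_group)

text \<open>Existence sends the letter of a morphism to its conjugator. Only the values on the
  groups, for injectivity, and on the loops, for the transversal, are recorded.\<close>

definition \<pi> where
  "\<pi> = (SOME \<pi>. \<pi> \<in> hom \<Gamma> K \<and> (\<forall>i\<in>Obj. \<forall>q\<in>carrier (G i). \<pi> (\<iota> (Some i) q) = translation i q) \<and>
    (\<forall>\<sigma>\<in>carrier K. \<sigma> \<noteq> \<one>\<^bsub>K\<^esub> \<longrightarrow> \<pi> (\<tau> (Inr \<sigma>)) = \<sigma>))"

lemma \<pi>: "\<pi> \<in> hom \<Gamma> K"
  "\<lbrakk>i \<in> Obj; q \<in> carrier (G i)\<rbrakk> \<Longrightarrow> \<pi> (\<iota> (Some i) q) = translation i q"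
  "\<lbrakk>\<sigma> \<in> carrier K; \<sigma> \<noteq> \<one>\<^bsub>K\<^esub>\<rbrakk> \<Longrightarrow> \<pi> (\<tau> (Inr \<sigma>)) = \<sigma>"
proof -
  interpret K: group K by (rule K_group)
  let ?j = "case_option (\<lambda>_. \<one>\<^bsub>K\<^esub>) translation"
  let ?k = "case_sum (\<lambda>(i, j, f). conjugator i j f) (\<lambda>\<sigma>. \<sigma>)"
  have "\<exists>\<pi>\<in>hom \<Gamma> K. (\<forall>v\<in>V. \<forall>q\<in>carrier (P v). \<pi> (\<iota> v q) = ?j v q) \<and> (\<forall>e\<in>E. \<pi> (\<tau> e) = ?k e)"
  proof (rule hom_extends[OF K_group])
    show "?j v \<in> hom (P v) K" if "v \<in> V" for v
      using that by (auto simp: V_def translation_hom) (simp add: hom_def)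
    fix e assume e: "e \<in> E"
    then show "?k e \<in> carrier K" by (cases rule: edge_cases) (auto simp: conjugator)
    fix a assume a: "a \<in> carrier (P (src e))"
    with e show "?k e \<otimes>\<^bsub>K\<^esub> ?j (src e) a = ?j (tgt e) (\<phi> e a) \<otimes>\<^bsub>K\<^esub> ?k e"
      by (cases rule: edge_cases) (auto simp: conjugator)
  qed
  then have "\<exists>\<pi>. \<pi> \<in> hom \<Gamma> K \<and> (\<forall>i\<in>Obj. \<forall>q\<in>carrier (G i). \<pi> (\<iota> (Some i) q) = translation i q) \<and>
    (\<forall>\<sigma>\<in>carrier K. \<sigma> \<noteq> \<one>\<^bsub>K\<^esub> \<longrightarrow> \<pi> (\<tau> (Inr \<sigma>)) = \<sigma>)"
  proof (elim bexE conjE, intro exI conjI ballI impI)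
    fix \<pi> assume *: "\<pi> \<in> hom \<Gamma> K" "\<forall>v\<in>V. \<forall>q\<in>carrier (P v). \<pi> (\<iota> v q) = ?j v q" "\<forall>e\<in>E. \<pi> (\<tau> e) = ?k e"
    show "\<pi> \<in> hom \<Gamma> K" by (rule *)
    show "\<pi> (\<iota> (Some i) q) = translation i q" if "i \<in> Obj" "q \<in> carrier (G i)" for i q
      using *(2)[rule_format, of "Some i" q] that by (simp add: V_def)
    show "\<pi> (\<tau> (Inr \<sigma>)) = \<sigma>" if "\<sigma> \<in> carrier K" "\<sigma> \<noteq> \<one>\<^bsub>K\<^esub>" for \<sigma>
    proof -
      have "Inr \<sigma> \<in> E" using that by (simp add: E_def)
      then show ?thesis using *(3) by simp
    qed
  qed
  from someI_ex[OF this, folded \<pi>_def] show "\<pi> \<in> hom \<Gamma> K"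
    "\<lbrakk>i \<in> Obj; q \<in> carrier (G i)\<rbrakk> \<Longrightarrow> \<pi> (\<iota> (Some i) q) = translation i q"
    "\<lbrakk>\<sigma> \<in> carrier K; \<sigma> \<noteq> \<one>\<^bsub>K\<^esub>\<rbrakk> \<Longrightarrow> \<pi> (\<tau> (Inr \<sigma>)) = \<sigma>"
    by blast+
qed

lemma \<pi>_inj: "v \<in> V \<Longrightarrow> inj_on (\<lambda>q. \<pi> (\<iota> v q)) (carrier (P v))"
proof (cases v)
  case (Some i)
  moreover assume "v \<in> V"
  ultimately have "i \<in> Obj" by (auto simp: V_def)
  then show ?thesis using translation_inj[of i] Some by (auto simp: inj_on_def \<pi>)
qed simp

sublocale virtually_free_graph V P E src tgt \<phi> K None \<pi> Inr
proof (intro virtually_free_graph.intro virtually_free_graph_axioms.intro group_graph_axioms K_group K_finite \<pi>(1) \<pi>_inj)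
  fix \<sigma> assume "\<sigma> \<in> carrier K" "\<sigma> \<noteq> \<one>\<^bsub>K\<^esub>"
  moreover from this have "Inr \<sigma> \<in> E" by (simp add: E_def)
  ultimately show "Inr \<sigma> \<in> E \<and> src (Inr \<sigma>) = None \<and> tgt (Inr \<sigma>) = None \<and> \<pi> (\<tau> (Inr \<sigma>)) = \<sigma>"
    by (simp add: \<pi>)
qed (auto simp: V_def)

lemma \<iota>_inj:
  assumes "v \<in> V"
  shows "inj_on (\<iota> v) (carrier (P v))"
proof (rule inj_onI)
  fix q r assume *: "q \<in> carrier (P v)" "r \<in> carrier (P v)" "\<iota> v q = \<iota> v r"
  show "q = r" by (rule inj_onD[OF \<pi>_inj[OF assms]]) (use * in simp_all)
qed

sublocale based_group_graph V P E src tgt \<phi> None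
  by (intro based_group_graph.intro based_group_graph_axioms.intro group_graph_axioms \<iota>_inj)
    (auto simp: V_def)

sublocale coh: cohomology_graph \<Gamma> p V P \<iota> xedges xsrc xtgt x\<phi> x\<tau>
  using p_gt_1 by (rule cohomology_graph)

section \<open>The restriction map to the limit\<close>

abbreviation emb where "emb i \<equiv> \<iota> (Some i)"

lemma emb_hom: "i \<in> Obj \<Longrightarrow> emb i \<in> hom (G i) \<Gamma>"
  using \<iota>_hom[of "Some i"] by (simp add: V_def)

lemma emb_inj: "i \<in> Obj \<Longrightarrow> inj_on (emb i) (carrier (G i))"
  using \<iota>_inj[of "Some i"] by (simp add: V_def)

lemma G_fp_group: "i \<in> Obj \<Longrightarrow> fp_group (G i) p"
  by (intro fp_group.intro fp_group_axioms.intro G_group p_gt_1)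

lemma emb_fp_hom: "i \<in> Obj \<Longrightarrow> fp_hom (G i) \<Gamma> p (emb i)"
  by (simp add: fp_hom_def fp_hom_axioms_def G_fp_group coh.fp_group_axioms emb_hom)

lemma Mor_fp_hom: "\<lbrakk>i \<in> Obj; j \<in> Obj; f \<in> Mor i j\<rbrakk> \<Longrightarrow> fp_hom (G i) (G j) p f"
  by (simp add: fp_hom_def fp_hom_axioms_def G_fp_group Mor_hom)

lemma emb_conj:
  assumes "i \<in> Obj" "j \<in> Obj" "f \<in> Mor i j"
  shows "\<exists>\<gamma>\<in>carrier \<Gamma>. \<forall>q\<in>carrier (G i). emb j (f q) = \<gamma> \<otimes>\<^bsub>\<Gamma>\<^esub> emb i q \<otimes>\<^bsub>\<Gamma>\<^esub> inv\<^bsub>\<Gamma>\<^esub> \<gamma>"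
proof (intro bexI ballI)
  have e: "Inl (i, j, f) \<in> E" using assms by (auto simp: E_def)
  then show cl: "\<tau> (Inl (i, j, f)) \<in> carrier \<Gamma>" by simp
  fix q assume q: "q \<in> carrier (G i)"
  have "f q \<in> carrier (G j)" using Mor_hom[OF assms] q by (auto simp: hom_def)
  then have cl': "emb i q \<in> carrier \<Gamma>" "emb j (f q) \<in> carrier \<Gamma>"
    using q assms emb_hom by (auto simp: hom_def)
  have "\<tau> (Inl (i, j, f)) \<otimes>\<^bsub>\<Gamma>\<^esub> emb i q = emb j (f q) \<otimes>\<^bsub>\<Gamma>\<^esub> \<tau> (Inl (i, j, f))"
    using \<tau>_conj[OF e, of q] q by simp
  then show "emb j (f q) = \<tau> (Inl (i, j, f)) \<otimes>\<^bsub>\<Gamma>\<^esub> emb i q \<otimes>\<^bsub>\<Gamma>\<^esub> inv\<^bsub>\<Gamma>\<^esub> (\<tau> (Inl (i, j, f)))"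
    using cl cl' by (simp add: \<Gamma>.m_assoc)
qed

abbreviation "I \<equiv> compat_ring p Obj G Mor"
abbreviation "R \<equiv> rho p Obj G emb"
abbreviation "H\<Gamma> \<equiv> cohom_ring p \<Gamma>"

lemma I_simps [simp]:
  "carrier I = {x \<in> (\<Pi>\<^sub>E Q\<in>Obj. carrier (cohom_ring p (G Q))).
                   \<forall>Q\<in>Obj. \<forall>Q'\<in>Obj. \<forall>\<phi>\<in>Mor Q Q'. res p (G Q) \<phi> (x Q') = x Q}"
  "x \<otimes>\<^bsub>I\<^esub> y = (\<lambda>Q\<in>Obj. x Q \<otimes>\<^bsub>cohom_ring p (G Q)\<^esub> y Q)"
  "x \<oplus>\<^bsub>I\<^esub> y = (\<lambda>Q\<in>Obj. x Q \<oplus>\<^bsub>cohom_ring p (G Q)\<^esub> y Q)"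
  "\<one>\<^bsub>I\<^esub> = (\<lambda>Q\<in>Obj. \<one>\<^bsub>cohom_ring p (G Q)\<^esub>)"
  "\<zero>\<^bsub>I\<^esub> = (\<lambda>Q\<in>Obj. \<zero>\<^bsub>cohom_ring p (G Q)\<^esub>)"
  by (simp_all add: compat_ring_def)

text \<open>The embeddings of source and target differ along \<open>f\<close> by conjugation in
  Gamma, which changes a cocycle by a coboundary. \<open>conj_cohomologous\<close> conjugates in the
  opposite direction and is applied to the inverse of \<open>\<gamma>\<close>.\<close>

lemma rho_compatible:
  assumes "z \<in> coh.Z" "i \<in> Obj" "j \<in> Obj" "f \<in> Mor i j"
  shows "res p (G i) f (res p (G j) (emb j) (coh.cls z)) = res p (G i) (emb i) (coh.cls z)"
proof -
  interpret i: fp_hom "G i" \<Gamma> p "emb i" using assms by (intro emb_fp_hom)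
  interpret j: fp_hom "G j" \<Gamma> p "emb j" using assms by (intro emb_fp_hom)
  interpret f: fp_hom "G i" "G j" p f using assms by (intro Mor_fp_hom)
  obtain \<gamma> where \<gamma>: "\<gamma> \<in> carrier \<Gamma>"
    "\<And>q. q \<in> carrier (G i) \<Longrightarrow> emb j (f q) = \<gamma> \<otimes>\<^bsub>\<Gamma>\<^esub> emb i q \<otimes>\<^bsub>\<Gamma>\<^esub> inv\<^bsub>\<Gamma>\<^esub> \<gamma>"
    using emb_conj[OF assms(2-4)] by blast
  have "ceq p \<Gamma> (cob \<Gamma> z) (\<lambda>_. 0)" using assms(1) coh.cocycles_iff by blast
  then obtain h where h: "ceq p \<Gamma> (\<lambda>xs. z (map (\<lambda>x. inv\<^bsub>\<Gamma>\<^esub> (inv\<^bsub>\<Gamma>\<^esub> \<gamma>) \<otimes>\<^bsub>\<Gamma>\<^esub> x \<otimes>\<^bsub>\<Gamma>\<^esub> inv\<^bsub>\<Gamma>\<^esub> \<gamma>) xs)) (\<lambda>xs. z xs + cob \<Gamma> h xs)"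
    using coh.conj_cohomologous[of "inv\<^bsub>\<Gamma>\<^esub> \<gamma>" z] \<gamma>(1) by auto
  have "ceq p (G i) (\<lambda>xs. pullback (G j) (emb j) z (map f xs))
      (\<lambda>xs. pullback (G i) (emb i) z xs + cob (G i) (\<lambda>xs. h (map (emb i) xs)) xs)"
    unfolding ceq_def
  proof safe
    fix xs assume xs: "set xs \<subseteq> carrier (G i)"
    have fxs: "set (map f xs) \<subseteq> carrier (G j)" using xs f.closed by auto
    have conj: "map (emb j) (map f xs) = map (\<lambda>x. inv\<^bsub>\<Gamma>\<^esub> (inv\<^bsub>\<Gamma>\<^esub> \<gamma>) \<otimes>\<^bsub>\<Gamma>\<^esub> x \<otimes>\<^bsub>\<Gamma>\<^esub> inv\<^bsub>\<Gamma>\<^esub> \<gamma>) (map (emb i) xs)"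
      using xs \<gamma> by auto
    have "set (map (emb i) xs) \<subseteq> carrier \<Gamma>" using xs i.closed by auto
    then have "int p dvd z (map (emb j) (map f xs)) - (z (map (emb i) xs) + cob \<Gamma> h (map (emb i) xs))"
      unfolding conj using h unfolding ceq_def by blast
    moreover have "cob \<Gamma> h (map (emb i) xs) = cob (G i) (\<lambda>xs. h (map (emb i) xs)) xs"
      using xs assms by (intro cob_map G_group emb_hom)
    ultimately show "int p dvd pullback (G j) (emb j) z (map f xs)
        - (pullback (G i) (emb i) z xs + cob (G i) (\<lambda>xs. h (map (emb i) xs)) xs)"
      using xs fxs by (simp only: pullback_def if_True)
  qed
  then have "res p (G i) f (j.P.cls (pullback (G j) (emb j) z)) = i.P.cls (pullback (G i) (emb i) z)"
    using assms(1) f.res_eq_iff[OF j.pullback_cocycle i.pullback_cocycle] by blast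
  then show ?thesis using assms(1) by (simp add: i.res_cls j.res_cls)
qed

lemma rho_closed: "x \<in> carrier H\<Gamma> \<Longrightarrow> R x \<in> carrier I"
proof -
  assume x: "x \<in> carrier H\<Gamma>"
  then obtain z where z: "z \<in> coh.Z" "x = coh.cls z" by (auto simp: coh.carrier_H)
  have "res p (G i) (emb i) x \<in> carrier (cohom_ring p (G i))" if "i \<in> Obj" for i
    using fp_hom.res_closed[OF emb_fp_hom[OF that] x] .
  then show ?thesis using z rho_compatible[OF z(1)] by (auto simp: rho_def)
qed

lemma rho_hom:
  "\<lbrakk>x \<in> carrier H\<Gamma>; y \<in> carrier H\<Gamma>\<rbrakk> \<Longrightarrow> R (x \<otimes>\<^bsub>H\<Gamma>\<^esub> y) = R x \<otimes>\<^bsub>I\<^esub> R y"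
  "\<lbrakk>x \<in> carrier H\<Gamma>; y \<in> carrier H\<Gamma>\<rbrakk> \<Longrightarrow> R (x \<oplus>\<^bsub>H\<Gamma>\<^esub> y) = R x \<oplus>\<^bsub>I\<^esub> R y"
  "R \<one>\<^bsub>H\<Gamma>\<^esub> = \<one>\<^bsub>I\<^esub>" "R \<zero>\<^bsub>H\<Gamma>\<^esub> = \<zero>\<^bsub>I\<^esub>"
  by (auto simp: rho_def fun_eq_iff fp_hom.res_mult[OF emb_fp_hom] fp_hom.res_add[OF emb_fp_hom]
      fp_hom.res_one[OF emb_fp_hom] fp_hom.res_zero[OF emb_fp_hom])

lemma trivial_hom: "i \<in> Obj \<Longrightarrow> (\<lambda>_. \<one>\<^bsub>G i\<^esub>) \<in> hom T (G i)"
  using G_group[of i] by (auto simp: hom_def group.is_monoid monoid.one_closed monoid.l_one)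

lemma emb_None: "set qs \<subseteq> carrier T \<Longrightarrow> i \<in> Obj \<Longrightarrow> map (\<iota> None) qs = map (emb i) (map (\<lambda>_. \<one>\<^bsub>G i\<^esub>) qs)"
  using coh.\<iota>_hom \<iota>_one[of "Some i"] \<iota>_one[of None] by (auto simp: V_def)

lemma kernel_square_zero:
  assumes "x \<in> carrier H\<Gamma>" "y \<in> carrier H\<Gamma>" "R x = \<zero>\<^bsub>I\<^esub>" "R y = \<zero>\<^bsub>I\<^esub>"
  shows "x \<otimes>\<^bsub>H\<Gamma>\<^esub> y = \<zero>\<^bsub>H\<Gamma>\<^esub>"
proof -
  obtain f g where fg: "f \<in> coh.Z" "g \<in> coh.Z" "x = coh.cls f" "y = coh.cls g"
    using assms by (auto simp: coh.carrier_H)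
  have bd: "\<exists>h. ceq p (P v) (\<lambda>qs. z (map (\<iota> v) qs)) (cob (P v) h)"
    if z: "z \<in> coh.Z" "R (coh.cls z) = \<zero>\<^bsub>I\<^esub>" and v: "v \<in> V" for z v
  proof -
    have obj: "\<exists>h. ceq p (G i) (\<lambda>qs. z (map (emb i) qs)) (cob (G i) h)" if i: "i \<in> Obj" for i
    proof -
      interpret i: fp_hom "G i" \<Gamma> p "emb i" using i by (intro emb_fp_hom)
      have "res p (G i) (emb i) (coh.cls z) = i.P.cls (\<lambda>_. 0)"
        using fun_cong[OF z(2), of i] i by (simp add: rho_def i.P.zero_H)
      then show ?thesis using i.res_eq_iff[OF z(1) i.P.zero_cocycle] by simp
    qed
    show ?thesis
    proof (cases v)
      case None
      \<comment> \<open>The trivial base group reaches Gamma through the identity of the object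
        \<open>i\<^sub>0\<close>, so a primitive on that object restricts to one at the base
        vertex.\<close>
      obtain h where h: "ceq p (G i\<^sub>0) (\<lambda>qs. z (map (emb i\<^sub>0) qs)) (cob (G i\<^sub>0) h)" using obj[OF i\<^sub>0] by blast
      have "ceq p T (\<lambda>qs. z (map (\<iota> None) qs)) (cob T (\<lambda>qs. h (map (\<lambda>_. \<one>\<^bsub>G i\<^sub>0\<^esub>) qs)))"
        unfolding ceq_def
      proof safe
        fix qs assume qs: "set qs \<subseteq> carrier T"
        have "set (map (\<lambda>_. \<one>\<^bsub>G i\<^sub>0\<^esub>) qs) \<subseteq> carrier (G i\<^sub>0)"
          using G_group[OF i\<^sub>0] by (auto simp: group.is_monoid monoid.one_closed)
        then have "int p dvd z (map (emb i\<^sub>0) (map (\<lambda>_. \<one>\<^bsub>G i\<^sub>0\<^esub>) qs)) - cob (G i\<^sub>0) h (map (\<lambda>_. \<one>\<^bsub>G i\<^sub>0\<^esub>) qs)"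
          using h unfolding ceq_def by blast
        then show "int p dvd z (map (\<iota> None) qs) - cob T (\<lambda>qs. h (map (\<lambda>_. \<one>\<^bsub>G i\<^sub>0\<^esub>) qs)) qs"
          unfolding emb_None[OF qs i\<^sub>0] cob_map[OF T_group trivial_hom[OF i\<^sub>0] qs] .
      qed
      then show ?thesis using None by auto
    next
      case (Some i)
      then show ?thesis using v obj by (auto simp: V_def)
    qed
  qed
  obtain m where m: "ceq p \<Gamma> (cp f g) (cob \<Gamma> m)"
    using coh.kernel_square_zero[of f g] bd fg assms(3,4) coh.cocycles_iff by auto
  have "coh.cls (cup p f g) = coh.cls (\<lambda>_. 0)"
  proof (rule coh.cls_eqI)
    show "ceq p \<Gamma> (cup p f g) (\<lambda>xs. 0 + cob \<Gamma> m xs)"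
      using ceq_trans[OF ceq_cup m] by simp
  qed (use fg coh.cup_cocycle coh.zero_cocycle in auto)
  then show ?thesis using fg by (simp add: coh.cls_mult coh.zero_H)
qed

text \<open>In degree 0 nothing is a coboundary, so a morphism forces equal values at its two ends
  and connectedness spreads the value. A single base vertex joined to all objects requires exactly
  this.\<close>

lemma degree_zero_constant:
  assumes z: "\<And>i. i \<in> Obj \<Longrightarrow> z i \<in> cocycles p (G i)"
    and compat: "\<And>i j f. \<lbrakk>i \<in> Obj; j \<in> Obj; f \<in> Mor i j\<rbrakk> \<Longrightarrow>
      \<exists>h. ceq p (G i) (\<lambda>qs. z j (map f qs)) (\<lambda>qs. z i qs + cob (G i) h qs)"
    and "i \<in> Obj"
  shows "z i [] = z i\<^sub>0 []"
proof -
  let ?E = "{(Q, Q'). Q \<in> Obj \<and> Q' \<in> Obj \<and> Mor Q Q' \<noteq> {}}"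
  have edge: "z j [] = z i []" if "(i, j) \<in> ?E" for i j
  proof -
    obtain f where f: "i \<in> Obj" "j \<in> Obj" "f \<in> Mor i j" using \<open>(i, j) \<in> ?E\<close> by auto
    obtain h where "ceq p (G i) (\<lambda>qs. z j (map f qs)) (\<lambda>qs. z i qs + cob (G i) h qs)"
      using compat[OF f] by blast
    then have "int p dvd z j [] - z i []" unfolding ceq_def by (metis add_0_right cob_Nil empty_subsetI list.map(1) set_empty)
    then show ?thesis
      using fp_group.cocycle_range[OF G_fp_group[OF f(1)] z[OF f(1)], of "[]"]
        fp_group.cocycle_range[OF G_fp_group[OF f(2)] z[OF f(2)], of "[]"]
      by (metis mod_eq_dvd_iff)
  qed
  have "(i\<^sub>0, i) \<in> (?E \<union> ?E\<inverse>)\<^sup>*"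
    using connected assms(3) by (simp add: connected_category_def Let_def)
  then show ?thesis
  proof (induction rule: rtrancl_induct)
    case (step j k)
    from step.hyps(2) consider "(j, k) \<in> ?E" | "(k, j) \<in> ?E" by blast
    then have "z k [] = z j []" by cases (rule edge, assumption, rule edge[symmetric], assumption)
    with step.IH show ?case by simp
  qed simp
qed

lemma rho_surjective:
  assumes "x \<in> carrier I"
  shows "x \<in> R ` carrier H\<Gamma>"
proof -
  have "\<forall>i\<in>Obj. \<exists>z. z \<in> cocycles p (G i) \<and> x i = fp_group.cls (G i) p z"
  proof
    fix i assume i: "i \<in> Obj"
    then have "x i \<in> carrier (cohom_ring p (G i))" using assms by auto
    then show "\<exists>z. z \<in> cocycles p (G i) \<and> x i = fp_group.cls (G i) p z"
      unfolding fp_group.carrier_H[OF G_fp_group[OF i]] by blast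
  qed
  then obtain z where z: "\<And>i. i \<in> Obj \<Longrightarrow> z i \<in> cocycles p (G i)"
    "\<And>i. i \<in> Obj \<Longrightarrow> x i = fp_group.cls (G i) p (z i)" by metis
  have compat: "\<exists>h. ceq p (G i) (\<lambda>qs. z j (map f qs)) (\<lambda>qs. z i qs + cob (G i) h qs)"
    if f: "i \<in> Obj" "j \<in> Obj" "f \<in> Mor i j" for i j f
  proof -
    have "res p (G i) f (x j) = x i" using assms f by auto
    then show ?thesis
      using fp_hom.res_eq_iff[OF Mor_fp_hom[OF f] z(1)[OF f(2)] z(1)[OF f(1)]] z(2) f by simp
  qed
  \<comment> \<open>The base vertex carries the common degree-0 value; on a trivial group every
    cocycle is cohomologous to its degree-0 part.\<close>
  define zv where "zv = case_option (\<lambda>qs::'a list. if qs = [] then z i\<^sub>0 [] else 0) z"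
  have "\<exists>y. coh.eq (cob \<Gamma> y) (\<lambda>_. 0) \<and>
    (\<forall>v\<in>V. \<exists>h. ceq p (P v) (\<lambda>qs. y (map (\<iota> v) qs)) (\<lambda>qs. zv v qs + cob (P v) h qs))"
  proof (rule coh.restriction_surjective)
    fix v assume v: "v \<in> V"
    show "ceq p (P v) (cob (P v) (zv v)) (\<lambda>_. 0)"
    proof (cases v)
      case None
      interpret T: fp_group T p by (intro fp_group.intro fp_group_axioms.intro T_group p_gt_1)
      have "ceq p T (cob T (\<lambda>qs. z i\<^sub>0 [] * (if qs = [] then 1 else 0))) (\<lambda>_. 0)"
      proof -
        have "cob T (\<lambda>qs. z i\<^sub>0 [] * (if qs = [] then 1 else 0)) qs = z i\<^sub>0 [] * cob T (\<lambda>qs. if qs = [] then 1 else 0) qs" for qs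
          by (cases qs) (simp_all add: cob_Cons bar_scale algebra_simps)
        then show ?thesis using T.one_cocycle unfolding T.cocycles_iff by (simp add: ceq_def)
      qed
      then show ?thesis using None by (simp add: zv_def if_distrib[of "(*) _"] cong: if_cong)
    next
      case (Some i)
      then show ?thesis using v z(1)[of i] fp_group.cocycles_iff[OF G_fp_group] by (auto simp: V_def zv_def)
    qed
  next
    fix e assume e: "e \<in> xedges"
    show "\<exists>y. ceq p (P (xsrc e)) (\<lambda>qs. zv (xtgt e) (map (x\<phi> e) qs))
       (\<lambda>qs. zv (xsrc e) qs + cob (P (xsrc e)) y qs)"
    proof (cases e)
      case (Inl v)
      then have "v \<in> V" "v \<noteq> None" using e by (auto simp: xedges_def)
      then obtain i where i: "v = Some i" "i \<in> Obj" by (auto simp: V_def)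
      have "ceq p T (cob T (\<lambda>qs. z i (map (\<lambda>_. \<one>\<^bsub>G i\<^esub>) qs))) (\<lambda>_. 0)"
        unfolding ceq_def
      proof safe
        fix qs assume qs: "set qs \<subseteq> carrier T"
        have "set (map (\<lambda>_. \<one>\<^bsub>G i\<^esub>) qs) \<subseteq> carrier (G i)"
          using G_group[OF i(2)] by (auto simp: group.is_monoid monoid.one_closed)
        moreover have "ceq p (G i) (cob (G i) (z i)) (\<lambda>_. 0)"
          using z(1)[OF i(2)] fp_group.cocycles_iff[OF G_fp_group[OF i(2)]] by blast
        ultimately show "int p dvd cob T (\<lambda>qs. z i (map (\<lambda>_. \<one>\<^bsub>G i\<^esub>) qs)) qs - 0"
          unfolding cob_map[OF T_group trivial_hom[OF i(2)] qs, of "z i", symmetric] ceq_def by blast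
      qed
      then obtain y where "ceq p T (\<lambda>qs. z i (map (\<lambda>_. \<one>\<^bsub>G i\<^esub>) qs))
          (\<lambda>qs. (if qs = [] then z i [] else 0) + cob T y qs)"
        using trivial_group_cohomology[OF T_group, of undefined p "\<lambda>qs. z i (map (\<lambda>_. \<one>\<^bsub>G i\<^esub>) qs)"]
        unfolding list.map by auto
      moreover have "z i [] = z i\<^sub>0 []"
        by (rule degree_zero_constant[of z]) (assumption | rule z(1) compat i(2))+
      ultimately show ?thesis
        unfolding Inl i(1) xdefs
        by (intro exI[of _ y]) (simp only: sum.case option.case P_simps T_simps zv_def)
    next
      case (Inr e')
      then have "e' \<in> E" using e by (auto simp: xedges_def)
      then show ?thesis
      proof (cases rule: edge_cases)
        case (mor i j f)
        then show ?thesis using Inr compat[of i j f] by (simp add: xdefs zv_def)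
      next
        case (loop \<sigma>)
        have "ceq p (P (xsrc e)) (\<lambda>qs. zv (xtgt e) (map (x\<phi> e) qs))
          (\<lambda>qs. zv (xsrc e) qs + cob (P (xsrc e)) (\<lambda>_. 0) qs)"
          using Inr loop by (simp add: ceq_def zv_def xdefs)
        then show ?thesis by blast
      qed
    qed
  qed
  then obtain y where y: "coh.eq (cob \<Gamma> y) (\<lambda>_. 0)"
    "\<And>v. v \<in> V \<Longrightarrow> \<exists>h. ceq p (P v) (\<lambda>qs. y (map (\<iota> v) qs)) (\<lambda>qs. zv v qs + cob (P v) h qs)"
    by blast
  have "\<forall>i\<in>Obj. \<exists>N. \<forall>xs. N < length xs \<longrightarrow> z i xs = 0"
    using z(1) fp_group.cocycles_iff[OF G_fp_group] fp_group.cochain_bound[OF G_fp_group] by blast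
  then obtain N where N: "\<And>i xs. \<lbrakk>i \<in> Obj; N i < length xs\<rbrakk> \<Longrightarrow> z i xs = 0" by metis
  define M where "M = Max (N ` Obj)"
  have M: "z i xs = 0" if "i \<in> Obj" "M < length xs" for i xs
  proof (rule N)
    have "N i \<le> M" unfolding M_def using finite_Obj that(1) by (intro Max_ge) auto
    then show "N i < length xs" using that(2) by simp
  qed (rule that(1))
  \<comment> \<open>\<open>y\<close> may live in infinitely many degrees, whereas all
    \<open>z i\<close> vanish above \<open>M\<close>. Cutting \<open>y\<close> at
    \<open>Suc M\<close> keeps each \<open>z i\<close> and cuts the primitives at \<open>M\<close>,
    so the restrictions keep their classes.\<close>
  define w where "w = cnorm p \<Gamma> (trunc (Suc M) y)"
  have "ceq p \<Gamma> (cob \<Gamma> w) (cob \<Gamma> (trunc (Suc M) y))"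
    unfolding w_def by (intro coh.ceq_cob ceq_cnorm)
  also have "ceq p \<Gamma> (cob \<Gamma> (trunc (Suc M) y)) (trunc (Suc (Suc M)) (\<lambda>_. 0))"
    unfolding cob_trunc[abs_def] using ceq_trunc[OF y(1)] .
  also have "trunc (Suc (Suc M)) (\<lambda>_. 0) = (\<lambda>_. 0)" by (auto simp: trunc_def)
  finally have w: "w \<in> coh.Z" unfolding coh.cocycles_iff by (simp add: w_def coh.trunc_cochain)
  have "R (coh.cls w) = x"
  proof
    fix i
    show "R (coh.cls w) i = x i"
    proof (cases "i \<in> Obj")
      case True
      interpret i: fp_hom "G i" \<Gamma> p "emb i" using True by (rule emb_fp_hom)
      obtain h where h: "ceq p (G i) (\<lambda>qs. y (map (emb i) qs)) (\<lambda>qs. z i qs + cob (G i) h qs)"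
        using y(2)[of "Some i"] True by (auto simp: V_def zv_def)
      have "ceq p (G i) (\<lambda>qs. w (map (emb i) qs)) (\<lambda>qs. trunc (Suc M) y (map (emb i) qs))"
        unfolding w_def by (rule ceq_map[OF i.closed ceq_cnorm])
      also have "(\<lambda>qs. trunc (Suc M) y (map (emb i) qs)) = trunc (Suc M) (\<lambda>qs. y (map (emb i) qs))"
        by (auto simp: trunc_def)
      also have "ceq p (G i) \<dots> (trunc (Suc M) (\<lambda>qs. z i qs + cob (G i) h qs))" by (rule ceq_trunc[OF h])
      also have "trunc (Suc M) (\<lambda>qs. z i qs + cob (G i) h qs) = (\<lambda>qs. z i qs + cob (G i) (trunc M h) qs)"
        using M[OF True] by (auto simp: trunc_def cob_trunc)
      finally have "res p (G i) (emb i) (coh.cls w) = i.P.cls (z i)"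
        using i.res_eq_iff[OF w z(1)[OF True]] by blast
      then show ?thesis using True z(2) by (simp add: rho_def)
    next
      case False
      have "x \<in> (\<Pi>\<^sub>E Q\<in>Obj. carrier (cohom_ring p (G Q)))" using assms unfolding I_simps by blast
      then have "x i = undefined" using False by (rule PiE_arb)
      then show ?thesis using False by (simp add: rho_def)
    qed
  qed
  then show ?thesis using w coh.cls_in_H by blast
qed

lemma rho_image: "R ` carrier H\<Gamma> = carrier I"
  using rho_closed rho_surjective by blast

end

theorem theorem1:
  fixes p :: nat and Obj :: "'i set" and G :: "'i \<Rightarrow> 'a monoid"
    and Mor :: "'i \<Rightarrow> 'i \<Rightarrow> ('a \<Rightarrow> 'a) set"
  assumes "Factorial_Ring.prime p"
    and "finite_inj_group_category Obj G Mor"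
    and "connected_category Obj Mor"
  shows "\<exists>(\<Gamma> :: nat monoid) (\<iota> :: 'i \<Rightarrow> 'a \<Rightarrow> nat).
    group \<Gamma> \<and>
    (\<forall>Q\<in>Obj. \<iota> Q \<in> hom (G Q) \<Gamma> \<and> inj_on (\<iota> Q) (carrier (G Q))) \<and>
    (\<forall>Q\<in>Obj. \<forall>Q'\<in>Obj. \<forall>\<phi>\<in>Mor Q Q'. \<exists>\<gamma>\<in>carrier \<Gamma>. \<forall>q\<in>carrier (G Q).
        \<iota> Q' (\<phi> q) = \<gamma> \<otimes>\<^bsub>\<Gamma>\<^esub> \<iota> Q q \<otimes>\<^bsub>\<Gamma>\<^esub> inv\<^bsub>\<Gamma>\<^esub> \<gamma>) \<and>
    rho p Obj G \<iota> ` carrier (cohom_ring p \<Gamma>) = carrier (compat_ring p Obj G Mor) \<and>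
    (\<forall>x\<in>a_kernel (cohom_ring p \<Gamma>) (compat_ring p Obj G Mor) (rho p Obj G \<iota>).
     \<forall>y\<in>a_kernel (cohom_ring p \<Gamma>) (compat_ring p Obj G Mor) (rho p Obj G \<iota>).
        x \<otimes>\<^bsub>cohom_ring p \<Gamma>\<^esub> y = \<zero>\<^bsub>cohom_ring p \<Gamma>\<^esub>) \<and>
    (\<exists>\<psi>. \<psi> \<in> ring_iso (cohom_ring p \<Gamma> Quot nilrad (cohom_ring p \<Gamma>))
                     (compat_ring p Obj G Mor Quot nilrad (compat_ring p Obj G Mor)) \<and>
         (\<forall>x\<in>carrier (cohom_ring p \<Gamma>).
            \<psi> (nilrad (cohom_ring p \<Gamma>) +>\<^bsub>cohom_ring p \<Gamma>\<^esub> x) =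
            nilrad (compat_ring p Obj G Mor) +>\<^bsub>compat_ring p Obj G Mor\<^esub> rho p Obj G \<iota> x)) \<and>
    (\<exists>N. N \<lhd> \<Gamma> \<and> finite (rcosets\<^bsub>\<Gamma>\<^esub> N) \<and> free_subgroup \<Gamma> N)"
proof -
  interpret finite_group_category p Obj G Mor using assms by unfold_locales
  have ker: "a_kernel H\<Gamma> I R = {x \<in> carrier H\<Gamma>. R x = \<zero>\<^bsub>I\<^esub>}"
    by (simp add: a_kernel_def kernel_def del: I_simps)
  show ?thesis
  proof (rule exI[of _ \<Gamma>], rule exI[of _ emb], intro conjI)
    show "group \<Gamma>" by (rule \<Gamma>.group_axioms)
    show "\<forall>Q\<in>Obj. emb Q \<in> hom (G Q) \<Gamma> \<and> inj_on (emb Q) (carrier (G Q))"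
      using emb_hom emb_inj by blast
    show "\<forall>Q\<in>Obj. \<forall>Q'\<in>Obj. \<forall>\<phi>\<in>Mor Q Q'. \<exists>\<gamma>\<in>carrier \<Gamma>. \<forall>q\<in>carrier (G Q).
        emb Q' (\<phi> q) = \<gamma> \<otimes>\<^bsub>\<Gamma>\<^esub> emb Q q \<otimes>\<^bsub>\<Gamma>\<^esub> inv\<^bsub>\<Gamma>\<^esub> \<gamma>"
      using emb_conj by blast
    show "R ` carrier H\<Gamma> = carrier I" by (rule rho_image)
    show "\<forall>x\<in>a_kernel H\<Gamma> I R. \<forall>y\<in>a_kernel H\<Gamma> I R. x \<otimes>\<^bsub>H\<Gamma>\<^esub> y = \<zero>\<^bsub>H\<Gamma>\<^esub>"
      unfolding ker using kernel_square_zero by blast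
    show "\<exists>\<psi>. \<psi> \<in> ring_iso (H\<Gamma> Quot nilrad H\<Gamma>) (I Quot nilrad I) \<and>
        (\<forall>x\<in>carrier H\<Gamma>. \<psi> (nilrad H\<Gamma> +>\<^bsub>H\<Gamma>\<^esub> x) = nilrad I +>\<^bsub>I\<^esub> R x)"
      by (intro nilradical_quotient_iso coh.ring_H rho_closed rho_hom rho_image kernel_square_zero)
    show "\<exists>N. N \<lhd> \<Gamma> \<and> finite (rcosets\<^bsub>\<Gamma>\<^esub> N) \<and> free_subgroup \<Gamma> N"
      using N_normal N_finite_index N_free by blast
  qed
qed

end
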